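(* Let $X_1=\mathbf C^4\times\{0\}$ and $X_2=\{0\}\times\mathbf C^4$ in $\mathbf C^8$, with standard holomorphic volume forms $\Omega_1=Z_1\wedge Z_2\wedge Z_3\wedge Z_4$, $\Omega_2=Z_5\wedge Z_6\wedge Z_7\wedge Z_8$ and standard Kähler forms $\omega_1,\omega_2$, and let $\omega=\omega_1+\omega_2$ be the standard Kähler form on $\mathbf C^8$. A plane $\xi\in\mathbf G(\mathbf C^8,8)$ is calibrated by \[ \Phi=\operatorname{Re}(\Omega_1\wedge\Omega_2)+\tfrac1{4!}\omega^4+\operatorname{Re}(\Omega_1+\Omega_2)\wedge\tfrac12\omega^2 \] (i.e. $\Phi(\xi)=1$) if and only if one of the following four cases holds: \begin{enumerate} \item[(1)] $\xi$ is a special Lagrangian $8$-plane. \item[(2)] $\xi$ is a complex $4$-plane. \item[(3)] $\xi=\xi_1\wedge\xi_2$, where each $\xi_i$ is a Cayley $4$-plane in $X_i$, i.e., $\xi_i\in\mathbf G(X_i,4)$ is calibrated by $\operatorname{Re}\Omega_i+\tfrac12\omega_i^2$. \item[(4)] $\xi$ admits a normal form representation (with unitary basis $e_1,\dots,e_8$ of $\mathbf C^8$ and characteristic angles $\theta_1,\dots,\theta_4$) with $\theta_1=\theta_2=\theta_3=\theta_4$ and \[ [e_1,\dots,e_8]=\operatorname{diag}(U_1,U_2)\,S, \] where $S\in\mathrm{Sp}(4)$ and $U_1,U_2\in\mathrm{SU}(4)$. \end{enumerate}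
   Context: $\mathbf C^8$ is identified with $\mathbf R^{16}$ with real inner product $\langle v,w\rangle=\operatorname{Re}H(v,w)$ and Kähler form $\omega=\operatorname{Im}H$, where $H(v,w)=\sum_j\bar v_jw_j$. $Z_1,\dots,Z_8$ are the complex coordinate functions, $\omega_1=\frac{\mathbf i}2\sum_{j=1}^4Z_j\wedge\bar Z_j$ and $\omega_2=\frac{\mathbf i}2\sum_{j=5}^8Z_j\wedge\bar Z_j$. $\mathbf G(V,m)$ is the set of simple real $m$-vectors $\xi=x_1\wedge\dots\wedge x_m$ in $V$ of Euclidean norm $1$ (oriented real $m$-planes); an $m$-form $\phi$ calibrates $\xi$ if $\phi(\xi)=1$. The wedge product is normalized by $\alpha\wedge\beta=\frac{(k+l)!}{k!\,l!}\operatorname{Alt}(\alpha\otimes\beta)$. A special Lagrangian $8$-plane is $\xi\in\mathbf G(\mathbf C^8,8)$ with $\operatorname{Re}(\Omega_1\wedge\Omega_2)(\xi)=1$. A complex $4$-plane is a $4$-dimensional complex subspace of $\mathbf C^8$ with its complex orientation, equivalently $\frac1{4!}\omega^4(\xi)=1$. Normal form: any $\xi\in\mathbf G(\mathbf C^8,8)$ can be written as \[ \begin{aligned} \xi={}&e_1\wedge(\mathbf ie_1\cos\theta_1+e_2\sin\theta_1)\wedge e_3\wedge(\mathbf ie_3\cos\theta_2+e_4\sin\theta_2)\\ &\wedge e_5\wedge(\mathbf ie_5\cos\theta_3+e_6\sin\theta_3)\wedge e_7\wedge(\mathbf ie_7\cos\theta_4+e_8\sin\theta_4) \end{aligned} \]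 for a unitary basis $e_1,\dots,e_8$ of $\mathbf C^8$ and angles $0\le\theta_1\le\theta_2\le\theta_3\le\frac\pi2$, $\theta_3\le\theta_4\le\pi$. $[e_1,\dots,e_8]$ denotes the complex $8\times8$ matrix with columns $e_1,\dots,e_8$. $\mathrm{Sp}(4)$ is the compact symplectic group, realized as the group of complex $8\times8$ unitary matrices $S$ with $S^TJ_8S=J_8$, where $J_8=\operatorname{diag}(J_2,J_2,J_2,J_2)$ and $J_2=\begin{pmatrix}0&1\\-1&0\end{pmatrix}$; equivalently the unitary matrices preserving $\sigma=Z_1\wedge Z_2+Z_3\wedge Z_4+Z_5\wedge Z_6+Z_7\wedge Z_8$. *)

theory Defs
  imports "HOL-Analysis.Analysis"
begin

section \<open>Alternating forms and multivectors\<close>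

text \<open>
  A covariant \<open>m\<close>-tensor on \<open>'v\<close> is a function on lists, of which only the values at lists
  of length \<open>m\<close> matter.  Since lists carry no degree in their type, the degrees of the factors are
  explicit arguments of the products below.
\<close>

definition alternating_form :: "nat \<Rightarrow> ('v::real_vector list \<Rightarrow> real) \<Rightarrow> bool" where
  "alternating_form m \<phi> \<longleftrightarrow>
     (\<forall>xs i. length xs = m \<and> i < m \<longrightarrow> linear (\<lambda>v. \<phi> (xs[i := v]))) \<and>
     (\<forall>xs i j. length xs = m \<and> i < j \<and> j < m \<and> xs ! i = xs ! j \<longrightarrow> \<phi> xs = 0)"

definition Alt :: "nat \<Rightarrow> ('v list \<Rightarrow> 'b::real_normed_field) \<Rightarrow> 'v list \<Rightarrow> 'b" where
  "Alt m T xs = (\<Sum>p | p permutes {..<m}. of_int (sign p) * T (permute_list p xs)) / fact m"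

definition tensor :: "nat \<Rightarrow> ('v list \<Rightarrow> 'b::real_normed_field) \<Rightarrow> ('v list \<Rightarrow> 'b) \<Rightarrow> 'v list \<Rightarrow> 'b" where
  "tensor k \<alpha> \<beta> xs = \<alpha> (take k xs) * \<beta> (drop k xs)"

definition wedge :: "('v list \<Rightarrow> 'b::real_normed_field) \<Rightarrow> nat \<Rightarrow> nat \<Rightarrow> ('v list \<Rightarrow> 'b) \<Rightarrow> 'v list \<Rightarrow> 'b"
    ("_ \<and>\<^bsub>_,_\<^esub> _" [76, 0, 0, 75] 75) where
  "(\<alpha> \<and>\<^bsub>k,l\<^esub> \<beta>) xs = fact (k + l) / (fact k * fact l) * Alt (k + l) (tensor k \<alpha> \<beta>) xs"

text \<open>\<open>wedge_power d \<alpha> n\<close> is the \<open>n\<close>-th exterior power of the \<open>d\<close>-form \<open>\<alpha>\<close>.\<close>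

fun wedge_power :: "nat \<Rightarrow> ('v list \<Rightarrow> 'b::real_normed_field) \<Rightarrow> nat \<Rightarrow> 'v list \<Rightarrow> 'b" where
  "wedge_power d \<alpha> 0 = (\<lambda>_. 1)"
| "wedge_power d \<alpha> (Suc n) = \<alpha> \<and>\<^bsub>d,d * n\<^esub> wedge_power d \<alpha> n"

text \<open>
  The \<open>m\<close>-vectors are the linear functionals on the alternating \<open>m\<close>-forms, extended by
  \<open>0\<close> to all other arguments; \<open>x\<^sub>1 \<and> \<dots> \<and> x\<^sub>m\<close> is the evaluation
  at \<open>(x\<^sub>1, \<dots>, x\<^sub>m)\<close>.  Hence \<open>\<phi>(\<xi>)\<close> is written \<open>\<xi> \<phi>\<close>, and two lists
  give the same simple \<open>m\<close>-vector iff no alternating form separates them.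
\<close>

type_synonym 'v multivector = "('v list \<Rightarrow> real) \<Rightarrow> real"

definition simple_vector :: "'v::real_vector list \<Rightarrow> 'v multivector" where
  "simple_vector xs \<phi> = (if alternating_form (length xs) \<phi> then \<phi> xs else 0)"

definition vwedge :: "'v::real_vector multivector \<Rightarrow> nat \<Rightarrow> nat \<Rightarrow> 'v multivector \<Rightarrow> 'v multivector" where
  "vwedge \<xi> k l \<eta> \<phi> =
     (if alternating_form (k + l) \<phi> then \<xi> (\<lambda>xs. \<eta> (\<lambda>ys. \<phi> (xs @ ys))) else 0)"

text \<open>The Euclidean norm of \<open>x\<^sub>1 \<and> \<dots> \<and> x\<^sub>m\<close>: the square root of the Gram determinant.\<close>

definition gram_det :: "'v::real_inner list \<Rightarrow> real" where
  "gram_det xs = (\<Sum>p | p permutes {..<length xs}.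
     of_int (sign p) * (\<Prod>i<length xs. xs ! i \<bullet> xs ! p i))"

definition simple_norm :: "'v::real_inner list \<Rightarrow> real" where
  "simple_norm xs = sqrt (gram_det xs)"

definition Grass :: "'v::real_inner set \<Rightarrow> nat \<Rightarrow> 'v multivector set" where
  "Grass V m = {simple_vector xs | xs. length xs = m \<and> set xs \<subseteq> V \<and> simple_norm xs = 1}"

definition calibrates :: "('v list \<Rightarrow> real) \<Rightarrow> 'v multivector \<Rightarrow> bool" where
  "calibrates \<phi> \<xi> \<longleftrightarrow> \<xi> \<phi> = 1"

lemma alternating_form_append_left:
  assumes "alternating_form (length xs + l) \<phi>"
  shows "alternating_form l (\<lambda>ys. \<phi> (xs @ ys))"
  unfolding alternating_form_def
proof (intro conjI allI impI)
  fix ys :: "'a list" and i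
  assume h: "length ys = l \<and> i < l"
  have "linear (\<lambda>v. \<phi> ((xs @ ys)[length xs + i := v]))"
    using assms h unfolding alternating_form_def by (metis add_less_cancel_left length_append)
  then show "linear (\<lambda>v. \<phi> (xs @ ys[i := v]))"
    by (simp add: list_update_append)
next
  fix ys :: "'a list" and i j
  assume h: "length ys = l \<and> i < j \<and> j < l \<and> ys ! i = ys ! j"
  have "\<forall>zs i j. length zs = length xs + l \<and> i < j \<and> j < length xs + l \<and> zs ! i = zs ! j
      \<longrightarrow> \<phi> zs = 0"
    using assms unfolding alternating_form_def by blast
  from this[rule_format, of "xs @ ys" "length xs + i" "length xs + j"] h
  show "\<phi> (xs @ ys) = 0" by simp
qed

lemma alternating_form_append_right:
  assumes "alternating_form (k + length ys) \<phi>"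
  shows "alternating_form k (\<lambda>xs. \<phi> (xs @ ys))"
  unfolding alternating_form_def
proof (intro conjI allI impI)
  fix xs :: "'a list" and i
  assume h: "length xs = k \<and> i < k"
  have "linear (\<lambda>v. \<phi> ((xs @ ys)[i := v]))"
    using assms h unfolding alternating_form_def by (metis length_append trans_less_add1)
  then show "linear (\<lambda>v. \<phi> (xs[i := v] @ ys))"
    using h by (simp add: list_update_append)
next
  fix xs :: "'a list" and i j
  assume h: "length xs = k \<and> i < j \<and> j < k \<and> xs ! i = xs ! j"
  have "\<forall>zs i j. length zs = k + length ys \<and> i < j \<and> j < k + length ys \<and> zs ! i = zs ! j
      \<longrightarrow> \<phi> zs = 0"
    using assms unfolding alternating_form_def by blast
  from this[rule_format, of "xs @ ys" i j] h
  show "\<phi> (xs @ ys) = 0" by (simp add: nth_append)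
qed

lemma alternating_form_cong:
  assumes \<phi>: "alternating_form m \<phi>" and eq: "\<And>xs. length xs = m \<Longrightarrow> \<phi> xs = \<psi> xs"
  shows "alternating_form m \<psi>"
  unfolding alternating_form_def
proof (intro conjI allI impI)
  fix xs :: "'a list" and i
  assume h: "length xs = m \<and> i < m"
  then have "(\<lambda>v. \<psi> (xs[i := v])) = (\<lambda>v. \<phi> (xs[i := v]))"
    by (intro ext eq[symmetric]) simp
  moreover have "linear (\<lambda>v. \<phi> (xs[i := v]))"
    using \<phi> h unfolding alternating_form_def by blast
  ultimately show "linear (\<lambda>v. \<psi> (xs[i := v]))"
    by (simp only:)
next
  fix xs :: "'a list" and i j
  assume h: "length xs = m \<and> i < j \<and> j < m \<and> xs ! i = xs ! j"
  then have "\<phi> xs = 0"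
    using \<phi> unfolding alternating_form_def by blast
  with eq[of xs] h show "\<psi> xs = 0" by simp
qed

lemma vwedge_simple:
  "vwedge (simple_vector xs) (length xs) (length ys) (simple_vector ys) = simple_vector (xs @ ys)"
proof
  fix \<phi> :: "'a list \<Rightarrow> real"
  show "vwedge (simple_vector xs) (length xs) (length ys) (simple_vector ys) \<phi> =
        simple_vector (xs @ ys) \<phi>"
  proof (cases "alternating_form (length xs + length ys) \<phi>")
    case True
    let ?\<psi> = "\<lambda>zs. simple_vector ys (\<lambda>ws. \<phi> (zs @ ws))"
    have eq: "?\<psi> zs = \<phi> (zs @ ys)" if "length zs = length xs" for zs
      using alternating_form_append_left[of zs "length ys" \<phi>] True that
      by (simp add: simple_vector_def)
    have "alternating_form (length xs) ?\<psi>"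
      by (rule alternating_form_cong[OF alternating_form_append_right[OF True] eq[symmetric]])
    then show ?thesis
      using True eq by (simp add: vwedge_def simple_vector_def)
  qed (simp add: vwedge_def simple_vector_def)
qed

section \<open>Forms on \<open>\<complex>\<^sup>8\<close>\<close>

text \<open>
  The index type \<open>8\<close> is the integers modulo 8, so the index \<open>8\<close> is \<open>0\<close> and intervals
  such as \<open>{5..8}\<close> are empty; index ranges are therefore enumerated.  The real inner product
  \<open>\<bullet>\<close> of the type is the real part of the hermitian form below, and \<open>*s\<close> is complex scalar
  multiplication.
\<close>

type_synonym C8 = "complex ^ 8"

definition herm :: "complex ^ 'n \<Rightarrow> complex ^ 'n \<Rightarrow> complex" where
  "herm v w = (\<Sum>j\<in>UNIV. cnj (v $ j) * w $ j)"

lemma inner_eq_Re_herm: "v \<bullet> w = Re (herm v w)"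
  by (simp add: herm_def inner_vec_def inner_complex_def)

definition Z :: "8 \<Rightarrow> C8 list \<Rightarrow> complex" where
  "Z j xs = xs ! 0 $ j"

definition Zbar :: "8 \<Rightarrow> C8 list \<Rightarrow> complex" where
  "Zbar j xs = cnj (Z j xs)"

definition X1 :: "C8 set" where
  "X1 = {v. \<forall>j\<in>{5, 6, 7, 8}. v $ j = 0}"

definition X2 :: "C8 set" where
  "X2 = {v. \<forall>j\<in>{1, 2, 3, 4}. v $ j = 0}"

definition \<Omega>1 :: "C8 list \<Rightarrow> complex" where
  "\<Omega>1 = Z 1 \<and>\<^bsub>1,3\<^esub> (Z 2 \<and>\<^bsub>1,2\<^esub> (Z 3 \<and>\<^bsub>1,1\<^esub> Z 4))"

definition \<Omega>2 :: "C8 list \<Rightarrow> complex" where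
  "\<Omega>2 = Z 5 \<and>\<^bsub>1,3\<^esub> (Z 6 \<and>\<^bsub>1,2\<^esub> (Z 7 \<and>\<^bsub>1,1\<^esub> Z 8))"

text \<open>
  The complex-valued form \<open>\<i>/2 \<Sum> Z\<^sub>j \<and> Zbar\<^sub>j\<close> takes real values
  (lemma \<open>kahler_complex\<close>); \<open>Re\<close> only turns it into a real-valued form.
\<close>

definition kahler :: "8 set \<Rightarrow> C8 list \<Rightarrow> real" where
  "kahler A xs = Re (\<i> / 2 * (\<Sum>j\<in>A. (Z j \<and>\<^bsub>1,1\<^esub> Zbar j) xs))"

definition \<omega>1 :: "C8 list \<Rightarrow> real" where
  "\<omega>1 = kahler {1, 2, 3, 4}"

definition \<omega>2 :: "C8 list \<Rightarrow> real" where
  "\<omega>2 = kahler {5, 6, 7, 8}"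

definition \<omega> :: "C8 list \<Rightarrow> real" where
  "\<omega> xs = \<omega>1 xs + \<omega>2 xs"

definition \<Phi> :: "C8 list \<Rightarrow> real" where
  "\<Phi> xs = Re ((\<Omega>1 \<and>\<^bsub>4,4\<^esub> \<Omega>2) xs)
         + 1 / fact 4 * wedge_power 2 \<omega> 4 xs
         + ((\<lambda>ys. Re (\<Omega>1 ys + \<Omega>2 ys)) \<and>\<^bsub>4,4\<^esub> (\<lambda>ys. 1 / 2 * wedge_power 2 \<omega> 2 ys)) xs"

lemma wedge_1_1:
  fixes \<alpha> \<beta> :: "'v list \<Rightarrow> 'b::real_normed_field"
  shows "(\<alpha> \<and>\<^bsub>1,1\<^esub> \<beta>) [v, w] = \<alpha> [v] * \<beta> [w] - \<alpha> [w] * \<beta> [v]"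
proof -
  have "{..<2::nat} = {0, 1}" by auto
  then have perms: "{p. p permutes {..<2::nat}} = {id, Transposition.transpose 0 1}"
    by (auto simp: permutes_doubleton_iff)
  have ne: "(id :: nat \<Rightarrow> nat) \<noteq> Transposition.transpose 0 1"
    by (metis id_apply transpose_apply_first zero_neq_one)
  have upt: "[0..<2] = [0, Suc 0]" by (simp add: upt_rec)
  show ?thesis
    using ne
    by (simp add: upt wedge_def Alt_def tensor_def perms permute_list_def sign_swap_id sign_id
        flip: numeral_2_eq_2)
qed

lemma kahler_complex:
  "\<i> / 2 * (\<Sum>j\<in>A. (Z j \<and>\<^bsub>1,1\<^esub> Zbar j) [v, w]) = of_real (kahler A [v, w])"
  "kahler A [v, w] = Im (\<Sum>j\<in>A. cnj (v $ j) * w $ j)"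
proof -
  have t: "\<i> / 2 * (Z j \<and>\<^bsub>1,1\<^esub> Zbar j) [v, w] = of_real (Im (cnj (v $ j) * w $ j))" for j
    unfolding wedge_1_1 by (simp add: Z_def Zbar_def complex_eq_iff)
  have "\<i> / 2 * (\<Sum>j\<in>A. (Z j \<and>\<^bsub>1,1\<^esub> Zbar j) [v, w]) = of_real (Im (\<Sum>j\<in>A. cnj (v $ j) * w $ j))"
    unfolding sum_distrib_left t by simp
  then show "kahler A [v, w] = Im (\<Sum>j\<in>A. cnj (v $ j) * w $ j)"
    "\<i> / 2 * (\<Sum>j\<in>A. (Z j \<and>\<^bsub>1,1\<^esub> Zbar j) [v, w]) = of_real (kahler A [v, w])"
    by (simp_all add: kahler_def)
qed

lemma UNIV_8_enum: "(UNIV :: 8 set) = {1, 2, 3, 4} \<union> {5, 6, 7, 8}"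
  by (rule sym, rule card_subset_eq) simp_all

lemma \<omega>_eq_Im_herm: "\<omega> [v, w] = Im (herm v w)"
  unfolding \<omega>_def \<omega>1_def \<omega>2_def kahler_complex herm_def UNIV_8_enum
  by (subst sum.union_disjoint) simp_all

section \<open>The planes\<close>

definition special_lagrangian :: "C8 multivector \<Rightarrow> bool" where
  "special_lagrangian \<xi> \<longleftrightarrow>
     \<xi> \<in> Grass UNIV 8 \<and> calibrates (\<lambda>xs. Re ((\<Omega>1 \<and>\<^bsub>4,4\<^esub> \<Omega>2) xs)) \<xi>"

text \<open>
  \<open>vec.subspace\<close>, \<open>vec.span\<close>, \<open>vec.dim\<close> refer to the complex vector space structure.  The complex
  orientation of a subspace with complex basis \<open>v\<^sub>1, \<dots>, v\<^sub>k\<close> is the one for which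
  \<open>v\<^sub>1, \<i>v\<^sub>1, \<dots>, v\<^sub>k, \<i>v\<^sub>k\<close> is a positive real basis.
\<close>

definition complex_plane :: "nat \<Rightarrow> C8 multivector \<Rightarrow> bool" where
  "complex_plane k \<xi> \<longleftrightarrow>
     (\<exists>W. vec.subspace W \<and> vec.dim W = k \<and> \<xi> \<in> Grass W (2 * k) \<and>
        (\<exists>vs c. distinct vs \<and> length vs = k \<and> vec.independent (set vs) \<and> vec.span (set vs) = W \<and>
           0 < c \<and> \<xi> = (\<lambda>\<phi>. c * simple_vector (concat (map (\<lambda>v. [v, \<i> *s v]) vs)) \<phi>)))"

definition cayley1 :: "C8 multivector \<Rightarrow> bool" where
  "cayley1 \<xi> \<longleftrightarrow>
     \<xi> \<in> Grass X1 4 \<and> calibrates (\<lambda>xs. Re (\<Omega>1 xs) + 1 / 2 * wedge_power 2 \<omega>1 2 xs) \<xi>"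

definition cayley2 :: "C8 multivector \<Rightarrow> bool" where
  "cayley2 \<xi> \<longleftrightarrow>
     \<xi> \<in> Grass X2 4 \<and> calibrates (\<lambda>xs. Re (\<Omega>2 xs) + 1 / 2 * wedge_power 2 \<omega>2 2 xs) \<xi>"

definition unitary_basis :: "('n \<Rightarrow> complex ^ 'n) \<Rightarrow> bool" where
  "unitary_basis e \<longleftrightarrow> (\<forall>i j. herm (e i) (e j) = (if i = j then 1 else 0))"

definition normal_form ::
    "C8 multivector \<Rightarrow> (8 \<Rightarrow> C8) \<Rightarrow> real \<Rightarrow> real \<Rightarrow> real \<Rightarrow> real \<Rightarrow> bool" where
  "normal_form \<xi> e \<theta>1 \<theta>2 \<theta>3 \<theta>4 \<longleftrightarrow>
     unitary_basis e \<and>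
     0 \<le> \<theta>1 \<and> \<theta>1 \<le> \<theta>2 \<and> \<theta>2 \<le> \<theta>3 \<and> \<theta>3 \<le> pi / 2 \<and> \<theta>3 \<le> \<theta>4 \<and> \<theta>4 \<le> pi \<and>
     \<xi> = simple_vector
       [e 1, cos \<theta>1 *\<^sub>R (\<i> *s e 1) + sin \<theta>1 *\<^sub>R e 2,
        e 3, cos \<theta>2 *\<^sub>R (\<i> *s e 3) + sin \<theta>2 *\<^sub>R e 4,
        e 5, cos \<theta>3 *\<^sub>R (\<i> *s e 5) + sin \<theta>3 *\<^sub>R e 6,
        e 7, cos \<theta>4 *\<^sub>R (\<i> *s e 7) + sin \<theta>4 *\<^sub>R e 8]"

section \<open>Matrix groups\<close>

definition adjoint_matrix :: "complex ^ 'n ^ 'm \<Rightarrow> complex ^ 'm ^ 'n" where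
  "adjoint_matrix A = (\<chi> i j. cnj (A $ j $ i))"

definition unitary_matrix :: "complex ^ 'n ^ 'n \<Rightarrow> bool" where
  "unitary_matrix A \<longleftrightarrow> adjoint_matrix A ** A = mat 1 \<and> A ** adjoint_matrix A = mat 1"

definition SU4 :: "(complex ^ 4 ^ 4) set" where
  "SU4 = {U. unitary_matrix U \<and> det U = 1}"

definition J8 :: "complex ^ 8 ^ 8" where
  "J8 = (\<chi> i j. if (i, j) \<in> {(1, 2), (3, 4), (5, 6), (7, 8)} then 1
               else if (j, i) \<in> {(1, 2), (3, 4), (5, 6), (7, 8)} then - 1 else 0)"

definition Sp4 :: "(complex ^ 8 ^ 8) set" where
  "Sp4 = {S. unitary_matrix S \<and> Finite_Cartesian_Product.transpose S ** J8 ** S = J8}"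

text \<open>Position of an index within its block \<open>{1, 2, 3, 4}\<close> or \<open>{5, 6, 7, 8}\<close>.\<close>

definition block_pos :: "8 \<Rightarrow> 4" where
  "block_pos i = (if i \<in> {1, 5} then 1 else if i \<in> {2, 6} then 2 else if i \<in> {3, 7} then 3 else 4)"

definition block_diag :: "complex ^ 4 ^ 4 \<Rightarrow> complex ^ 4 ^ 4 \<Rightarrow> complex ^ 8 ^ 8" where
  "block_diag A B = (\<chi> i j.
     if i \<in> {1, 2, 3, 4} \<and> j \<in> {1, 2, 3, 4} then A $ block_pos i $ block_pos j
     else if i \<in> {5, 6, 7, 8} \<and> j \<in> {5, 6, 7, 8} then B $ block_pos i $ block_pos j
     else 0)"

definition matrix_of_columns :: "('n \<Rightarrow> 'a ^ 'm) \<Rightarrow> 'a ^ 'n ^ 'm" where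
  "matrix_of_columns e = (\<chi> i j. e j $ i)"

end

theory Submission
  imports Defs
begin

text \<open>
  A plane with characteristic angles \<open>\<theta>\<^sub>j\<close>, unitary basis \<open>e\<close>, \<open>c\<^sub>j = cos \<theta>\<^sub>j\<close> and \<open>s\<^sub>j = sin \<theta>\<^sub>j\<close> has
  \<open>\<Phi> = c\<^sub>1c\<^sub>2c\<^sub>3c\<^sub>4 + s\<^sub>1s\<^sub>2s\<^sub>3s\<^sub>4 Re \<delta> + \<Sum> s\<^sub>ls\<^sub>mc\<^sub>jc\<^sub>k Re (A\<^sub>l\<^sub>m + D\<^sub>l\<^sub>m)\<close>, where \<open>\<delta> = det e\<close> and \<open>A\<^sub>l\<^sub>m\<close>, \<open>D\<^sub>l\<^sub>m\<close>
  are the values of \<open>\<Omega>1\<close>, \<open>\<Omega>2\<close> on the pairs \<open>l, m\<close> of basis vectors.  Jacobi's identity gives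
  \<open>D\<^sub>l\<^sub>m = \<delta> cnj A\<^sub>j\<^sub>k\<close> for complementary pairs.  For unimodular \<open>t\<close> the sum \<open>\<Sum> t\<^sub>lt\<^sub>m A\<^sub>l\<^sub>m\<close> is the Pfaffian of a
  \<open>4 \<times> 4\<close> block of a unitary skew matrix, hence at most 1 in modulus.  Choosing the phases shows that
  \<open>\<beta>\<^sub>k = cnj \<kappa> A\<^sub>l\<^sub>m + \<kappa> cnj A\<^sub>j\<^sub>k\<close>, with \<open>\<kappa>\<^sup>2 = \<delta>\<close> and \<open>k\<close> running over the three pairings of the four planes,
  satisfies \<open>\<Sum> |\<beta>\<^sub>k| \<le> 1\<close>, and \<open>\<Phi>\<close> is a convex combination with weights \<open>|\<beta>\<^sub>k|\<close> and \<open>1 - \<Sum> |\<beta>\<^sub>k|\<close> of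
  the numbers \<open>Re ((c\<^sub>lc\<^sub>m + z s\<^sub>ls\<^sub>m)(c\<^sub>jc\<^sub>k + z' s\<^sub>js\<^sub>k))\<close> with \<open>|z| = |z'| = 1\<close> and of
  \<open>c\<^sub>1c\<^sub>2c\<^sub>3c\<^sub>4 + s\<^sub>1s\<^sub>2s\<^sub>3s\<^sub>4 Re \<delta>\<close>, all of them at most 1.

  In the equality case, positive weight on the last number gives complex and special Lagrangian
  planes.  A single pairing with \<open>|\<beta>\<^sub>k| = 1\<close> forces, by Hadamard's inequality, the unitary basis to split
  along \<open>X1\<close> and \<open>X2\<close>.  Two pairings of positive weight force equal angles, and then the Pfaffian bound is
  sharp, which makes the diagonal blocks of \<open>E J8 E\<^sup>T\<close> unitary and its other blocks zero.
\<close>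

section \<open>Alternating forms and wedge products\<close>


text \<open>The wedge product is a sum over all permutations, and eight slots give 8! of them; the
  forms are therefore evaluated only on lists whose Kaehler matrix consists of 2 x 2 blocks, where
  few cosets contribute. Instead of ordered angles the proof uses unit pairs (c_j, s_j) in any
  order: the three pairings are interchanged by permuting the four planes, which would destroy the
  order, and the order returns only in the case of equal angles, where it is trivial. Orientation is
  carried by the sign of c4, which the equality cases have to recover. The root \<kappa> of \<delta>
  lets one number govern both coefficients of a pairing: for complementary minors A, A' Jacobi gives
  them as Re (A + \<delta> cnj A') = Re (\<kappa> \<beta>) and Re (A' + \<delta> cnj A) = Re
  (\<kappa> cnj \<beta>). The bound on the sum of the |\<beta>_k| prescribes three phases at once,
  and the four free phases t_j can meet them. In the Hadamard step the terms of |A| + |A'| belong to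
  different quadruples of vectors; Jacobi's |D| = |A'| brings them to the same one.\<close>

definition multilin :: "('s::comm_ring_1 \<Rightarrow> 'v::ab_group_add \<Rightarrow> 'v) \<Rightarrow> nat \<Rightarrow> ('v list \<Rightarrow> 's) \<Rightarrow> bool" where
  "multilin sc m f \<longleftrightarrow>
     (\<forall>xs i u v. length xs = m \<and> i < m \<longrightarrow> f (xs[i := u + v]) = f (xs[i := u]) + f (xs[i := v])) \<and>
     (\<forall>xs i c u. length xs = m \<and> i < m \<longrightarrow> f (xs[i := sc c u]) = c * f (xs[i := u]))"

text \<open>The scalar multiplication is a parameter because the same lemmas serve real forms such
  as \<open>\<omega>\<close> and complex-multilinear forms such as \<open>\<Omega>1\<close>.\<close>

definition alt_form :: "('s::comm_ring_1 \<Rightarrow> 'v::ab_group_add \<Rightarrow> 'v) \<Rightarrow> nat \<Rightarrow> ('v list \<Rightarrow> 's) \<Rightarrow> bool" where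
  "alt_form sc m f \<longleftrightarrow> multilin sc m f \<and>
     (\<forall>xs i j. length xs = m \<and> i < j \<and> j < m \<and> xs ! i = xs ! j \<longrightarrow> f xs = 0)"

text \<open>Linearity is left out on purpose: counting cosets in a wedge product uses only the sign
  change under swaps.\<close>

definition antisym_form :: "nat \<Rightarrow> ('v list \<Rightarrow> 's::comm_ring_1) \<Rightarrow> bool" where
  "antisym_form m f \<longleftrightarrow>
     (\<forall>xs i j. length xs = m \<and> i < m \<and> j < m \<and> i \<noteq> j \<longrightarrow> f (xs[i := xs ! j, j := xs ! i]) = - f xs)"

lemma multilinD:
  assumes "multilin sc m f" "length xs = m" "i < m"
  shows "f (xs[i := u + v]) = f (xs[i := u]) + f (xs[i := v])"
    "f (xs[i := sc c u]) = c * f (xs[i := u])"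
  using assms unfolding multilin_def by blast+

lemma alternating_form_iff_alt_form: "alternating_form m \<phi> \<longleftrightarrow> alt_form (*\<^sub>R) m \<phi>"
  unfolding alternating_form_def alt_form_def multilin_def linear_iff real_scaleR_def by (simp only: imp_conjR all_conj_distrib) blast

lemma alt_formD:
  assumes "alt_form sc m f"
  shows "multilin sc m f"
    "length xs = m \<Longrightarrow> i < m \<Longrightarrow> j < m \<Longrightarrow> i \<noteq> j \<Longrightarrow> xs ! i = xs ! j \<Longrightarrow> f xs = 0"
proof -
  show "multilin sc m f" using assms unfolding alt_form_def by blast
  assume h: "length xs = m" "i < m" "j < m" "i \<noteq> j" "xs ! i = xs ! j"
  consider "i < j" | "j < i" using h(4) by linarith
  then show "f xs = 0"
    using assms h unfolding alt_form_def by cases metis+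
qed

lemma multilin_cong:
  assumes "multilin sc m f" "\<And>xs. length xs = m \<Longrightarrow> f xs = g xs"
  shows "multilin sc m g"
  using assms(1) assms(2)[symmetric] unfolding multilin_def by simp

lemma alt_form_cong:
  assumes "alt_form sc m f" "\<And>xs. length xs = m \<Longrightarrow> f xs = g xs"
  shows "alt_form sc m g"
  using assms(1) multilin_cong[OF _ assms(2), of sc] assms(2)[symmetric] unfolding alt_form_def by simp

lemma alt_form_antisym:
  assumes "alt_form sc m f"
  shows "antisym_form m f"
  unfolding antisym_form_def
proof (intro allI impI, elim conjE)
  fix xs :: "'b list" and i j
  assume l: "length xs = m" "i < m" "j < m" "i \<noteq> j"
  note M = multilinD[OF alt_formD(1)[OF assms]]
  let ?a = "xs ! i" and ?b = "xs ! j"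
  let ?F = "\<lambda>a b. f (xs[i := a, j := b])"
  have addl: "?F (a + a') b = ?F a b + ?F a' b" for a a' b
    using M(1)[of "xs[j := b]" i a a'] l by (simp add: list_update_swap[of i j])
  have addr: "?F a (b + b') = ?F a b + ?F a b'" for a b b'
    using M(1)[of "xs[i := a]" j b b'] l by simp
  have diag: "?F a a = 0" for a
    by (rule alt_formD(2)[OF assms, of _ i j]) (use l in auto)
  have "0 = ?F (?a + ?b) (?a + ?b)" using diag by simp
  also have "\<dots> = ?F ?b ?a + ?F ?a ?b" unfolding addl addr using diag[of ?a] diag[of ?b] by (simp only: add_0_left add_0_right)
  finally have "?F ?b ?a = - ?F ?a ?b" by (metis eq_neg_iff_add_eq_0)
  then show "f (xs[i := xs ! j, j := xs ! i]) = - f xs" by simp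
qed

lemma permute_list_transpose:
  assumes "i < length xs" "j < length xs"
  shows "permute_list (Transposition.transpose i j) xs = xs[i := xs ! j, j := xs ! i]"
  using assms by (intro nth_equalityI)
    (auto simp: permute_list_def nth_list_update Transposition.transpose_def)

lemma sign_transpose_compose:
  fixes S :: "'i set"
  assumes "finite S" "p permutes S"
  shows "sign (Transposition.transpose a b \<circ> p) = (if a = b then sign p else - sign p)"
proof -
  have "permutation p" using assms permutation_permutes by blast
  then show ?thesis by (simp add: sign_compose permutation_swap_id sign_swap_id)
qed

text \<open>Restricting the swaps to a set \<open>A\<close> of positions makes this applicable to a
  tensor product, which is antisymmetric in its first \<open>k\<close> and in its last
  \<open>l\<close> slots separately but not jointly.\<close>

lemma antisym_on_permute:
  fixes f :: "'v list \<Rightarrow> 's::comm_ring_1"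
  assumes A: "A \<subseteq> {..<n}"
    and f: "\<And>xs i j. length xs = n \<Longrightarrow> i \<in> A \<Longrightarrow> j \<in> A \<Longrightarrow> i \<noteq> j \<Longrightarrow>
           f (xs[i := xs ! j, j := xs ! i]) = - f xs"
    and p: "p permutes A" and l: "length xs = n"
  shows "f (permute_list p xs) = of_int (sign p) * f xs"
proof -
  have "finite A" using A finite_subset by blast
  from p this show ?thesis using l
  proof (induction arbitrary: xs rule: permutes_induct)
    case id then show ?case by (simp add: sign_id)
  next
    case (swap a b p)
    have ab: "a < n" "b < n" using A swap.hyps by auto
    have pn: "p permutes {..<n}" using swap.hyps A permutes_subset by blast
    have "permute_list (Transposition.transpose a b \<circ> p) xs =
        permute_list p (permute_list (Transposition.transpose a b) xs)"
      using pn swap.prems by (intro permute_list_compose) simp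
    moreover have "f (permute_list p (permute_list (Transposition.transpose a b) xs)) =
        of_int (sign p) * f (permute_list (Transposition.transpose a b) xs)"
      using swap by simp
    moreover have "f (permute_list (Transposition.transpose a b) xs) = - f xs"
      using f[of xs a b] swap ab by (simp add: permute_list_transpose)
    moreover have "sign (Transposition.transpose a b \<circ> p) = - sign p"
      using sign_transpose_compose[OF _ pn] swap.hyps by simp
    ultimately show ?case by (simp del: o_apply only: of_int_minus minus_mult_left mult_minus_right)
  qed
qed

lemma antisym_permute:
  assumes "antisym_form m f" "p permutes {..<m}" "length xs = m"
  shows "f (permute_list p xs) = of_int (sign p) * f xs"
  using antisym_on_permute[of "{..<m}" m f p xs] assms unfolding antisym_form_def by auto

lemma permute_list_update:
  assumes "p permutes {..<length xs}" "i < length xs"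
  shows "permute_list p (xs[i := v]) = (permute_list p xs)[inv p i := v]"
proof (rule nth_equalityI)
  fix j assume "j < length (permute_list p (xs[i := v]))"
  then have j: "j < length xs" by simp
  have pj: "p j < length xs" using permutes_in_image[OF assms(1)] j by simp
  have "inv p i = j \<longleftrightarrow> i = p j" using permutes_inverses[OF assms(1)] by metis
  then show "permute_list p (xs[i := v]) ! j = (permute_list p xs)[inv p i := v] ! j"
    using assms j pj by (auto simp: permute_list_nth nth_list_update)
qed simp

lemma multilin_permute:
  assumes "multilin sc m T" "p permutes {..<m}"
  shows "multilin sc m (\<lambda>xs. T (permute_list p xs))"
proof -
  have i: "inv p i < m" if "i < m" for i
    using permutes_in_image[OF permutes_inv[OF assms(2)], of i] that by simp
  show ?thesis
    unfolding multilin_def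
    using assms(2) i multilinD[OF assms(1)] by (auto simp: permute_list_update)
qed

lemma multilin_sum:
  assumes "\<And>p. p \<in> P \<Longrightarrow> multilin sc m (T p)"
  shows "multilin sc m (\<lambda>xs. \<Sum>p\<in>P. T p xs)"
  unfolding multilin_def using multilinD[OF assms]
  by (auto simp: sum.distrib sum_distrib_left intro!: sum.cong)

lemma multilin_cmult:
  assumes "multilin sc m T"
  shows "multilin sc m (\<lambda>xs. a * T xs)"
  unfolding multilin_def using multilinD[OF assms] by (auto simp: algebra_simps)

lemma multilin_add:
  assumes "multilin sc m T" "multilin sc m T'"
  shows "multilin sc m (\<lambda>xs. T xs + T' xs)"
  unfolding multilin_def using multilinD[OF assms(1)] multilinD[OF assms(2)]
  by (auto simp: algebra_simps)

lemma alt_form_cmult: "alt_form sc m f \<Longrightarrow> alt_form sc m (\<lambda>xs. a * f xs)"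
  unfolding alt_form_def using multilin_cmult by fastforce

lemma alt_form_add: "alt_form sc m f \<Longrightarrow> alt_form sc m g \<Longrightarrow> alt_form sc m (\<lambda>xs. f xs + g xs)"
  unfolding alt_form_def using multilin_add by fastforce

lemma alt_form_Alt:
  fixes T :: "'v::ab_group_add list \<Rightarrow> 'b::real_normed_field"
  assumes "multilin sc m T"
  shows "alt_form sc m (Alt m T)"
  unfolding alt_form_def
proof (intro conjI allI impI, goal_cases)
  case 1
  have "multilin sc m (\<lambda>xs. inverse (fact m) *
      (\<Sum>p | p permutes {..<m}. of_int (sign p) * T (permute_list p xs)))"
    by (intro multilin_cmult multilin_sum multilin_permute assms) simp
  then show ?case by (rule multilin_cong) (simp add: Alt_def field_simps)
next
  case (2 xs i j)
  then have l: "length xs = m" "i < m" "j < m" "i \<noteq> j" "xs ! i = xs ! j" by auto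
  let ?t = "Transposition.transpose i j"
  let ?P = "{p. p permutes {..<m}}"
  let ?g = "\<lambda>p. of_int (sign p) * T (permute_list p xs)"
  have t: "?t permutes {..<m}" using l by (intro permutes_swap_id) auto
  have fix_xs: "permute_list ?t xs = xs"
    using l by (simp add: permute_list_transpose) (metis list_update_id)
  \<comment> \<open>The transposition of the two equal entries fixes the list and reverses every
    sign, so the sum equals its own negative.\<close>
  have "(\<Sum>p\<in>?P. ?g p) = (\<Sum>p\<in>?P. ?g (?t \<circ> p))"
    by (rule setum_permutations_compose_left[OF t])
  also have "\<dots> = (\<Sum>p\<in>?P. - ?g p)"
  proof (rule sum.cong[OF refl])
    fix p assume "p \<in> ?P"
    then have p: "p permutes {..<m}" by simp
    have "permute_list (?t \<circ> p) xs = permute_list p xs"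
      using p l fix_xs by (subst permute_list_compose) auto
    moreover have "sign (?t \<circ> p) = - sign p"
      using sign_transpose_compose[OF _ p] l by simp
    ultimately show "?g (?t \<circ> p) = - ?g p" by simp
  qed
  finally have "(\<Sum>p\<in>?P. ?g p) = - (\<Sum>p\<in>?P. ?g p)" by (simp only: sum_negf)
  moreover have "x = 0" if "x = - x" for x :: 'b
    using that by (simp add: eq_neg_iff_add_eq_0 flip: mult_2)
  ultimately have "(\<Sum>p\<in>?P. ?g p) = 0" by blast
  then show ?case by (simp add: Alt_def)
qed

lemma multilin_tensor:
  fixes \<alpha> \<beta> :: "'v::ab_group_add list \<Rightarrow> 'b::real_normed_field"
  assumes "multilin sc k \<alpha>" "multilin sc l \<beta>"
  shows "multilin sc (k + l) (tensor k \<alpha> \<beta>)"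
proof -
  have t: "take k (xs[i := v]) = (if i < k then (take k xs)[i := v] else take k xs)" (is ?t)
    "drop k (xs[i := v]) = (if i < k then drop k xs else (drop k xs)[i - k := v])" (is ?d) for xs :: "'v list" and i v
  proof -
    show ?t by (cases "i < k") (simp_all add: take_update_swap[symmetric] del: take_update_cancel, simp)
    show ?d by (auto simp: drop_update_swap)
  qed
  show ?thesis
    unfolding multilin_def tensor_def t
    using multilinD[OF assms(1)] multilinD[OF assms(2)] by (auto simp: algebra_simps)
qed

lemma alt_form_wedge:
  fixes \<alpha> \<beta> :: "'v::ab_group_add list \<Rightarrow> 'b::real_normed_field"
  assumes "multilin sc k \<alpha>" "multilin sc l \<beta>"
  shows "alt_form sc (k + l) (\<alpha> \<and>\<^bsub>k,l\<^esub> \<beta>)"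
  by (rule alt_form_cong[OF alt_form_cmult[OF alt_form_Alt[OF multilin_tensor[OF assms]],
      of "fact (k + l) / (fact k * fact l)"]]) (simp add: wedge_def)

lemma alt_form_wedge_power:
  fixes \<alpha> :: "'v::ab_group_add list \<Rightarrow> 'b::real_normed_field"
  assumes "multilin sc d \<alpha>"
  shows "alt_form sc (d * n) (wedge_power d \<alpha> n)"
proof (induction n)
  case 0 show ?case by (simp add: alt_form_def multilin_def)
next
  case (Suc n)
  show ?case using alt_form_wedge[OF assms alt_formD(1)[OF Suc]] by simp
qed


section \<open>Wedge products as sums over coset representatives\<close>

lemma permutes_split_image:
  assumes q: "q permutes {..<n}" and qk: "q ` {..<k} = {..<k}" and k: "k \<le> (n::nat)"
  obtains q1 q2 where "q1 permutes {..<k}" "q2 permutes {k..<n}" "q = q1 \<circ> q2"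
proof
  define q1 where "q1 = (\<lambda>i. if i < k then q i else i)"
  define q2 where "q2 = (\<lambda>i. if i < k then i else q i)"
  have inj: "inj q" using q permutes_inj by blast
  have lt: "q i < k \<longleftrightarrow> i < k" for i
    using qk inj by (metis imageE image_eqI inj_eq lessThan_iff)
  show "q1 permutes {..<k}"
  proof (rule bij_imp_permutes)
    have "bij_betw q {..<k} {..<k}"
      using inj_on_subset[OF inj subset_UNIV] qk unfolding bij_betw_def by blast
    moreover have "bij_betw q1 {..<k} {..<k} = bij_betw q {..<k} {..<k}"
      by (rule bij_betw_cong) (simp add: q1_def)
    ultimately show "bij_betw q1 {..<k} {..<k}" by blast
  qed (simp add: q1_def)
  show "q2 permutes {k..<n}"
  proof (rule bij_imp_permutes)
    have "q ` {k..<n} = {k..<n}"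
    proof -
      have "{k..<n} = {..<n} - {..<k}" using k by auto
      then show ?thesis using image_set_diff[OF inj, of "{..<n}" "{..<k}"] qk permutes_image[OF q] by simp
    qed
    then have "bij_betw q {k..<n} {k..<n}"
      using inj_on_subset[OF inj subset_UNIV] unfolding bij_betw_def by blast
    moreover have "bij_betw q2 {k..<n} {k..<n} = bij_betw q {k..<n} {k..<n}"
      by (rule bij_betw_cong) (simp add: q2_def)
    ultimately show "bij_betw q2 {k..<n} {k..<n}" by blast
    show "q2 x = x" if "x \<notin> {k..<n}" for x
      using that q k unfolding q2_def by (auto simp: permutes_def)
  qed
  show "q = q1 \<circ> q2" using lt by (auto simp: fun_eq_iff q1_def q2_def)
qed

lemma card_permutes_stabilizer:
  assumes k: "k \<le> (n::nat)"
  shows "card {q. q permutes {..<n} \<and> q ` {..<k} = {..<k}} = fact k * fact (n - k)"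
proof -
  let ?A = "{q. q permutes {..<k}}" and ?B = "{q. q permutes {k..<n}}"
  let ?c = "\<lambda>(q1, q2). q1 \<circ> q2"
  have im: "{q. q permutes {..<n} \<and> q ` {..<k} = {..<k}} = ?c ` (?A \<times> ?B)"
  proof (intro equalityI subsetI)
    fix q assume "q \<in> {q. q permutes {..<n} \<and> q ` {..<k} = {..<k}}"
    then obtain q1 q2 where "q1 permutes {..<k}" "q2 permutes {k..<n}" "q = q1 \<circ> q2"
      using permutes_split_image[OF _ _ k] by blast
    then show "q \<in> ?c ` (?A \<times> ?B)" by auto
  next
    fix q assume "q \<in> ?c ` (?A \<times> ?B)"
    then obtain q1 q2 where q: "q1 permutes {..<k}" "q2 permutes {k..<n}" "q = q1 \<circ> q2" by auto
    have "q1 permutes {..<n}" "q2 permutes {..<n}"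
      using permutes_subset[OF q(1), of "{..<n}"] permutes_subset[OF q(2), of "{..<n}"] k
      by (simp_all add: subset_eq)
    then have "q permutes {..<n}" using q(3) permutes_compose by blast
    moreover have "q2 ` {..<k} = {..<k}"
      using q(2) by (auto simp: permutes_def image_iff)
    then have "q ` {..<k} = {..<k}" using q(3) permutes_image[OF q(1)] by (simp only: image_comp[symmetric])
    ultimately show "q \<in> {q. q permutes {..<n} \<and> q ` {..<k} = {..<k}}" by simp
  qed
  have "inj_on ?c (?A \<times> ?B)"
  proof (rule inj_onI, clarify)
    fix q1 q2 r1 r2 :: "nat \<Rightarrow> nat"
    assume h: "q1 permutes {..<k}" "q2 permutes {k..<n}" "r1 permutes {..<k}" "r2 permutes {k..<n}"
      and eq: "q1 \<circ> q2 = r1 \<circ> r2"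
    have "q1 i = r1 i" for i
    proof (cases "i < k")
      case True
      then have "q2 i = i" "r2 i = i" using h by (simp_all add: permutes_def)
      then show ?thesis using fun_cong[OF eq, of i] by simp
    qed (use h in \<open>simp add: permutes_def\<close>)
    then have "q1 = r1" by (rule ext)
    have "q2 x = r2 x" for x
      using fun_cong[OF eq, of x] permutes_inj[OF h(1)] \<open>q1 = r1\<close> by (simp add: inj_eq)
    then show "q1 = r1 \<and> q2 = r2" using \<open>q1 = r1\<close> by blast
  qed
  then show ?thesis
    unfolding im by (simp add: card_image card_cartesian_product card_permutations)
qed

text \<open>
  The summand of \<open>Alt\<close> is constant on the left cosets of the stabilizer of \<open>{..<k}\<close>, and these
  cosets are the fibres of \<open>p \<mapsto> p ` {..<k}\<close>; so a system of representatives suffices.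
\<close>

lemma wedge_representatives:
  fixes \<alpha> \<beta> :: "'v list \<Rightarrow> 'b::real_normed_field"
  assumes \<alpha>: "antisym_form k \<alpha>" and \<beta>: "antisym_form l \<beta>" and len: "length xs = k + l"
    and R: "finite R" "\<And>p. p \<in> R \<Longrightarrow> p permutes {..<k + l}" "inj_on (\<lambda>p. p ` {..<k}) R"
    and zero: "\<And>p. p permutes {..<k + l} \<Longrightarrow> p ` {..<k} \<notin> (\<lambda>p. p ` {..<k}) ` R \<Longrightarrow>
      \<alpha> (take k (permute_list p xs)) * \<beta> (drop k (permute_list p xs)) = 0"
  shows "(\<alpha> \<and>\<^bsub>k,l\<^esub> \<beta>) xs =
    (\<Sum>p\<in>R. of_int (sign p) * (\<alpha> (take k (permute_list p xs)) * \<beta> (drop k (permute_list p xs))))"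
proof -
  let ?n = "k + l"
  let ?P = "{p. p permutes {..<?n}}"
  let ?H = "{q. q permutes {..<?n} \<and> q ` {..<k} = {..<k}}"
  let ?im = "\<lambda>p :: nat \<Rightarrow> nat. p ` {..<k}"
  let ?f = "\<lambda>ys. \<alpha> (take k ys) * \<beta> (drop k ys)"
  let ?g = "\<lambda>p. of_int (sign p) * ?f (permute_list p xs)"
  have fP: "finite ?P" by (simp add: finite_permutations)
  have f1: "?f (permute_list q ys) = of_int (sign q) * ?f ys"
    if "q permutes {..<k}" "length ys = ?n" for q ys
  proof (rule antisym_on_permute[where n = ?n, OF _ _ that])
    fix zs :: "'v list" and i j
    assume z: "length zs = ?n" "i \<in> {..<k}" "j \<in> {..<k}" "i \<noteq> j"
    then have "take k (zs[i := zs ! j, j := zs ! i]) = (take k zs)[i := take k zs ! j, j := take k zs ! i]"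
      "drop k (zs[i := zs ! j, j := zs ! i]) = drop k zs"
      by (auto simp: take_update_swap)
    moreover have "\<alpha> ((take k zs)[i := take k zs ! j, j := take k zs ! i]) = - \<alpha> (take k zs)"
      using \<alpha> z unfolding antisym_form_def by (simp del: nth_take)
    ultimately show "?f (zs[i := zs ! j, j := zs ! i]) = - ?f zs"
      by (simp only: minus_mult_left)
  qed auto
  have f2: "?f (permute_list q ys) = of_int (sign q) * ?f ys"
    if "q permutes {k..<?n}" "length ys = ?n" for q ys
  proof (rule antisym_on_permute[where n = ?n, OF _ _ that])
    fix zs :: "'v list" and i j
    assume z: "length zs = ?n" "i \<in> {k..<?n}" "j \<in> {k..<?n}" "i \<noteq> j"
    then have "drop k (zs[i := zs ! j, j := zs ! i]) =
        (drop k zs)[i - k := drop k zs ! (j - k), j - k := drop k zs ! (i - k)]"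
      "take k (zs[i := zs ! j, j := zs ! i]) = take k zs"
      by (auto simp: drop_update_swap)
    moreover have "i - k < l" "j - k < l" "i - k \<noteq> j - k" "length (drop k zs) = l" using z by auto
    then have "\<beta> ((drop k zs)[i - k := drop k zs ! (j - k), j - k := drop k zs ! (i - k)]) = - \<beta> (drop k zs)"
      using \<beta> unfolding antisym_form_def by blast
    ultimately show "?f (zs[i := zs ! j, j := zs ! i]) = - ?f zs"
      by (simp only: mult_minus_right)
  qed auto
  have cH: "card ?H = fact k * fact l" using card_permutes_stabilizer[of k ?n] by simp
  have inv: "?g (p \<circ> q) = ?g p" if p: "p \<in> ?P" and q: "q \<in> ?H" for p q
  proof -
    obtain q1 q2 where q12: "q1 permutes {..<k}" "q2 permutes {k..<?n}" "q = q1 \<circ> q2"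
      using permutes_split_image[of q ?n k] q by auto
    have qn: "q1 permutes {..<?n}" "q2 permutes {..<?n}" "q permutes {..<?n}" "p permutes {..<?n}"
      using permutes_subset[OF q12(1), of "{..<?n}"] permutes_subset[OF q12(2), of "{..<?n}"] q p
      by (simp_all add: subset_eq)
    have perm: "permutation q1" "permutation q2" "permutation p" "permutation q"
      using qn permutation_permutes by blast+
    let ?ys = "permute_list p xs"
    have "?f (permute_list (p \<circ> q) xs) = ?f (permute_list q2 (permute_list q1 ?ys))"
      using qn q12 len by (simp add: permute_list_compose)
    also have "\<dots> = of_int (sign q1 * sign q2) * ?f ?ys"
      using f1[OF q12(1), of ?ys] f2[OF q12(2), of "permute_list q1 ?ys"] len by simp
    also have "sign q1 * sign q2 = sign q"
      using q12(3) perm by (simp add: sign_compose)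
    finally have "?g (p \<circ> q) = of_int (sign p * sign q) * (of_int (sign q) * ?f ?ys)"
      using perm by (simp only: sign_compose)
    also have "\<dots> = of_int (sign p) * of_int (sign q * sign q) * ?f ?ys"
      by (simp only: of_int_mult mult.assoc)
    finally show ?thesis by (simp only: sign_idempotent of_int_1 mult_1_right)
  qed
  \<comment> \<open>A fibre is a left coset of the stabilizer, so it has k! l! elements, all with
    the same summand.\<close>
  have fibre: "(\<Sum>p | p \<in> ?P \<and> ?im p = ?im p0. ?g p) = of_nat (fact k * fact l) * ?g p0"
    if p0: "p0 \<in> ?P" for p0
  proof -
    have inj0: "inj p0" using p0 permutes_inj by blast
    have eq: "{p \<in> ?P. ?im p = ?im p0} = (\<lambda>q. p0 \<circ> q) ` ?H"
    proof (intro equalityI subsetI)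
      fix p assume p: "p \<in> {p \<in> ?P. ?im p = ?im p0}"
      have "inv p0 \<circ> p permutes {..<?n}" using p p0 permutes_compose permutes_inv by blast
      moreover have "(inv p0 \<circ> p) ` {..<k} = {..<k}"
        using p inj0 by (simp add: image_comp[symmetric] image_inv_f_f del: o_apply)
      moreover have "p = p0 \<circ> (inv p0 \<circ> p)" using p0 by (simp add: o_assoc permutes_inv_o)
      ultimately show "p \<in> (\<lambda>q. p0 \<circ> q) ` ?H" by blast
    next
      fix p assume "p \<in> (\<lambda>q. p0 \<circ> q) ` ?H"
      then obtain q where q: "q permutes {..<?n}" "q ` {..<k} = {..<k}" "p = p0 \<circ> q" by auto
      have "p ` {..<k} = p0 ` {..<k}" using q by (simp only: image_comp[symmetric])
      then show "p \<in> {p \<in> ?P. ?im p = ?im p0}"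
        using p0 q permutes_compose[of q "{..<?n}" p0] by simp
    qed
    have inj: "inj_on (\<lambda>q. p0 \<circ> q) ?H"
      using inj0 by (intro inj_onI) (simp add: fun_eq_iff inj_eq)
    have "(\<Sum>p | p \<in> ?P \<and> ?im p = ?im p0. ?g p) = (\<Sum>q\<in>?H. ?g (p0 \<circ> q))"
      unfolding eq by (subst sum.reindex[OF inj]) (simp only: o_def)
    also have "\<dots> = (\<Sum>q\<in>?H. ?g p0)" by (intro sum.cong refl inv p0)
    finally show ?thesis by (simp only: sum_constant cH)
  qed
  have "(\<Sum>p\<in>?P. ?g p) = (\<Sum>p | p \<in> ?P \<and> ?im p \<in> ?im ` R. ?g p)"
    by (rule sum.mono_neutral_right[OF fP]) (use zero in auto)
  also have "\<dots> = (\<Sum>S\<in>?im ` R. \<Sum>p | p \<in> {p. p \<in> ?P \<and> ?im p \<in> ?im ` R} \<and> ?im p = S. ?g p)"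
    by (rule sum.group[symmetric]) (use R fP in auto)
  also have "\<dots> = (\<Sum>p0\<in>R. \<Sum>p | p \<in> {p. p \<in> ?P \<and> ?im p \<in> ?im ` R} \<and> ?im p = ?im p0. ?g p)"
    by (subst sum.reindex[OF R(3)]) (simp only: o_def)
  also have "\<dots> = (\<Sum>p0\<in>R. \<Sum>p | p \<in> ?P \<and> ?im p = ?im p0. ?g p)"
  proof (rule sum.cong[OF refl])
    fix p0 assume "p0 \<in> R"
    then have "{p. p \<in> {p. p \<in> ?P \<and> ?im p \<in> ?im ` R} \<and> ?im p = ?im p0} = {p. p \<in> ?P \<and> ?im p = ?im p0}"
      by blast
    then show "(\<Sum>p | p \<in> {p. p \<in> ?P \<and> ?im p \<in> ?im ` R} \<and> ?im p = ?im p0. ?g p) =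
        (\<Sum>p | p \<in> ?P \<and> ?im p = ?im p0. ?g p)" by (rule arg_cong)
  qed
  also have "\<dots> = (\<Sum>p0\<in>R. of_nat (fact k * fact l) * ?g p0)"
    using R(2) by (intro sum.cong refl fibre) auto
  \<comment> \<open>The factor k! l! is exactly what the normalization of the wedge product divides
    by.\<close>
  finally have "(\<Sum>p\<in>?P. ?g p) = fact k * fact l * (\<Sum>p0\<in>R. ?g p0)"
    by (simp add: sum_distrib_left)
  then show ?thesis
    by (simp add: wedge_def Alt_def tensor_def)
qed


text \<open>The case of a single representative \<open>id\<close>, for arguments on which every
  other coset contributes zero.\<close>

lemma wedge_first_block:
  fixes \<alpha> \<beta> :: "'v list \<Rightarrow> 'b::real_normed_field"
  assumes "antisym_form k \<alpha>" "antisym_form l \<beta>" "length xs = k + l"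
    and "\<And>p. p permutes {..<k + l} \<Longrightarrow> p ` {..<k} \<noteq> {..<k} \<Longrightarrow>
      \<alpha> (take k (permute_list p xs)) * \<beta> (drop k (permute_list p xs)) = 0"
  shows "(\<alpha> \<and>\<^bsub>k,l\<^esub> \<beta>) xs = \<alpha> (take k xs) * \<beta> (drop k xs)"
  using wedge_representatives[OF assms(1-3), of "{id}"] assms(4) by (simp add: permutes_id)

text \<open>A coset is determined by the index moved into slot 0, so the transpositions of 0 and i
  represent all of them. Taking these instead of cyclic shifts makes every sign but the first
  negative and explains the argument order in the formulas that follow.\<close>

lemma wedge_1_representatives:
  fixes \<alpha> \<beta> :: "'v list \<Rightarrow> 'b::real_normed_field"
  assumes \<alpha>: "antisym_form 1 \<alpha>" and \<beta>: "antisym_form l \<beta>" and len: "length xs = 1 + l"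
  shows "(\<alpha> \<and>\<^bsub>1,l\<^esub> \<beta>) xs = (\<Sum>i<1 + l. (if i = 0 then 1 else - 1) *
    (\<alpha> (take 1 (permute_list (Transposition.transpose 0 i) xs)) *
     \<beta> (drop 1 (permute_list (Transposition.transpose 0 i) xs))))"
proof -
  let ?t = "\<lambda>i::nat. Transposition.transpose 0 i"
  have im: "?t i ` {..<1} = {i}" for i by auto
  have inj: "inj_on ?t A" for A using im by (metis inj_onI the_elem_eq)
  have inj': "inj_on (\<lambda>p. p ` {..<1}) (?t ` A)" for A
    by (rule inj_onI) (use im in auto)
  have "(\<alpha> \<and>\<^bsub>1,l\<^esub> \<beta>) xs = (\<Sum>p\<in>?t ` {..<1 + l}. of_int (sign p) *
    (\<alpha> (take 1 (permute_list p xs)) * \<beta> (drop 1 (permute_list p xs))))"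
  proof (rule wedge_representatives[OF \<alpha> \<beta> len _ _ inj'], goal_cases)
    case (2 p)
    then show ?case by (auto intro!: permutes_swap_id)
  next
    case (3 p)
    have "p ` {..<1} = {p 0}" by auto
    moreover have "p 0 < 1 + l" using permutes_in_image[OF 3(1), of 0] by simp
    ultimately have "p ` {..<1} \<in> (\<lambda>p. p ` {..<1}) ` ?t ` {..<1 + l}"
      using im by (auto simp: image_image)
    with 3(2) show ?case by blast
  qed simp
  also have "\<dots> = (\<Sum>i<1 + l. of_int (sign (?t i)) *
    (\<alpha> (take 1 (permute_list (?t i) xs)) * \<beta> (drop 1 (permute_list (?t i) xs))))"
    by (subst sum.reindex[OF inj]) (simp only: o_def)
  also have "\<dots> = (\<Sum>i<1 + l. (if i = 0 then 1 else - 1) *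
    (\<alpha> (take 1 (permute_list (?t i) xs)) * \<beta> (drop 1 (permute_list (?t i) xs))))"
    by (rule sum.cong) (auto simp: sign_swap_id)
  finally show ?thesis .
qed

lemma lessThan_small: "{..<4::nat} = {0,1,2,3}" "{..<3::nat} = {0,1,2}" "{..<2::nat} = {0,1}" "{..<8::nat} = {0,1,2,3,4,5,6,7}"
  by auto

lemma upt_small: "[0..<2] = [0,1]" "[0..<3] = [0,1,2]" "[0..<4] = [0,1,2,3]" "[0..<8] = [0,1,2,3,4,5,6,7]"
  by (simp_all add: upt_rec)

lemma permute_list_small:
  "permute_list p [a, b] = [[a, b] ! p 0, [a, b] ! p 1]"
  "permute_list p [a, b, c] = [[a, b, c] ! p 0, [a, b, c] ! p 1, [a, b, c] ! p 2]"
  "permute_list p [a, b, c, d] = [[a, b, c, d] ! p 0, [a, b, c, d] ! p 1, [a, b, c, d] ! p 2, [a, b, c, d] ! p 3]"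
  "permute_list p [a, b, c, d, e, f, g, h] =
     [[a, b, c, d, e, f, g, h] ! p 0, [a, b, c, d, e, f, g, h] ! p 1, [a, b, c, d, e, f, g, h] ! p 2,
      [a, b, c, d, e, f, g, h] ! p 3, [a, b, c, d, e, f, g, h] ! p 4, [a, b, c, d, e, f, g, h] ! p 5,
      [a, b, c, d, e, f, g, h] ! p 6, [a, b, c, d, e, f, g, h] ! p 7]"
proof -
  have *: "length [a, b] = 2" "length [a, b, c] = 3" "length [a, b, c, d] = 4"
    "length [a, b, c, d, e, f, g, h] = 8" by simp_all
  show "permute_list p [a, b] = [[a, b] ! p 0, [a, b] ! p 1]"
    "permute_list p [a, b, c] = [[a, b, c] ! p 0, [a, b, c] ! p 1, [a, b, c] ! p 2]"
    "permute_list p [a, b, c, d] = [[a, b, c, d] ! p 0, [a, b, c, d] ! p 1, [a, b, c, d] ! p 2, [a, b, c, d] ! p 3]"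
    "permute_list p [a, b, c, d, e, f, g, h] =
     [[a, b, c, d, e, f, g, h] ! p 0, [a, b, c, d, e, f, g, h] ! p 1, [a, b, c, d, e, f, g, h] ! p 2,
      [a, b, c, d, e, f, g, h] ! p 3, [a, b, c, d, e, f, g, h] ! p 4, [a, b, c, d, e, f, g, h] ! p 5,
      [a, b, c, d, e, f, g, h] ! p 6, [a, b, c, d, e, f, g, h] ! p 7]"
    unfolding permute_list_def * upt_small by (simp_all only: list.map)
qed

lemma wedge_1_2:
  fixes \<alpha> \<beta> :: "'v list \<Rightarrow> 'b::real_normed_field"
  assumes "antisym_form 1 \<alpha>" "antisym_form 2 \<beta>"
  shows "(\<alpha> \<and>\<^bsub>1,2\<^esub> \<beta>) [a, b, c] = \<alpha> [a] * \<beta> [b, c] - \<alpha> [b] * \<beta> [a, c] - \<alpha> [c] * \<beta> [b, a]"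
proof -
  have "{..<1 + 2::nat} = {0, 1, 2}" by auto
  then show ?thesis
    by (subst wedge_1_representatives[OF assms])
      (simp_all add: permute_list_small Transposition.transpose_def)
qed

lemma wedge_1_3:
  fixes \<alpha> \<beta> :: "'v list \<Rightarrow> 'b::real_normed_field"
  assumes "antisym_form 1 \<alpha>" "antisym_form 3 \<beta>"
  shows "(\<alpha> \<and>\<^bsub>1,3\<^esub> \<beta>) [a, b, c, d] = \<alpha> [a] * \<beta> [b, c, d] - \<alpha> [b] * \<beta> [a, c, d]
    - \<alpha> [c] * \<beta> [b, a, d] - \<alpha> [d] * \<beta> [b, c, a]"
proof -
  have "{..<1 + 3::nat} = {0, 1, 2, 3}" by auto
  then show ?thesis
    by (subst wedge_1_representatives[OF assms])
      (simp_all add: permute_list_small Transposition.transpose_def)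
qed

text \<open>One representative for each two-element subset of the four slots. Four of them are
  single transpositions; the identity and the one that exchanges both pairs are even.\<close>

lemma wedge_2_2:
  fixes \<alpha> \<beta> :: "'v list \<Rightarrow> 'b::real_normed_field"
  assumes \<alpha>: "antisym_form 2 \<alpha>" and \<beta>: "antisym_form 2 \<beta>"
  shows "(\<alpha> \<and>\<^bsub>2,2\<^esub> \<beta>) [a, b, c, d] = \<alpha> [a, b] * \<beta> [c, d] - \<alpha> [a, c] * \<beta> [b, d]
    - \<alpha> [a, d] * \<beta> [c, b] - \<alpha> [c, b] * \<beta> [a, d] - \<alpha> [d, b] * \<beta> [c, a] + \<alpha> [c, d] * \<beta> [a, b]"
proof -
  let ?t = "Transposition.transpose :: nat \<Rightarrow> _"
  let ?rs = "[id, ?t 1 2, ?t 1 3, ?t 0 2, ?t 0 3, ?t 0 2 \<circ> ?t 1 3]"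
  let ?R = "set ?rs"
  have n: "{..<2 + 2 :: nat} = {0, 1, 2, 3}" by auto
  have perm: "p permutes {0, 1, 2, 3}" if "p \<in> ?R" for p
    using that by (auto intro!: permutes_swap_id permutes_compose permutes_id)
  have ims: "map (\<lambda>p. p ` {..<2}) ?rs = [{0, 1}, {0, 2}, {0, 3}, {1, 2}, {1, 3}, {2, 3}]"
    by (auto simp: lessThan_small Transposition.transpose_def)
  have dist: "distinct (map (\<lambda>p. p ` {..<2}) ?rs)" unfolding ims by (simp add: doubleton_eq_iff)
  then have dist': "distinct ?rs" and inj: "inj_on (\<lambda>p. p ` {..<2}) ?R"
    unfolding distinct_map by blast+
  have sg: "sign (?t 0 2 \<circ> ?t 1 3) = 1"
    by (simp add: sign_compose permutation_swap_id sign_swap_id)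
  have "(\<alpha> \<and>\<^bsub>2,2\<^esub> \<beta>) [a, b, c, d] = (\<Sum>p\<in>?R. of_int (sign p) *
     (\<alpha> (take 2 (permute_list p [a, b, c, d])) * \<beta> (drop 2 (permute_list p [a, b, c, d]))))"
  proof (rule wedge_representatives[OF \<alpha> \<beta> _ _ _ inj], goal_cases)
    case (3 p)
    then show ?case using perm unfolding n by blast
  next
    case (4 p)
    have "p ` {..<2} = {p 0, p 1}" by (auto simp: lessThan_small)
    moreover have "p 0 \<in> {0,1,2,3}" "p 1 \<in> {0,1,2,3}" "p 0 \<noteq> p 1"
      using permutes_in_image[OF 4(1)] inj_eq[OF permutes_inj[OF 4(1)]] unfolding n by (simp_all del: insert_iff, auto)
    moreover have "{x, y} \<in> set [{0, 1}, {0, 2}, {0, 3}, {1, 2}, {1, 3}, {2, 3}]"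
      if "x \<in> {0,1,2,3}" "y \<in> {0,1,2,3}" "x \<noteq> y" for x y :: nat
      using that by (elim insertE emptyE; simp add: doubleton_eq_iff)
    ultimately have "p ` {..<2} \<in> set [{0, 1}, {0, 2}, {0, 3}, {1, 2}, {1, 3}, {2, 3}]" by metis
    then have "p ` {..<2} \<in> (\<lambda>p. p ` {..<2}) ` ?R" unfolding ims[symmetric] by simp
    with 4(2) show ?case by blast
  qed simp_all
  also have "\<dots> = sum_list (map (\<lambda>p. of_int (sign p) *
     (\<alpha> (take 2 (permute_list p [a, b, c, d])) * \<beta> (drop 2 (permute_list p [a, b, c, d])))) ?rs)"
    by (rule sum_list_distinct_conv_sum_set[OF dist', symmetric])
  also have "\<dots> = \<alpha> [a, b] * \<beta> [c, d] - \<alpha> [a, c] * \<beta> [b, d]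
    - \<alpha> [a, d] * \<beta> [c, b] - \<alpha> [c, b] * \<beta> [a, d] - \<alpha> [d, b] * \<beta> [c, a] + \<alpha> [c, d] * \<beta> [a, b]"
    using sg by (simp add: permute_list_small Transposition.transpose_def sign_swap_id del: permute_list_id)
  finally show ?thesis .
qed


text \<open>Block diagonality for the slot pairs (0, 1), (2, 3) and so on; the entry inside a pair
  is unrestricted.\<close>

definition adapted :: "('v list \<Rightarrow> 'b::zero) \<Rightarrow> 'v list \<Rightarrow> bool" where
  "adapted \<alpha> xs \<longleftrightarrow> (\<forall>i<length xs. \<forall>j<length xs. i div 2 \<noteq> j div 2 \<longrightarrow> \<alpha> [xs ! i, xs ! j] = 0)"

text \<open>Exchanges slot pair 0 with slot pair j. It represents the coset that moves pair j to the
  front, and being even it brings no sign.\<close>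

definition pair_swap :: "nat \<Rightarrow> nat \<Rightarrow> nat" where
  "pair_swap j = Transposition.transpose 0 (2 * j) \<circ> Transposition.transpose 1 (Suc (2 * j))"

lemma pair_swap_apply:
  "pair_swap j (2 * m) = 2 * Transposition.transpose 0 j m"
  "pair_swap j (Suc (2 * m)) = Suc (2 * Transposition.transpose 0 j m)"
  "pair_swap j i div 2 = Transposition.transpose 0 j (i div 2)"
proof -
  show 1: "pair_swap j (2 * m) = 2 * Transposition.transpose 0 j m"
    and 2: "pair_swap j (Suc (2 * m)) = Suc (2 * Transposition.transpose 0 j m)" for m
    by (auto simp: pair_swap_def Transposition.transpose_def) presburger+
  show "pair_swap j i div 2 = Transposition.transpose 0 j (i div 2)"
    by (cases "even i") (auto elim!: evenE oddE simp: 1 2)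
qed

lemma pair_swap_permutes: "j < n \<Longrightarrow> pair_swap j permutes {..<2 * n}"
  unfolding pair_swap_def by (intro permutes_compose permutes_swap_id) auto

lemma sign_pair_swap: "sign (pair_swap j) = 1"
  unfolding pair_swap_def by (simp add: sign_compose permutation_swap_id sign_swap_id)

text \<open>In each factor only a complete pair gives a non-zero value. Each of the n + 1 pairs that
  can come first leaves an adapted list and yields the same product, which turns n! into (n +
  1)!.\<close>

lemma wedge_power_adapted:
  fixes \<alpha> :: "'v::ab_group_add list \<Rightarrow> 'b::real_normed_field"
  assumes alt: "alt_form sc 2 \<alpha>" and len: "length xs = 2 * n" and ad: "adapted \<alpha> xs"
  shows "wedge_power 2 \<alpha> n xs = fact n * (\<Prod>j<n. \<alpha> [xs ! (2 * j), xs ! Suc (2 * j)])"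
  using len ad
proof (induction n arbitrary: xs)
  case 0 then show ?case by simp
next
  case (Suc n)
  let ?im = "\<lambda>p :: nat \<Rightarrow> nat. p ` {..<2}"
  let ?g = "\<lambda>m. \<alpha> [xs ! (2 * m), xs ! Suc (2 * m)]"
  let ?ys = "\<lambda>p. permute_list p xs"
  note anti = alt_form_antisym[OF alt]
  have im: "?im p = {p 0, p 1}" for p by (auto simp: lessThan_small)
  have ps01: "pair_swap j 0 = 2 * j" "pair_swap j 1 = Suc (2 * j)" for j
    using pair_swap_apply(1)[of j 0] pair_swap_apply(2)[of j 0] by simp_all
  have imj: "?im (pair_swap j) = {2 * j, Suc (2 * j)}" for j
    unfolding im ps01 ..
  have "inj_on (\<lambda>j. ?im (pair_swap j)) {..<Suc n}"
    by (rule inj_onI) (simp only: imj doubleton_eq_iff, presburger)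
  then have inj: "inj_on pair_swap {..<Suc n}" "inj_on ?im (pair_swap ` {..<Suc n})"
    by (auto simp: inj_on_def)
  have len: "length xs = 2 + 2 * n" using Suc.prems by simp
  have "wedge_power 2 \<alpha> (Suc n) xs = (\<Sum>p\<in>pair_swap ` {..<Suc n}. of_int (sign p) *
      (\<alpha> (take 2 (?ys p)) * wedge_power 2 \<alpha> n (drop 2 (?ys p))))"
    unfolding wedge_power.simps
  proof (rule wedge_representatives[OF anti alt_form_antisym[OF alt_form_wedge_power[OF alt_formD(1)[OF alt]]]
        len _ _ inj(2)], goal_cases)
    case (2 p)
    then show ?case using pair_swap_permutes[of _ "Suc n"] by (auto simp del: mult_Suc_right simp add: mult_Suc_right[symmetric])
  next
    case (3 p)
    have p01: "p 0 < 2 + 2 * n" "p 1 < 2 + 2 * n" "p 0 \<noteq> p 1"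
      using permutes_in_image[OF 3(1)] inj_eq[OF permutes_inj[OF 3(1)]] by simp_all
    have "?ys p ! 0 = xs ! p 0" "?ys p ! 1 = xs ! p 1"
      by (rule permute_list_nth[OF 3(1)[folded len]], simp add: len)+
    then have "take 2 (?ys p) = [xs ! p 0, xs ! p 1]"
      using len
      by (intro nth_equalityI) (auto simp: less_Suc_eq numeral_2_eq_2)
    \<comment> \<open>Two distinct slots of one block would fill that block and give the coset of a
      pair swap, which is excluded.\<close>
    moreover have "p 0 div 2 \<noteq> p 1 div 2"
    proof
      assume eq: "p 0 div 2 = p 1 div 2"
      have "?im p = ?im (pair_swap (p 0 div 2))"
        unfolding im ps01 using eq p01(3) by (auto; presburger)
      moreover have "p 0 div 2 < Suc n" using p01 by auto
      ultimately show False using 3(2) by blast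
    qed
    ultimately have "\<alpha> (take 2 (?ys p)) = 0"
      using Suc.prems(2) p01 len unfolding adapted_def by simp
    then show ?case by simp
  qed simp
  also have "\<dots> = (\<Sum>j<Suc n. \<alpha> (take 2 (?ys (pair_swap j))) * wedge_power 2 \<alpha> n (drop 2 (?ys (pair_swap j))))"
    by (subst sum.reindex[OF inj(1)]) (simp add: sign_pair_swap)
  also have "\<dots> = (\<Sum>j<Suc n. fact n * (\<Prod>m<Suc n. ?g m))"
  proof (rule sum.cong[OF refl])
    fix j assume "j \<in> {..<Suc n}"
    then have j: "j < Suc n" by simp
    let ?t = "Transposition.transpose 0 j"
    let ?zs = "drop 2 (?ys (pair_swap j))"
    have pj: "pair_swap j permutes {..<length xs}" using pair_swap_permutes[OF j] len by simp
    have nth: "?ys (pair_swap j) ! i = xs ! pair_swap j i" if "i < length xs" for i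
      using permute_list_nth[OF pj that] .
    have lz: "length ?zs = 2 * n" using len by simp
    have zn: "?zs ! i = xs ! pair_swap j (i + 2)" if "i < 2 * n" for i
      using nth[of "i + 2"] that len by (simp add: add.commute)
    have lt: "pair_swap j i < length xs" if "i < length xs" for i
      using permutes_in_image[OF pj, of i] that by simp
    have "adapted \<alpha> ?zs"
      unfolding adapted_def lz
    proof (intro allI impI)
      fix a b assume ab: "a < 2 * n" "b < 2 * n" "a div 2 \<noteq> b div 2"
      have "pair_swap j (a + 2) div 2 \<noteq> pair_swap j (b + 2) div 2"
        using ab(3) unfolding pair_swap_apply by (simp add: Transposition.transpose_eq_iff)
      moreover have "pair_swap j (a + 2) < length xs" "pair_swap j (b + 2) < length xs"
        by (rule lt, use ab(1,2) len in simp)+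
      ultimately have "\<alpha> [xs ! pair_swap j (a + 2), xs ! pair_swap j (b + 2)] = 0"
        using Suc.prems(2) unfolding adapted_def by blast
      then show "\<alpha> [?zs ! a, ?zs ! b] = 0"
        by (simp only: zn[OF ab(1)] zn[OF ab(2)])
    qed
    from Suc.IH[OF lz this]
    have "wedge_power 2 \<alpha> n ?zs = fact n * (\<Prod>m<n. ?g (?t (Suc m)))"
      using pair_swap_apply(1,2)[of j "Suc _"] by (simp add: zn)
    moreover have "?ys (pair_swap j) ! 0 = xs ! (2 * j)" "?ys (pair_swap j) ! 1 = xs ! Suc (2 * j)"
      using nth[of 0] nth[of 1] ps01[of j] len by auto
    then have "take 2 (?ys (pair_swap j)) = [xs ! (2 * j), xs ! Suc (2 * j)]"
      using len by (intro nth_equalityI) (auto simp: less_Suc_eq numeral_2_eq_2)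
    moreover have "?g j * (\<Prod>m<n. ?g (?t (Suc m))) = (\<Prod>m<Suc n. ?g (?t m))"
      by (subst prod.lessThan_Suc_shift) simp
    \<comment> \<open>The pair swap only permutes the blocks, so the product over all of them does
      not change.\<close>
    moreover have "(\<Prod>m<Suc n. ?g (?t m)) = (\<Prod>m<Suc n. ?g m)"
      using prod.permute[OF permutes_swap_id[of 0 "{..<Suc n}" j], of ?g] j by (simp add: o_def del: prod.lessThan_Suc)
    ultimately show "\<alpha> (take 2 (?ys (pair_swap j))) * wedge_power 2 \<alpha> n ?zs = fact n * (\<Prod>m<Suc n. ?g m)"
      by (simp only: mult.left_commute[of _ "fact n"])
  qed
  finally show ?case by (simp add: algebra_simps del: prod.lessThan_Suc)
qed

lemma multilin_linear_sum:
  assumes "multilin sc n \<psi>" "length ys = n" "k < n" "finite J"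
  shows "\<psi> (ys[k := \<Sum>j\<in>J. sc (c j) (v j)]) = (\<Sum>j\<in>J. c j * \<psi> (ys[k := v j]))"
  using assms(4)
proof (induction J rule: finite_induct)
  case empty
  have "\<psi> (ys[k := 0]) = \<psi> (ys[k := 0]) + \<psi> (ys[k := 0])"
    using multilinD(1)[OF assms(1-3), of 0 0] by simp
  then show ?case by simp
next
  case (insert j J)
  then show ?case using multilinD[OF assms(1-3)] by simp
qed

text \<open>Expansion of an alternating form by multilinearity; only the injective index choices survive.\<close>

lemma alt_form_linear_combination:
  assumes \<psi>: "alt_form sc n \<psi>" and lu: "length us = n" and lx: "length xs = n"
    and x: "\<And>i. i < n \<Longrightarrow> xs ! i = (\<Sum>j<n. sc (a i j) (us ! j))"
  shows "\<psi> xs = (\<Sum>p | p permutes {..<n}. of_int (sign p) * (\<Prod>i<n. a i (p i))) * \<psi> us"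
proof -
  \<comment> \<open>Index choices for the first k slots, extended by the identity so that at k = n
    the injective ones are literally the permutations of \<open>{..<n}\<close>.\<close>
  let ?F = "\<lambda>k. {f. (\<forall>i<k. f i < n) \<and> (\<forall>i\<ge>k. f i = i)}"
  let ?l = "\<lambda>k f. map (\<lambda>i. us ! f i) [0..<k] @ drop k xs"
  have FS: "bij_betw (\<lambda>(f, j). f(k := j)) (?F k \<times> {..<n}) (?F (Suc k))" for k
    by (rule bij_betw_byWitness[where f' = "\<lambda>f. (f(k := k), f k)"])
      (auto simp: less_Suc_eq Suc_le_eq fun_eq_iff)
  have fin: "finite (?F k)" for k
  proof (induction k)
    case 0
    have "?F 0 = {id}" by auto
    then show ?case by simp
  next
    case (Suc k) then show ?case using bij_betw_finite[OF FS[of k]] by simp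
  qed
  have step: "\<psi> xs = (\<Sum>f\<in>?F k. (\<Prod>i<k. a i (f i)) * \<psi> (?l k f))" if "k \<le> n" for k
    using that
  proof (induction k)
    case 0
    have "?F 0 = {id}" by auto
    then show ?case by simp
  next
    case (Suc k)
    have k: "k < n" using Suc.prems by simp
    have ex: "\<psi> (?l k f) = (\<Sum>j<n. a k j * \<psi> (?l (Suc k) (f(k := j))))" for f
    proof -
      have "?l k f = (?l k f)[k := \<Sum>j<n. sc (a k j) (us ! j)]"
        using k lx x[OF k] by (simp add: list_update_append Cons_nth_drop_Suc[symmetric])
      moreover have "\<psi> ((?l k f)[k := \<Sum>j<n. sc (a k j) (us ! j)]) = (\<Sum>j<n. a k j * \<psi> ((?l k f)[k := us ! j]))"
        by (rule multilin_linear_sum[OF alt_formD(1)[OF \<psi>]]) (use k lx in auto)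
      moreover have "(?l k f)[k := us ! j] = ?l (Suc k) (f(k := j))" for j
        using k lx by (auto simp: list_update_append Cons_nth_drop_Suc[symmetric])
      ultimately show ?thesis by simp
    qed
    have "\<psi> xs = (\<Sum>f\<in>?F k. (\<Prod>i<k. a i (f i)) * \<psi> (?l k f))" using Suc by simp
    also have "\<dots> = (\<Sum>f\<in>?F k. \<Sum>j<n. (\<Prod>i<Suc k. a i ((f(k := j)) i)) * \<psi> (?l (Suc k) (f(k := j))))"
      unfolding ex sum_distrib_left
      by (intro sum.cong refl) (simp add: mult.assoc)
    also have "\<dots> = (\<Sum>(f, j)\<in>?F k \<times> {..<n}. (\<Prod>i<Suc k. a i ((f(k := j)) i)) * \<psi> (?l (Suc k) (f(k := j))))"
      by (rule sum.cartesian_product)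
    also have "\<dots> = (\<Sum>z\<in>?F k \<times> {..<n}. (\<lambda>f. (\<Prod>i<Suc k. a i (f i)) * \<psi> (?l (Suc k) f)) ((\<lambda>(f, j). f(k := j)) z))"
      by (rule sum.cong) auto
    also have "\<dots> = (\<Sum>f\<in>?F (Suc k). (\<Prod>i<Suc k. a i (f i)) * \<psi> (?l (Suc k) f))"
      by (rule sum.reindex_bij_betw[OF FS])
    finally show ?case .
  qed
  have "\<psi> xs = (\<Sum>f\<in>?F n. (\<Prod>i<n. a i (f i)) * \<psi> (?l n f))" by (rule step) simp
  also have "\<dots> = (\<Sum>f | f permutes {..<n}. (\<Prod>i<n. a i (f i)) * \<psi> (?l n f))"
  proof (rule sum.mono_neutral_right[OF fin], goal_cases)
    case 1
    show ?case
    proof (intro subsetI CollectI conjI allI impI)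
      fix f i assume f: "f \<in> {f. f permutes {..<n}}"
      show "f i < n" if "i < n" using f that permutes_in_image[of f "{..<n}" i] by simp
      show "f i = i" if "n \<le> i" using f that permutes_not_in[of f "{..<n}" i] by simp
    qed
  next
    case 2
    show ?case
    proof
      fix f assume f: "f \<in> ?F n - {f. f permutes {..<n}}"
      have "\<not> inj_on f {..<n}"
      proof
        assume "inj_on f {..<n}"
        moreover have "f ` {..<n} \<subseteq> {..<n}" using f by auto
        ultimately have "bij_betw f {..<n} {..<n}"
          by (simp add: bij_betw_def endo_inj_surj)
        then show False using f bij_imp_permutes[of f "{..<n}"] by auto
      qed
      then obtain i j where ij: "i < n" "j < n" "i \<noteq> j" "f i = f j" unfolding inj_on_def by auto
      have "\<psi> (?l n f) = 0"
        by (rule alt_formD(2)[OF \<psi>, of _ i j]) (use ij lx in auto)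
      then show "(\<Prod>i<n. a i (f i)) * \<psi> (?l n f) = 0" by simp
    qed
  qed
  also have "\<dots> = (\<Sum>f | f permutes {..<n}. of_int (sign f) * (\<Prod>i<n. a i (f i)) * \<psi> us)"
  proof (rule sum.cong[OF refl])
    fix f assume f: "f \<in> {f. f permutes {..<n}}"
    have "?l n f = permute_list f us" using lx lu by (simp add: permute_list_def)
    then show "(\<Prod>i<n. a i (f i)) * \<psi> (?l n f) = of_int (sign f) * (\<Prod>i<n. a i (f i)) * \<psi> us"
      using antisym_permute[OF alt_form_antisym[OF \<psi>], of f us] f lu by (simp add: mult.left_commute mult.assoc)
  qed
  finally show ?thesis by (simp add: sum_distrib_right)
qed

section \<open>Gram determinants and adapted bases\<close>


definition orthonormal_list :: "'v::real_inner list \<Rightarrow> bool" where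
  "orthonormal_list us \<longleftrightarrow>
     (\<forall>i<length us. \<forall>j<length us. us ! i \<bullet> us ! j = (if i = j then 1 else 0))"

text \<open>The inner product of two simple vectors. For fixed \<open>ys\<close> it is an
  alternating form in \<open>xs\<close>, so Gram determinants can be computed with the expansion
  lemma for such forms.\<close>

definition gram_form :: "'v::real_inner list \<Rightarrow> 'v list \<Rightarrow> real" where
  "gram_form ys xs = (\<Sum>p | p permutes {..<length ys}.
     of_int (sign p) * (\<Prod>i<length ys. xs ! i \<bullet> ys ! p i))"

lemma leibniz_transpose:
  fixes a :: "nat \<Rightarrow> nat \<Rightarrow> 's::comm_ring_1"
  shows "(\<Sum>p | p permutes {..<n}. of_int (sign p) * (\<Prod>i<n. a i (p i))) =
    (\<Sum>p | p permutes {..<n}. of_int (sign p) * (\<Prod>i<n. a (p i) i))"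
proof -
  have "(\<Sum>p | p permutes {..<n}. of_int (sign p) * (\<Prod>i<n. a i (p i))) =
      (\<Sum>p | p permutes {..<n}. of_int (sign (inv p)) * (\<Prod>i<n. a i (inv p i)))"
    by (rule sum_permutations_inverse)
  also have "\<dots> = (\<Sum>p | p permutes {..<n}. of_int (sign p) * (\<Prod>i<n. a (p i) i))"
  proof (rule sum.cong[OF refl])
    fix p assume "p \<in> {p. p permutes {..<n}}"
    then have p: "p permutes {..<n}" by simp
    have "(\<Prod>i<n. a i (inv p i)) = (\<Prod>i<n. a (p i) (inv p (p i)))"
      using prod.permute[OF p, of "\<lambda>i. a i (inv p i)"] by (simp add: o_def)
    also have "\<dots> = (\<Prod>i<n. a (p i) i)"
      using permutes_inverses(2)[OF p] by simp
    finally show "of_int (sign (inv p)) * (\<Prod>i<n. a i (inv p i)) = of_int (sign p) * (\<Prod>i<n. a (p i) i)"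
      using p by (simp add: sign_inverse permutation_permutes[THEN iffD2, OF exI[of _ "{..<n}"]])
  qed
  finally show ?thesis .
qed

lemma gram_form_commute:
  assumes "length xs = length ys"
  shows "gram_form ys xs = gram_form xs ys"
  unfolding gram_form_def assms
  by (subst leibniz_transpose[where a = "\<lambda>i j. xs ! i \<bullet> ys ! j"]) (simp add: inner_commute)

lemma alt_form_gram_form: "alt_form (*\<^sub>R) (length ys) (gram_form ys)"
proof -
  let ?n = "length ys"
  let ?T = "\<lambda>xs. \<Prod>i<?n. xs ! i \<bullet> ys ! i"
  have upd: "(\<Prod>i<?n. xs[k := v] ! i \<bullet> ys ! i) = (v \<bullet> ys ! k) * (\<Prod>i\<in>{..<?n} - {k}. xs ! i \<bullet> ys ! i)"
    if "length xs = ?n" "k < ?n" for xs k v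
  proof -
    have "(\<Prod>i<?n. xs[k := v] ! i \<bullet> ys ! i) =
        (xs[k := v] ! k \<bullet> ys ! k) * (\<Prod>i\<in>{..<?n} - {k}. xs[k := v] ! i \<bullet> ys ! i)"
      using that by (intro prod.remove) auto
    then show ?thesis using that by simp
  qed
  have "multilin (*\<^sub>R) ?n ?T"
    unfolding multilin_def by (auto simp: upd inner_add_left algebra_simps)
  then have "alt_form (*\<^sub>R) ?n (\<lambda>xs. fact ?n * Alt ?n ?T xs)"
    by (intro alt_form_cmult alt_form_Alt)
  then show ?thesis
  proof (rule alt_form_cong)
    fix xs :: "'a list" assume l: "length xs = ?n"
    have "fact ?n * Alt ?n ?T xs = (\<Sum>p | p permutes {..<?n}. of_int (sign p) * ?T (permute_list p xs))"
      by (simp add: Alt_def)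
    also have "\<dots> = (\<Sum>p | p permutes {..<?n}. of_int (sign p) * (\<Prod>i<?n. ys ! i \<bullet> xs ! p i))"
      using l by (intro sum.cong refl) (simp add: permute_list_nth inner_commute)
    also have "\<dots> = gram_form xs ys" using l by (simp add: gram_form_def)
    also have "\<dots> = gram_form ys xs" using l by (simp add: gram_form_commute)
    finally show "fact ?n * Alt ?n ?T xs = gram_form ys xs" .
  qed
qed

lemma gram_det_eq_gram_form: "gram_det xs = gram_form xs xs"
  by (simp add: gram_det_def gram_form_def)

lemma gram_det_orthonormal:
  assumes "orthonormal_list us"
  shows "gram_det us = 1"
proof -
  let ?n = "length us"
  have z: "(\<Prod>i<?n. us ! i \<bullet> us ! p i) = 0" if p: "p permutes {..<?n}" "p \<noteq> id" for p
  proof -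
    obtain i where i: "p i \<noteq> i" using p(2) unfolding fun_eq_iff id_def by blast
    then have "i < ?n" using p(1) by (metis lessThan_iff permutes_not_in)
    moreover have "p i < ?n" using permutes_in_image[OF p(1), of i] calculation by simp
    ultimately show ?thesis using i assms unfolding orthonormal_list_def
      by (intro prod_zero) (auto intro!: bexI[of _ i])
  qed
  have "gram_det us = (\<Sum>p\<in>{id}. of_int (sign p) * (\<Prod>i<?n. us ! i \<bullet> us ! p i))"
    unfolding gram_det_def
    by (rule sum.mono_neutral_right) (use z in \<open>auto simp: finite_permutations permutes_id\<close>)
  also have "\<dots> = 1" using assms by (simp add: orthonormal_list_def)
  finally show ?thesis .
qed

text \<open>The symmetric \<open>gram_form\<close> is alternating in each argument, so the
  hypothesis applies once on each side and produces \<rho> twice.\<close>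

lemma gram_det_proportional:
  assumes len: "length xs = length us" and on: "orthonormal_list us"
    and \<rho>: "\<And>\<phi>. alternating_form (length us) \<phi> \<Longrightarrow> \<phi> xs = \<rho> * \<phi> us"
  shows "gram_det xs = \<rho>\<^sup>2"
proof -
  have a: "alternating_form (length us) (gram_form zs)" if "length zs = length us" for zs :: "'a list"
    using alt_form_gram_form[of zs] that by (simp add: alternating_form_iff_alt_form)
  have "gram_form xs xs = \<rho> * gram_form xs us" by (rule \<rho>[OF a]) (simp add: len)
  also have "gram_form xs us = gram_form us xs" by (rule gram_form_commute) (simp add: len)
  also have "gram_form us xs = \<rho> * gram_form us us" by (rule \<rho>[OF a]) simp
  also have "gram_form us us = 1" using gram_det_orthonormal[OF on] by (simp add: gram_det_eq_gram_form)
  finally show ?thesis by (simp add: gram_det_eq_gram_form power2_eq_square)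
qed

lemma alt_form_zero:
  fixes \<psi> :: "'v::real_vector list \<Rightarrow> real"
  assumes "alt_form (*\<^sub>R) n \<psi>" "length xs = n" "k < n" "xs ! k = 0"
  shows "\<psi> xs = 0"
proof -
  have "xs[k := 0] = xs" using assms(4) by (metis list_update_id)
  then show ?thesis
    using multilinD(2)[OF alt_formD(1)[OF assms(1)] assms(2,3), of 0 0] by (simp only: scaleR_zero_left mult_zero_left)
qed

lemma orthonormal_list_expansion:
  fixes V :: "'v::euclidean_space set"
  assumes V: "subspace V" and on: "orthonormal_list us" "set us \<subseteq> V" "length us = dim V" and x: "x \<in> V"
  shows "x = (\<Sum>j<length us. (x \<bullet> us ! j) *\<^sub>R us ! j)"
proof -
  have dist: "distinct us"
    using on(1) unfolding orthonormal_list_def distinct_conv_nth by (metis zero_neq_one)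
  have pw: "pairwise orthogonal (set us)" "0 \<notin> set us"
    using on(1) unfolding pairwise_def orthogonal_def orthonormal_list_def
    by (auto simp: in_set_conv_nth) (metis inner_zero_left zero_neq_one)
  have "independent (set us)" using pw by (rule pairwise_orthogonal_independent)
  moreover have "card (set us) = dim V" using dist on(3) by (simp add: distinct_card)
  ultimately have "V \<subseteq> span (set us)"
    using on(2) card_eq_dim[of "set us" V] by simp
  let ?y = "x - (\<Sum>j<length us. (x \<bullet> us ! j) *\<^sub>R us ! j)"
  have o: "?y \<bullet> us ! i = 0" if i: "i < length us" for i
  proof -
    have "(\<Sum>j<length us. (x \<bullet> us ! j) *\<^sub>R us ! j) \<bullet> us ! i = (\<Sum>j<length us. (x \<bullet> us ! j) * (if j = i then 1 else 0))"
      unfolding inner_sum_left using on(1) i by (intro sum.cong) (auto simp: orthonormal_list_def)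
    also have "\<dots> = x \<bullet> us ! i" using i by (simp add: if_distrib[of "(*) _"] cong: if_cong)
    finally show ?thesis by (simp add: inner_diff_left)
  qed
  have "?y \<in> V"
    using V x on(2) by (intro subspace_diff subspace_sum subspace_scale) auto
  then have "?y \<in> span (set us)" using \<open>V \<subseteq> span (set us)\<close> by blast
  moreover have "orthogonal ?y z" if "z \<in> set us" for z
    using o that unfolding orthogonal_def in_set_conv_nth by metis
  ultimately have "orthogonal ?y ?y" using orthogonal_to_span by blast
  then show ?thesis by (simp add: orthogonal_self)
qed

text \<open>If the span were too small, an orthonormal basis of it could be padded with zero vectors
  to the length of \<open>xs\<close>. The entries of \<open>xs\<close> are still combinations of
  this list, and an alternating form vanishes on it.\<close>

lemma gram_det_nonzero_dim:
  fixes xs :: "'v::euclidean_space list"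
  assumes "gram_det xs \<noteq> 0"
  shows "dim (span (set xs)) = length xs"
proof (rule ccontr)
  let ?V = "span (set xs)" and ?n = "length xs"
  assume ne: "dim ?V \<noteq> ?n"
  have "dim ?V \<le> card (set xs)" using dim_le_card[of ?V "set xs"] by simp
  then have lt: "dim ?V < ?n" using ne card_length[of xs] by linarith
  obtain B where B: "B \<subseteq> ?V" "pairwise orthogonal B" "\<And>x. x \<in> B \<Longrightarrow> norm x = 1"
    "independent B" "card B = dim ?V" "span B = ?V"
    using orthonormal_basis_subspace[OF subspace_span] by metis
  obtain bs where bs: "set bs = B" "distinct bs"
    using finite_distinct_list[OF independent_imp_finite[OF B(4)]] by blast
  have lb: "length bs = dim ?V" using bs B(5) distinct_card by metis
  have on: "orthonormal_list bs"
    unfolding orthonormal_list_def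
    using bs B(2,3) unfolding pairwise_def orthogonal_def
    by (auto simp: nth_eq_iff_index_eq dot_square_norm)
  let ?us = "bs @ replicate (?n - length bs) 0"
  have "xs ! i = (\<Sum>j<?n. (xs ! i \<bullet> ?us ! j) *\<^sub>R ?us ! j)" if i: "i < ?n" for i
  proof -
    have "xs ! i \<in> ?V" using i by (simp add: span_base)
    then have "xs ! i = (\<Sum>j<length bs. (xs ! i \<bullet> bs ! j) *\<^sub>R bs ! j)"
      using orthonormal_list_expansion[OF subspace_span on _ lb] bs B(1) by blast
    also have "\<dots> = (\<Sum>j<length bs. (xs ! i \<bullet> ?us ! j) *\<^sub>R ?us ! j)"
      by (rule sum.cong) (auto simp: nth_append)
    also have "\<dots> = (\<Sum>j<?n. (xs ! i \<bullet> ?us ! j) *\<^sub>R ?us ! j)"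
      by (rule sum.mono_neutral_left) (use lb lt in \<open>auto simp: nth_append\<close>)
    finally show ?thesis .
  qed
  moreover have lu: "length ?us = ?n" using lb lt by simp
  moreover have "gram_form xs ?us = 0"
    by (rule alt_form_zero[OF alt_form_gram_form lu, of "length bs"]) (use lb lt in \<open>auto simp: nth_append\<close>)
  ultimately have "gram_form xs xs = 0"
    using alt_form_linear_combination[OF alt_form_gram_form lu refl, of "\<lambda>i j. xs ! i \<bullet> ?us ! j"] by simp
  then show False using assms by (simp add: gram_det_eq_gram_form)
qed

text \<open>Take a maximum of \<open>w\<close> over the compact set of orthonormal pairs. Rotating
  one vector of the pair towards a unit vector orthogonal to both cannot increase \<open>w\<close>,
  which kills the mixed values.\<close>

lemma orthonormal_adapted_pair:
  fixes w :: "'v::euclidean_space \<Rightarrow> 'v \<Rightarrow> real"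
  assumes w: "bounded_bilinear w" and skew: "\<And>u v. w u v = - w v u"
    and V: "subspace V" "2 \<le> dim V"
  obtains u v where "u \<in> V" "v \<in> V" "u \<bullet> u = 1" "v \<bullet> v = 1" "u \<bullet> v = 0" "0 \<le> w u v"
    "\<And>z. z \<in> V \<Longrightarrow> u \<bullet> z = 0 \<Longrightarrow> v \<bullet> z = 0 \<Longrightarrow> w u z = 0 \<and> w v z = 0"
proof -
  interpret w: bounded_bilinear w by (rule w)
  let ?S = "V \<inter> sphere 0 1"
  let ?K = "?S \<times> ?S \<inter> {p. fst p \<bullet> snd p = 0}"
  have "compact ?S" using closed_subspace[OF V(1)] by (intro closed_Int_compact) auto
  then have "compact (?S \<times> ?S)" by (rule compact_Times[OF _ \<open>compact ?S\<close>])
  then have "compact ?K"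
    by (rule compact_Int_closed) (intro closed_Collect_eq continuous_intros)
  moreover have "?K \<noteq> {}"
  proof -
    obtain B where B: "B \<subseteq> V" "pairwise orthogonal B" "\<And>x. x \<in> B \<Longrightarrow> norm x = 1" "card B = dim V"
      using orthonormal_basis_subspace[OF V(1)] by metis
    have "\<not> card B \<le> Suc 0" using B(4) V(2) by simp
    moreover from this have "finite B" using card.infinite by fastforce
    ultimately obtain x y where "x \<in> B" "y \<in> B" "x \<noteq> y"
      using card_le_Suc0_iff_eq by blast
    then have "(x, y) \<in> ?K" using B unfolding pairwise_def orthogonal_def by auto
    then show ?thesis by blast
  qed
  moreover have "continuous_on ?K (\<lambda>p. w (fst p) (snd p))"
    by (intro w.continuous_on continuous_intros)
  ultimately have "\<exists>p\<in>?K. \<forall>q\<in>?K. w (fst q) (snd q) \<le> w (fst p) (snd p)"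
    by (rule continuous_attains_sup)
  then obtain p where p: "p \<in> ?K" and max: "\<And>q. q \<in> ?K \<Longrightarrow> w (fst q) (snd q) \<le> w (fst p) (snd p)"
    by blast
  obtain u v where uv: "p = (u, v)" by fastforce
  have h: "u \<in> V" "v \<in> V" "u \<bullet> u = 1" "v \<bullet> v = 1" "u \<bullet> v = 0"
    using p unfolding uv by (auto simp: dot_square_norm)
  have mx: "w a b \<le> w u v" if "a \<in> V" "b \<in> V" "a \<bullet> a = 1" "b \<bullet> b = 1" "a \<bullet> b = 0" for a b
    using max[of "(a, b)"] that unfolding uv by (simp add: norm_eq_1)
  have nonneg: "0 \<le> w u v" using mx[of v u] h skew[of v u] by (simp add: inner_commute)
  \<comment> \<open>With r the square root of a^2 + b^2, the choice (s, t) = (a / r, b / r) attains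
    the value r, so r \<le> a and b must vanish.\<close>
  have rot: "b = 0" if "\<And>s t. s\<^sup>2 + t\<^sup>2 = 1 \<Longrightarrow> s * a + t * b \<le> a" "0 \<le> a" for a b :: real
  proof (rule ccontr)
    assume b: "b \<noteq> 0"
    define r where "r = sqrt (a\<^sup>2 + b\<^sup>2)"
    have pos: "0 < a\<^sup>2 + b\<^sup>2" using b by (simp add: sum_power2_gt_zero_iff)
    then have r: "0 < r" "r\<^sup>2 = a\<^sup>2 + b\<^sup>2" by (simp_all add: r_def)
    have "(a / r)\<^sup>2 + (b / r)\<^sup>2 = (a\<^sup>2 + b\<^sup>2) / r\<^sup>2" by (simp add: power_divide add_divide_distrib)
    then have "(a / r)\<^sup>2 + (b / r)\<^sup>2 = 1" using r(1) unfolding r(2)[symmetric] by simp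
    then have "a / r * a + b / r * b \<le> a" by (rule that(1))
    moreover have "a / r * a + b / r * b = (a\<^sup>2 + b\<^sup>2) / r" by (simp add: power2_eq_square add_divide_distrib)
    then have "a / r * a + b / r * b = r" using r(1) unfolding r(2)[symmetric] by (simp add: power2_eq_square)
    ultimately have "r\<^sup>2 \<le> a\<^sup>2" using r(1) by (intro power_mono) simp_all
    then show False using r(2) b by simp
  qed
  have unit: "w u z = 0 \<and> w v z = 0" if z: "z \<in> V" "u \<bullet> z = 0" "v \<bullet> z = 0" "z \<bullet> z = 1" for z
  proof
    show "w u z = 0"
    proof (rule rot[OF _ nonneg])
      fix s t :: real assume st: "s\<^sup>2 + t\<^sup>2 = 1"
      have "w u (s *\<^sub>R v + t *\<^sub>R z) \<le> w u v"
        using V(1) h z st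
        by (intro mx subspace_add subspace_scale)
          (auto simp: inner_add_left inner_add_right inner_commute power2_eq_square)
      then show "s * w u v + t * w u z \<le> w u v" by (simp add: w.add_right w.scaleR_right)
    qed
    have "w z v = 0"
    proof (rule rot[OF _ nonneg])
      fix s t :: real assume st: "s\<^sup>2 + t\<^sup>2 = 1"
      have "w (s *\<^sub>R u + t *\<^sub>R z) v \<le> w u v"
        using V(1) h z st
        by (intro mx subspace_add subspace_scale)
          (auto simp: inner_add_left inner_add_right inner_commute power2_eq_square)
      then show "s * w u v + t * w z v \<le> w u v" by (simp add: w.add_left w.scaleR_left)
    qed
    then show "w v z = 0" using skew[of v z] by simp
  qed
  have "w u z = 0 \<and> w v z = 0" if z: "z \<in> V" "u \<bullet> z = 0" "v \<bullet> z = 0" for z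
  proof (cases "z = 0")
    case True then show ?thesis by (simp add: w.zero_right)
  next
    case False
    let ?y = "inverse (norm z) *\<^sub>R z"
    have "?y \<in> V" using V(1) z(1) by (rule subspace_scale)
    then have "w u ?y = 0 \<and> w v ?y = 0"
      using unit[of ?y] z False by (simp add: dot_square_norm power2_eq_square)
    then show ?thesis using False by (simp add: w.scaleR_right)
  qed
  then show thesis using that h nonneg by blast
qed

lemma orthonormal_adapted_basis:
  fixes w :: "'v::euclidean_space \<Rightarrow> 'v \<Rightarrow> real"
  assumes w: "bounded_bilinear w" and skew: "\<And>u v. w u v = - w v u"
    and V: "subspace V" "dim V = 2 * n"
  shows "\<exists>us. length us = 2 * n \<and> set us \<subseteq> V \<and> orthonormal_list us \<and>
    (\<forall>i<2 * n. \<forall>j<2 * n. i div 2 \<noteq> j div 2 \<longrightarrow> w (us ! i) (us ! j) = 0) \<and>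
    (\<forall>j<n. 0 \<le> w (us ! (2 * j)) (us ! Suc (2 * j)))"
  using V
proof (induction n arbitrary: V)
  case 0 then show ?case by (auto simp: orthonormal_list_def)
next
  case (Suc n)
  obtain u v where uv: "u \<in> V" "v \<in> V" "u \<bullet> u = 1" "v \<bullet> v = 1" "u \<bullet> v = 0" "0 \<le> w u v"
    and ort: "\<And>z. z \<in> V \<Longrightarrow> u \<bullet> z = 0 \<Longrightarrow> v \<bullet> z = 0 \<Longrightarrow> w u z = 0 \<and> w v z = 0"
    using orthonormal_adapted_pair[OF w skew Suc.prems(1)] Suc.prems(2) by auto
  let ?A = "span {u, v}"
  define V' where "V' = {z \<in> V. \<forall>x\<in>?A. orthogonal x z}"
  have sub: "?A \<subseteq> V" using uv Suc.prems(1) by (intro span_minimal) auto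
  have "dim V' + dim ?A = dim V"
    unfolding V'_def by (rule dim_subspace_orthogonal_to_vectors[OF subspace_span Suc.prems(1) sub])
  moreover have "dim ?A = 2"
  proof -
    have ne: "u \<noteq> v" using uv by auto
    have "independent {u, v}"
      using uv by (intro pairwise_orthogonal_independent) (auto simp: pairwise_def orthogonal_def inner_commute)
    then show ?thesis using ne by (simp add: dim_eq_card_independent)
  qed
  ultimately have d: "dim V' = 2 * n" using Suc.prems(2) by simp
  have s: "subspace V'"
    using Suc.prems(1) unfolding V'_def subspace_def orthogonal_def
    by (auto simp: inner_add_right)
  obtain us where us: "length us = 2 * n" "set us \<subseteq> V'" "orthonormal_list us"
    "\<forall>i<2 * n. \<forall>j<2 * n. i div 2 \<noteq> j div 2 \<longrightarrow> w (us ! i) (us ! j) = 0"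
    "\<forall>j<n. 0 \<le> w (us ! (2 * j)) (us ! Suc (2 * j))"
    using Suc.IH[OF s d] by blast
  have V': "z \<in> V" "u \<bullet> z = 0" "v \<bullet> z = 0" "z \<bullet> u = 0" "z \<bullet> v = 0" "w u z = 0" "w v z = 0" "w z u = 0" "w z v = 0"
    if "z \<in> set us" for z
  proof -
    show "z \<in> V" "u \<bullet> z = 0" "v \<bullet> z = 0" using that us(2) unfolding V'_def orthogonal_def
      by (auto simp: span_base)
    then show "z \<bullet> u = 0" "z \<bullet> v = 0" "w u z = 0" "w v z = 0" "w z u = 0" "w z v = 0"
      using ort[of z] skew[of z u] skew[of z v] by (simp_all add: inner_commute)
  qed
  have uo: "us ! k \<bullet> us ! l = (if k = l then 1 else 0)" if "k < 2 * n" "l < 2 * n" for k l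
    using us(1,3) that unfolding orthonormal_list_def by simp
  have nth: "i = 0 \<or> i = 1 \<or> (\<exists>k<2 * n. i = Suc (Suc k))" if "i < 2 * Suc n" for i
    using that by (cases i; cases "i - 1") auto
  have "orthonormal_list (u # v # us)"
    unfolding orthonormal_list_def
  proof (intro allI impI)
    fix i j assume "i < length (u # v # us)" "j < length (u # v # us)"
    then have ij: "i < 2 * Suc n" "j < 2 * Suc n" using us(1) by simp_all
    show "(u # v # us) ! i \<bullet> (u # v # us) ! j = (if i = j then 1 else 0)"
      using nth[OF ij(1)] nth[OF ij(2)] uv V'[OF nth_mem] us(1) uo inner_commute[of v u]
      by (auto split: if_splits)
  qed
  moreover have "w ((u # v # us) ! i) ((u # v # us) ! j) = 0"
    if ij: "i < 2 * Suc n" "j < 2 * Suc n" "i div 2 \<noteq> j div 2" for i j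
    using nth[OF ij(1)] nth[OF ij(2)] ij(3) V'[OF nth_mem] us(1,4) by auto
  moreover have "0 \<le> w ((u # v # us) ! (2 * j)) ((u # v # us) ! Suc (2 * j))" if "j < Suc n" for j
    using that us(5) uv(6) by (cases j) auto
  moreover have "set (u # v # us) \<subseteq> V" using uv V' by auto
  ultimately show ?case using us(1) by (intro exI[of _ "u # v # us"]) simp
qed

text \<open>\<rho> is the determinant of \<open>xs\<close> in the adapted basis, and the Gram
  determinant makes its square 1. The sign has to stay, because a basis with all pair values
  non-negative may reverse the orientation.\<close>

lemma simple_vector_adapted:
  fixes w :: "'v::euclidean_space \<Rightarrow> 'v \<Rightarrow> real"
  assumes w: "bounded_bilinear w" and skew: "\<And>u v. w u v = - w v u"
    and xs: "length xs = 2 * n" "gram_det xs = 1"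
  obtains us \<rho> where "length us = 2 * n" "set us \<subseteq> span (set xs)" "orthonormal_list us"
    "\<And>i j. i < 2 * n \<Longrightarrow> j < 2 * n \<Longrightarrow> i div 2 \<noteq> j div 2 \<Longrightarrow> w (us ! i) (us ! j) = 0"
    "\<And>j. j < n \<Longrightarrow> 0 \<le> w (us ! (2 * j)) (us ! Suc (2 * j))"
    "\<rho> = 1 \<or> \<rho> = - 1"
    "\<And>\<phi>. alternating_form (2 * n) \<phi> \<Longrightarrow> \<phi> xs = \<rho> * \<phi> us"
proof -
  have d: "dim (span (set xs)) = 2 * n" using gram_det_nonzero_dim[of xs] xs by simp
  obtain us where us: "length us = 2 * n" "set us \<subseteq> span (set xs)" "orthonormal_list us"
    "\<forall>i<2 * n. \<forall>j<2 * n. i div 2 \<noteq> j div 2 \<longrightarrow> w (us ! i) (us ! j) = 0"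
    "\<forall>j<n. 0 \<le> w (us ! (2 * j)) (us ! Suc (2 * j))"
    using orthonormal_adapted_basis[OF w skew subspace_span d] by blast
  define \<rho> where "\<rho> = (\<Sum>p | p permutes {..<2 * n}. of_int (sign p) * (\<Prod>i<2 * n. xs ! i \<bullet> us ! p i))"
  have \<rho>: "\<phi> xs = \<rho> * \<phi> us" if "alternating_form (2 * n) \<phi>" for \<phi>
    unfolding \<rho>_def
  proof (rule alt_form_linear_combination[OF that[unfolded alternating_form_iff_alt_form] us(1) xs(1)])
    fix i assume i: "i < 2 * n"
    then have "xs ! i \<in> span (set xs)" using xs(1) by (simp add: span_base)
    then show "xs ! i = (\<Sum>j<2 * n. (xs ! i \<bullet> us ! j) *\<^sub>R us ! j)"
      using orthonormal_list_expansion[OF subspace_span us(3,2)] us(1) d by auto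
  qed
  have "gram_det xs = \<rho>\<^sup>2" by (rule gram_det_proportional[OF _ us(3)]) (use xs us \<rho> in auto)
  then have "\<rho> = 1 \<or> \<rho> = - 1" using xs(2) by (simp add: power2_eq_1_iff)
  then show thesis using that us \<rho> by blast
qed

section \<open>The forms on complex 8-space\<close>


lemma UNIV_8: "(UNIV :: 8 set) = {1, 2, 3, 4, 5, 6, 7, 8}"
  using UNIV_8_enum by auto

lemma sum_8: "sum f (UNIV :: 8 set) = f 1 + f 2 + f 3 + f 4 + f 5 + f 6 + f 7 + f 8"
  unfolding UNIV_8 by (simp add: ac_simps)

lemma forall_8: "(\<forall>i::8. P i) \<longleftrightarrow> P 1 \<and> P 2 \<and> P 3 \<and> P 4 \<and> P 5 \<and> P 6 \<and> P 7 \<and> P 8"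
proof -
  have "(\<forall>i::8. P i) \<longleftrightarrow> (\<forall>i\<in>UNIV. P i)" by simp
  then show ?thesis unfolding UNIV_8 by simp
qed

lemma scaleR_eq_of_real_scale: "r *\<^sub>R v = complex_of_real r *s (v :: complex ^ 'n)"
  by (simp only: vec_eq_iff vector_scaleR_component vector_smult_component)
    (simp add: scaleR_conv_of_real)

lemma herm_simps [simp]:
  "herm (v + v') w = herm v w + herm v' w" "herm v (w + w') = herm v w + herm v w'"
  "herm (v - v') w = herm v w - herm v' w" "herm v (w - w') = herm v w - herm v w'"
  "herm (a *s v) w = cnj a * herm v w" "herm v (a *s w) = a * herm v w"
  "herm (r *\<^sub>R v) w = complex_of_real r * herm v w" "herm v (r *\<^sub>R w) = complex_of_real r * herm v w"
  "herm 0 w = 0" "herm v 0 = 0" "herm (- v) w = - herm v w" "herm v (- w) = - herm v w"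
  unfolding scaleR_eq_of_real_scale
  by (simp_all add: herm_def sum.distrib sum_distrib_left algebra_simps sum_subtractf sum_negf)

lemma cnj_herm: "cnj (herm v w) = herm w v"
  by (simp add: herm_def mult.commute)

lemma herm_self: "herm v v = of_real (norm v ^ 2)"
proof -
  have "Im (herm v v) = 0" using cnj_herm[of v v] by (simp add: complex_eq_iff)
  moreover have "Re (herm v v) = norm v ^ 2"
    by (simp add: inner_eq_Re_herm[symmetric] power2_norm_eq_inner)
  ultimately show ?thesis by (simp add: complex_eq_iff)
qed

lemma alt_form_Re:
  fixes f :: "(complex ^ 'n) list \<Rightarrow> complex"
  assumes "alt_form (*s) m f"
  shows "alt_form (*\<^sub>R) m (\<lambda>xs. Re (f xs))"
  using assms unfolding alt_form_def multilin_def scaleR_eq_of_real_scale by simp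

text \<open>A family containing both \<open>\<Omega>1\<close> and \<open>\<Omega>2\<close>, so that
  arguments about four coordinates are made once.\<close>

definition vol4 :: "8 \<Rightarrow> 8 \<Rightarrow> 8 \<Rightarrow> 8 \<Rightarrow> C8 list \<Rightarrow> complex" where
  "vol4 i j k l = Z i \<and>\<^bsub>1,3\<^esub> (Z j \<and>\<^bsub>1,2\<^esub> (Z k \<and>\<^bsub>1,1\<^esub> Z l))"

lemma \<Omega>_eq_vol4: "\<Omega>1 = vol4 1 2 3 4" "\<Omega>2 = vol4 5 6 7 8"
  by (simp_all add: \<Omega>1_def \<Omega>2_def vol4_def)

lemma alt_form_Z: "alt_form (*s) 1 (Z j)"
  by (auto simp: alt_form_def multilin_def Z_def)

lemma alt_form_vol_pieces:
  "alt_form (*s) 2 (Z k \<and>\<^bsub>1,1\<^esub> Z l)" "alt_form (*s) 3 (Z j \<and>\<^bsub>1,2\<^esub> (Z k \<and>\<^bsub>1,1\<^esub> Z l))"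
  "alt_form (*s) 4 (vol4 i j k l)"
proof -
  note z = alt_formD(1)[OF alt_form_Z]
  have e: "(2::nat) = 1 + 1" "(3::nat) = 1 + 2" "(4::nat) = 1 + 3" by simp_all
  show 1: "alt_form (*s) 2 (Z k \<and>\<^bsub>1,1\<^esub> Z l)" for k l
    unfolding e(1) by (rule alt_form_wedge[OF z z])
  show 2: "alt_form (*s) 3 (Z j \<and>\<^bsub>1,2\<^esub> (Z k \<and>\<^bsub>1,1\<^esub> Z l))" for j k l
    unfolding e(2) by (rule alt_form_wedge[OF z alt_formD(1)[OF 1]])
  show "alt_form (*s) 4 (vol4 i j k l)"
    unfolding vol4_def unfolding e(3) by (rule alt_form_wedge[OF z alt_formD(1)[OF 2]])
qed

lemma vol4_eq:
  "vol4 i j k l [a, b, c, d] =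
    a $ i * (b $ j * (c $ k * d $ l - d $ k * c $ l) - c $ j * (b $ k * d $ l - d $ k * b $ l)
           + d $ j * (b $ k * c $ l - c $ k * b $ l))
  - b $ i * (a $ j * (c $ k * d $ l - d $ k * c $ l) - c $ j * (a $ k * d $ l - d $ k * a $ l)
           + d $ j * (a $ k * c $ l - c $ k * a $ l))
  + c $ i * (a $ j * (b $ k * d $ l - d $ k * b $ l) - b $ j * (a $ k * d $ l - d $ k * a $ l)
           + d $ j * (a $ k * b $ l - b $ k * a $ l))
  - d $ i * (a $ j * (b $ k * c $ l - c $ k * b $ l) - b $ j * (a $ k * c $ l - c $ k * a $ l)
           + c $ j * (a $ k * b $ l - b $ k * a $ l))"
proof -
  note an = alt_form_antisym[OF alt_form_Z] alt_form_antisym[OF alt_form_vol_pieces(1)]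
    alt_form_antisym[OF alt_form_vol_pieces(2)]
  show ?thesis
    unfolding vol4_def wedge_1_3[OF an(1,3)] wedge_1_2[OF an(1,2)] wedge_1_1
    by (simp add: Z_def algebra_simps)
qed

lemma alt_form_kahler: "alt_form (*\<^sub>R) 2 (kahler A)"
proof -
  let ?f = "\<lambda>xs. Im (\<Sum>j\<in>A. cnj (xs ! 0 $ j) * xs ! 1 $ j)"
  have f: "alt_form (*\<^sub>R) 2 ?f"
    unfolding alt_form_def multilin_def
  proof (intro conjI allI impI)
    fix xs :: "C8 list" and i :: nat and u v assume h: "length xs = 2 \<and> i < 2"
    then have "i = 0 \<or> i = 1" by auto
    then show "?f (xs[i := u + v]) = ?f (xs[i := u]) + ?f (xs[i := v])"
      using h by (auto simp: sum.distrib sum_subtractf algebra_simps)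
  next
    fix xs :: "C8 list" and i :: nat and u and c :: real assume h: "length xs = 2 \<and> i < 2"
    then have "i = 0 \<or> i = 1" by auto
    then show "?f (xs[i := c *\<^sub>R u]) = c * ?f (xs[i := u])"
      using h by (auto simp: sum_distrib_left algebra_simps)
  next
    fix xs :: "C8 list" and i j :: nat
    assume h: "length xs = 2 \<and> i < j \<and> j < 2 \<and> xs ! i = xs ! j"
    then have ij: "i = 0" "j = 1" by linarith+
    have "xs ! 0 = xs ! 1" using h unfolding ij by blast
    then show "?f xs = 0" by (simp add: mult.commute)
  qed
  show ?thesis
  proof (rule alt_form_cong[OF f])
    fix xs :: "C8 list" assume "length xs = 2"
    then obtain v w where "xs = [v, w]" by (metis (no_types) One_nat_def Suc_1 length_0_conv length_Suc_conv)
    then show "?f xs = kahler A xs" by (simp add: kahler_complex(2))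
  qed
qed

lemma alt_form_\<omega>: "alt_form (*\<^sub>R) 2 \<omega>" "alt_form (*\<^sub>R) 2 \<omega>1" "alt_form (*\<^sub>R) 2 \<omega>2"
proof -
  show "alt_form (*\<^sub>R) 2 \<omega>1" "alt_form (*\<^sub>R) 2 \<omega>2"
    unfolding \<omega>1_def \<omega>2_def by (rule alt_form_kahler)+
  then show "alt_form (*\<^sub>R) 2 \<omega>"
    using alt_form_add[of "(*\<^sub>R)" 2 \<omega>1 \<omega>2] by (rule_tac alt_form_cong) (auto simp: \<omega>_def)
qed

text \<open>The complex determinant of eight vectors, kept complex valued because its phase on a
  unitary basis enters Jacobi's identity.\<close>

definition \<Omega>12 :: "C8 list \<Rightarrow> complex" where
  "\<Omega>12 = \<Omega>1 \<and>\<^bsub>4,4\<^esub> \<Omega>2"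

lemma alt_form_\<Omega>12: "alt_form (*s) 8 \<Omega>12"
  using alt_form_wedge[OF alt_formD(1)[OF alt_form_vol_pieces(3)] alt_formD(1)[OF alt_form_vol_pieces(3)]]
  unfolding \<Omega>12_def \<Omega>_eq_vol4 by simp

lemma wedge_power_one:
  fixes \<alpha> :: "'v list \<Rightarrow> 'b::real_normed_field"
  assumes "antisym_form d \<alpha>" "length xs = d"
  shows "wedge_power d \<alpha> 1 xs = \<alpha> xs"
proof -
  have "p ` {..<d} = {..<d}" if "p permutes {..<d}" for p using permutes_image[OF that] .
  then have "(\<alpha> \<and>\<^bsub>d,d * 0\<^esub> wedge_power d \<alpha> 0) xs = \<alpha> (take d xs) * wedge_power d \<alpha> 0 (drop d xs)"
    using assms by (intro wedge_first_block) (auto simp: antisym_form_def)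
  then show ?thesis using assms by simp
qed

text \<open>Arbitrary arguments are needed: in the mixed term the second factor meets vectors from
  the blocks in every possible arrangement.\<close>

lemma wedge_power_2_2:
  fixes \<alpha> :: "'v::real_vector list \<Rightarrow> real"
  assumes \<alpha>: "alt_form (*\<^sub>R) 2 \<alpha>"
  shows "wedge_power 2 \<alpha> 2 [a, b, c, d] =
    2 * (\<alpha> [a, b] * \<alpha> [c, d] - \<alpha> [a, c] * \<alpha> [b, d] + \<alpha> [a, d] * \<alpha> [b, c])"
proof -
  note an = alt_form_antisym[OF \<alpha>]
  have an1: "antisym_form 2 (wedge_power 2 \<alpha> 1)"
    using alt_form_antisym[OF alt_form_wedge_power[OF alt_formD(1)[OF \<alpha>], of 1]] by simp
  have sw: "\<alpha> [y, x] = - \<alpha> [x, y]" for x y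
    using an[unfolded antisym_form_def, rule_format, of "[x, y]" 0 1] by simp
  have "wedge_power 2 \<alpha> 2 = \<alpha> \<and>\<^bsub>2,2\<^esub> wedge_power 2 \<alpha> 1"
    by (simp add: numeral_2_eq_2)
  moreover have "wedge_power 2 \<alpha> 1 [x, y] = \<alpha> [x, y]" for x y
    by (rule wedge_power_one[OF an]) simp
  ultimately show ?thesis
    by (simp only: wedge_2_2[OF an an1] sw[of b c] sw[of b d] sw[of a c]) (simp add: algebra_simps)
qed


lemma alt_form_\<Phi>:
  "alt_form (*\<^sub>R) 8 (\<lambda>xs. Re (\<Omega>12 xs))"
  "alt_form (*\<^sub>R) 8 (\<lambda>xs. 1 / fact 4 * wedge_power 2 \<omega> 4 xs)"
  "alt_form (*\<^sub>R) 4 (\<lambda>ys. Re (\<Omega>1 ys + \<Omega>2 ys))"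
  "alt_form (*\<^sub>R) 4 (\<lambda>ys. 1 / 2 * wedge_power 2 \<omega> 2 ys)"
  "alt_form (*\<^sub>R) 8 \<Phi>"
proof -
  have e: "2 * 4 = (8::nat)" "2 * 2 = (4::nat)" "4 + 4 = (8::nat)" by simp_all
  note wp = alt_form_wedge_power[OF alt_formD(1)[OF alt_form_\<omega>(1)]]
  show 1: "alt_form (*\<^sub>R) 8 (\<lambda>xs. Re (\<Omega>12 xs))"
    by (rule alt_form_Re[OF alt_form_\<Omega>12])
  show 2: "alt_form (*\<^sub>R) 8 (\<lambda>xs. 1 / fact 4 * wedge_power 2 \<omega> 4 xs)"
    by (rule alt_form_cmult[OF wp[of 4, unfolded e]])
  show 3: "alt_form (*\<^sub>R) 4 (\<lambda>ys. Re (\<Omega>1 ys + \<Omega>2 ys))"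
    unfolding \<Omega>_eq_vol4 by (intro alt_form_Re alt_form_add alt_form_vol_pieces)
  show 4: "alt_form (*\<^sub>R) 4 (\<lambda>ys. 1 / 2 * wedge_power 2 \<omega> 2 ys)"
    by (rule alt_form_cmult[OF wp[of 2, unfolded e]])
  have "\<Phi> = (\<lambda>xs. Re (\<Omega>12 xs) + 1 / fact 4 * wedge_power 2 \<omega> 4 xs
       + ((\<lambda>ys. Re (\<Omega>1 ys + \<Omega>2 ys)) \<and>\<^bsub>4,4\<^esub> (\<lambda>ys. 1 / 2 * wedge_power 2 \<omega> 2 ys)) xs)"
    by (simp add: fun_eq_iff \<Phi>_def \<Omega>12_def)
  then show "alt_form (*\<^sub>R) 8 \<Phi>"
    using alt_form_add[OF alt_form_add[OF 1 2] alt_form_wedge[OF alt_formD(1)[OF 3] alt_formD(1)[OF 4], unfolded e]]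
    by simp
qed

lemma vol4_swap: "vol4 i j k l [c, d, a, b] = vol4 i j k l [a, b, c, d]"
  unfolding vol4_eq by (simp add: algebra_simps)

text \<open>The hypothesis lists the three ways, one for each term of the square of
  \<open>\<omega>\<close>, in which the last four slots can consist of two complete blocks. The
  first four slots then hold the other two blocks.\<close>

lemma pair_permutation_image:
  assumes p: "p permutes {..<8::nat}"
    and pair: "(p 4 div 2 = p 5 div 2 \<and> p 6 div 2 = p 7 div 2) \<or> (p 4 div 2 = p 6 div 2 \<and> p 5 div 2 = p 7 div 2)
      \<or> (p 4 div 2 = p 7 div 2 \<and> p 5 div 2 = p 6 div 2)"
  shows "p ` {..<4} \<in> {{0,1,2,3}, {0,1,4,5}, {0,1,6,7}, {2,3,4,5}, {2,3,6,7}, {4,5,6,7}}"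
proof -
  have lt: "p i < 8" if "i < 8" for i using permutes_in_image[OF p, of i] that by simp
  have inj: "p i = p j \<longleftrightarrow> i = j" for i j using permutes_inj[OF p] by (simp add: inj_eq)
  have block: "{a, b} = {2 * (a div 2), Suc (2 * (a div 2))}" if "a div 2 = b div 2" "a \<noteq> b" for a b :: nat
    using that by (auto; presburger)
  have two: "\<exists>l m. l < 4 \<and> m < 4 \<and> l \<noteq> m \<and> {a, b, c, d} = {2 * l, Suc (2 * l), 2 * m, Suc (2 * m)}"
    if "a div 2 = b div 2" "c div 2 = d div 2" "distinct [a, b, c, d]" "a < 8" "c < 8" for a b c d :: nat
  proof (intro exI conjI)
    show "a div 2 < 4" "c div 2 < 4" using that by auto
    have "{a, b, c, d} = {a, b} \<union> {c, d}" by auto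
    then show "{a, b, c, d} = {2 * (a div 2), Suc (2 * (a div 2)), 2 * (c div 2), Suc (2 * (c div 2))}"
      using block[of a b] block[of c d] that by auto
    show "a div 2 \<noteq> c div 2"
    proof
      assume "a div 2 = c div 2"
      then have "{a, b} = {c, d}" using block[of a b] block[of c d] that by simp
      then show False using that(3) by (simp add: doubleton_eq_iff)
    qed
  qed
  have "\<exists>l m. l < 4 \<and> m < 4 \<and> l \<noteq> m \<and> {p 4, p 5, p 6, p 7} = {2 * l, Suc (2 * l), 2 * m, Suc (2 * m)}"
    using pair
  proof (elim disjE conjE)
    assume "p 4 div 2 = p 5 div 2" "p 6 div 2 = p 7 div 2"
    then show ?thesis using two[of "p 4" "p 5" "p 6" "p 7"] by (simp add: inj lt)
  next
    assume "p 4 div 2 = p 6 div 2" "p 5 div 2 = p 7 div 2"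
    then show ?thesis using two[of "p 4" "p 6" "p 5" "p 7"] by (simp add: inj lt insert_commute)
  next
    assume "p 4 div 2 = p 7 div 2" "p 5 div 2 = p 6 div 2"
    then show ?thesis using two[of "p 4" "p 7" "p 5" "p 6"] by (simp add: inj lt insert_commute)
  qed
  then obtain l m where lm: "l < 4" "m < 4" "l \<noteq> m"
    "{p 4, p 5, p 6, p 7} = {2 * l, Suc (2 * l), 2 * m, Suc (2 * m)}" by blast
  have "p ` {..<4} = p ` ({..<8} - {4, 5, 6, 7})" by (rule arg_cong[of _ _ "image p"]) auto
  also have "\<dots> = p ` {..<8} - p ` {4, 5, 6, 7}" by (rule image_set_diff[OF permutes_inj[OF p]])
  also have "\<dots> = {0,1,2,3,4,5,6,7} - {2 * l, Suc (2 * l), 2 * m, Suc (2 * m)}"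
    unfolding permutes_image[OF p] by (simp only: image_insert image_empty lm(4) lessThan_small)
  finally have im: "p ` {..<4} = {0,1,2,3,4,5,6,7} - {2 * l, Suc (2 * l), 2 * m, Suc (2 * m)}" .
  have "l \<in> {0,1,2,3}" "m \<in> {0,1,2,3}" using lm by auto
  then show ?thesis unfolding im using lm(3)
    by (elim insertE emptyE; simp add: insert_Diff_if)
qed

text \<open>
  On a list whose Kaehler matrix is block diagonal, the last factor of the mixed term only sees
  the six unions of two blocks.
\<close>

lemma mixed_form_adapted:
  fixes u1 :: C8
  assumes ad: "adapted \<omega> [u1, u2, u3, u4, u5, u6, u7, u8]" and \<alpha>: "\<alpha> = (\<lambda>ys. Re (\<Omega>1 ys + \<Omega>2 ys))"
  shows "(\<alpha> \<and>\<^bsub>4,4\<^esub> (\<lambda>ys. 1 / 2 * wedge_power 2 \<omega> 2 ys)) [u1, u2, u3, u4, u5, u6, u7, u8] =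
    \<alpha> [u1, u2, u3, u4] * (\<omega> [u5, u6] * \<omega> [u7, u8]) + \<alpha> [u1, u2, u5, u6] * (\<omega> [u3, u4] * \<omega> [u7, u8])
  + \<alpha> [u1, u2, u7, u8] * (\<omega> [u3, u4] * \<omega> [u5, u6]) + \<alpha> [u3, u4, u5, u6] * (\<omega> [u1, u2] * \<omega> [u7, u8])
  + \<alpha> [u3, u4, u7, u8] * (\<omega> [u1, u2] * \<omega> [u5, u6]) + \<alpha> [u5, u6, u7, u8] * (\<omega> [u1, u2] * \<omega> [u3, u4])"
proof -
  let ?us = "[u1, u2, u3, u4, u5, u6, u7, u8]"
  let ?\<beta> = "\<lambda>ys. 1 / 2 * wedge_power 2 \<omega> 2 ys"
  let ?t = "Transposition.transpose :: nat \<Rightarrow> _"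
  let ?rs = "[id, ?t 2 4 \<circ> ?t 3 5, ?t 2 6 \<circ> ?t 3 7, ?t 0 4 \<circ> ?t 1 5, ?t 0 6 \<circ> ?t 1 7,
    (?t 0 4 \<circ> ?t 1 5) \<circ> (?t 2 6 \<circ> ?t 3 7)]"
  let ?im = "\<lambda>p :: nat \<Rightarrow> nat. p ` {..<4}"
  let ?sets = "[{0,1,2,3}, {0,1,4,5}, {0,1,6,7}, {2,3,4,5}, {2,3,6,7}, {4,5,6,7}] :: nat set list"
  have an: "antisym_form 4 \<alpha>" "antisym_form 4 ?\<beta>"
    unfolding \<alpha> using alt_form_\<Phi>(3,4)[THEN alt_form_antisym] by blast+
  have perm: "p permutes {..<4 + 4}" if "p \<in> set ?rs" for p
    using that by (auto intro!: permutes_swap_id permutes_compose permutes_id)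
  have sg: "sign p = 1" if "p \<in> set ?rs" for p
    using that by (auto simp: sign_compose permutation_swap_id permutation_compose sign_swap_id)
  have ims: "map ?im ?rs = ?sets"
    by (simp add: lessThan_small Transposition.transpose_def insert_commute)
  \<comment> \<open>Membership of 2, 4 and 6 tells the six unions of blocks apart.\<close>
  have "distinct (map (\<lambda>S. (2 \<in> S, 4 \<in> S, 6 \<in> S)) ?sets)" by simp
  then have "distinct (map ?im ?rs)" unfolding ims distinct_map by blast
  then have dist: "distinct ?rs" and inj: "inj_on ?im (set ?rs)"
    unfolding distinct_map by blast+
  have sw: "\<omega> [y, x] = - \<omega> [x, y]" for x y
    using alt_form_antisym[OF alt_form_\<omega>(1), unfolded antisym_form_def, rule_format, of "[x, y]" 0 1] by simp
  have \<beta>: "?\<beta> [a, b, c, d] = \<omega> [a, b] * \<omega> [c, d] - \<omega> [a, c] * \<omega> [b, d] + \<omega> [a, d] * \<omega> [b, c]" for a b c d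
    by (simp add: wedge_power_2_2[OF alt_form_\<omega>(1)])
  have adz: "\<omega> [?us ! i, ?us ! j] = 0" if "i < 8" "j < 8" "i div 2 \<noteq> j div 2" for i j
    using ad that unfolding adapted_def by simp
  have "(\<alpha> \<and>\<^bsub>4,4\<^esub> ?\<beta>) ?us = (\<Sum>p\<in>set ?rs. of_int (sign p) *
     (\<alpha> (take 4 (permute_list p ?us)) * ?\<beta> (drop 4 (permute_list p ?us))))"
  proof (rule wedge_representatives[OF an _ _ perm inj], goal_cases)
    case (4 p)
    then have p: "p permutes {..<8}" by simp
    have d: "drop 4 (permute_list p ?us) = [?us ! p 4, ?us ! p 5, ?us ! p 6, ?us ! p 7]"
      by (simp add: permute_list_small(4))
    have notin: "p ` {..<4} \<notin> set ?sets" using 4(2) unfolding ims[symmetric] by simp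
    have n: "\<not> ((p 4 div 2 = p 5 div 2 \<and> p 6 div 2 = p 7 div 2) \<or> (p 4 div 2 = p 6 div 2 \<and> p 5 div 2 = p 7 div 2)
      \<or> (p 4 div 2 = p 7 div 2 \<and> p 5 div 2 = p 6 div 2))" (is "\<not> ?pair")
    proof
      assume ?pair
      from pair_permutation_image[OF p this] show False using notin by (simp only: list.set) blast
    qed
    have lt: "p i < 8" if "i < 8" for i using permutes_in_image[OF p, of i] that by simp
    have z: "\<omega> [?us ! p i, ?us ! p j] = 0" if "p i div 2 \<noteq> p j div 2" "i < 8" "j < 8" for i j
      using adz[OF lt lt that(1)] that by blast
    have z': "p 4 div 2 \<noteq> p 5 div 2 \<Longrightarrow> \<omega> [?us ! p 4, ?us ! p 5] = 0" "p 6 div 2 \<noteq> p 7 div 2 \<Longrightarrow> \<omega> [?us ! p 6, ?us ! p 7] = 0"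
      "p 4 div 2 \<noteq> p 6 div 2 \<Longrightarrow> \<omega> [?us ! p 4, ?us ! p 6] = 0" "p 5 div 2 \<noteq> p 7 div 2 \<Longrightarrow> \<omega> [?us ! p 5, ?us ! p 7] = 0"
      "p 4 div 2 \<noteq> p 7 div 2 \<Longrightarrow> \<omega> [?us ! p 4, ?us ! p 7] = 0" "p 5 div 2 \<noteq> p 6 div 2 \<Longrightarrow> \<omega> [?us ! p 5, ?us ! p 6] = 0"
      by (rule z; simp)+
    have "\<omega> [?us ! p 4, ?us ! p 5] * \<omega> [?us ! p 6, ?us ! p 7] = 0"
      "\<omega> [?us ! p 4, ?us ! p 6] * \<omega> [?us ! p 5, ?us ! p 7] = 0"
      "\<omega> [?us ! p 4, ?us ! p 7] * \<omega> [?us ! p 5, ?us ! p 6] = 0"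
      unfolding mult_eq_0_iff using n z' by blast+
    then have "?\<beta> (drop 4 (permute_list p ?us)) = 0"
      unfolding d \<beta> by (simp only:)
    then show ?case by (simp only: mult_zero_right)
  qed simp_all
  also have "\<dots> = (\<Sum>p\<in>set ?rs. \<alpha> (take 4 (permute_list p ?us)) * ?\<beta> (drop 4 (permute_list p ?us)))"
    by (rule sum.cong[OF refl]) (simp only: sg of_int_1 mult_1_left)
  also have "\<dots> = sum_list (map (\<lambda>p. \<alpha> (take 4 (permute_list p ?us)) * ?\<beta> (drop 4 (permute_list p ?us))) ?rs)"
    by (rule sum_list_distinct_conv_sum_set[OF dist, symmetric])
  also have "\<dots> = \<alpha> [u1, u2, u3, u4] * ?\<beta> [u5, u6, u7, u8] + (\<alpha> [u1, u2, u5, u6] * ?\<beta> [u3, u4, u7, u8]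
     + (\<alpha> [u1, u2, u7, u8] * ?\<beta> [u5, u6, u3, u4] + (\<alpha> [u5, u6, u3, u4] * ?\<beta> [u1, u2, u7, u8]
     + (\<alpha> [u7, u8, u3, u4] * ?\<beta> [u5, u6, u1, u2] + \<alpha> [u5, u6, u7, u8] * ?\<beta> [u1, u2, u3, u4]))))"
    by (simp add: permute_list_small(4) Transposition.transpose_def del: permute_list_id wedge_power.simps)
  also have "\<dots> = \<alpha> [u1, u2, u3, u4] * (\<omega> [u5, u6] * \<omega> [u7, u8]) + \<alpha> [u1, u2, u5, u6] * (\<omega> [u3, u4] * \<omega> [u7, u8])
  + \<alpha> [u1, u2, u7, u8] * (\<omega> [u3, u4] * \<omega> [u5, u6]) + \<alpha> [u3, u4, u5, u6] * (\<omega> [u1, u2] * \<omega> [u7, u8])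
  + \<alpha> [u3, u4, u7, u8] * (\<omega> [u1, u2] * \<omega> [u5, u6]) + \<alpha> [u5, u6, u7, u8] * (\<omega> [u1, u2] * \<omega> [u3, u4])"
  proof -
    have z: "\<omega> [u5, u7] = 0" "\<omega> [u5, u8] = 0" "\<omega> [u3, u7] = 0" "\<omega> [u3, u8] = 0" "\<omega> [u5, u3] = 0" "\<omega> [u5, u4] = 0"
      "\<omega> [u1, u7] = 0" "\<omega> [u1, u8] = 0" "\<omega> [u5, u1] = 0" "\<omega> [u5, u2] = 0" "\<omega> [u1, u3] = 0" "\<omega> [u1, u4] = 0"
      using adz[of 4 6] adz[of 4 7] adz[of 2 6] adz[of 2 7] adz[of 4 2] adz[of 4 3] adz[of 0 6] adz[of 0 7]
        adz[of 4 0] adz[of 4 1] adz[of 0 2] adz[of 0 3] by simp_all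
    have s: "\<alpha> [c, d, a, b] = \<alpha> [a, b, c, d]" for a b c d
      unfolding \<alpha> \<Omega>_eq_vol4 vol4_swap[of _ _ _ _ c d] ..
    show ?thesis
      unfolding \<beta> z s[of u5 u6] s[of u7 u8 u3] by (simp add: algebra_simps)
  qed
  finally show ?thesis .
qed

lemma \<Phi>_adapted:
  fixes u1 :: C8
  assumes ad: "adapted \<omega> [u1, u2, u3, u4, u5, u6, u7, u8]" and \<alpha>: "\<alpha> = (\<lambda>ys. Re (\<Omega>1 ys + \<Omega>2 ys))"
  shows "\<Phi> [u1, u2, u3, u4, u5, u6, u7, u8] =
    Re (\<Omega>12 [u1, u2, u3, u4, u5, u6, u7, u8]) + \<omega> [u1, u2] * \<omega> [u3, u4] * \<omega> [u5, u6] * \<omega> [u7, u8]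
  + (\<alpha> [u1, u2, u3, u4] * (\<omega> [u5, u6] * \<omega> [u7, u8]) + \<alpha> [u1, u2, u5, u6] * (\<omega> [u3, u4] * \<omega> [u7, u8])
  + \<alpha> [u1, u2, u7, u8] * (\<omega> [u3, u4] * \<omega> [u5, u6]) + \<alpha> [u3, u4, u5, u6] * (\<omega> [u1, u2] * \<omega> [u7, u8])
  + \<alpha> [u3, u4, u7, u8] * (\<omega> [u1, u2] * \<omega> [u5, u6]) + \<alpha> [u5, u6, u7, u8] * (\<omega> [u1, u2] * \<omega> [u3, u4]))"
proof -
  have "wedge_power 2 \<omega> 4 [u1, u2, u3, u4, u5, u6, u7, u8] =
      fact 4 * (\<Prod>j<4. \<omega> [[u1, u2, u3, u4, u5, u6, u7, u8] ! (2 * j), [u1, u2, u3, u4, u5, u6, u7, u8] ! Suc (2 * j)])"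
    by (rule wedge_power_adapted[OF alt_form_\<omega>(1) _ ad]) simp
  then have "1 / fact 4 * wedge_power 2 \<omega> 4 [u1, u2, u3, u4, u5, u6, u7, u8] =
      \<omega> [u1, u2] * \<omega> [u3, u4] * \<omega> [u5, u6] * \<omega> [u7, u8]"
    by (simp add: lessThan_small mult.assoc del: wedge_power.simps)
  then show ?thesis
    unfolding \<Phi>_def using mixed_form_adapted[OF ad \<alpha>] by (simp only: \<Omega>12_def \<alpha>)
qed

section \<open>Minors of unitary matrices\<close>


text \<open>The list version of \<open>unitary_basis\<close>, since Jacobi's identity will be used
  for several orderings of the same basis.\<close>

definition unitary_list :: "C8 list \<Rightarrow> bool" where
  "unitary_list fs \<longleftrightarrow> length fs = 8 \<and>
     (\<forall>i<8. \<forall>j<8. herm (fs ! i) (fs ! j) = (if i = j then 1 else 0))"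

lemma unitary_list_map:
  assumes "unitary_basis e" "distinct is" "length is = 8"
  shows "unitary_list (map e is)"
  using assms by (simp add: unitary_list_def unitary_basis_def nth_eq_iff_index_eq)

lemma unitary_matrix_of_columns: "unitary_matrix (matrix_of_columns e) \<longleftrightarrow> unitary_basis e"
proof -
  let ?E = "matrix_of_columns e"
  have "(adjoint_matrix ?E ** ?E) $ i $ j = herm (e i) (e j)" for i j
    by (simp add: matrix_matrix_mult_def adjoint_matrix_def matrix_of_columns_def herm_def)
  then have "adjoint_matrix ?E ** ?E = mat 1 \<longleftrightarrow> unitary_basis e"
    unfolding unitary_basis_def vec_eq_iff by (simp add: mat_def)
  then show ?thesis unfolding unitary_matrix_def using matrix_left_right_inverse by blast
qed

lemma unitary_basis_rows:
  assumes "unitary_basis e"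
  shows "(\<Sum>k\<in>UNIV. e k $ a * cnj (e k $ b)) = (if a = b then 1 else 0)"
proof -
  let ?E = "matrix_of_columns e"
  have "?E ** adjoint_matrix ?E = mat 1"
    using assms unitary_matrix_of_columns unfolding unitary_matrix_def by blast
  then have "(?E ** adjoint_matrix ?E) $ a $ b = mat 1 $ a $ b" by simp
  then show ?thesis
    by (simp add: matrix_matrix_mult_def adjoint_matrix_def matrix_of_columns_def mat_def)
qed

lemma unitary_list_rows:
  assumes "unitary_list fs"
  shows "(\<Sum>k<8. fs ! k $ a * cnj (fs ! k $ b)) = (if a = b then 1 else 0)"
proof -
  have "card {..<8::nat} = card (UNIV :: 8 set)" by simp
  then obtain h :: "nat \<Rightarrow> 8" where h: "bij_betw h {..<8} UNIV"
    using finite_same_card_bij[of "{..<8::nat}" "UNIV :: 8 set"] by auto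
  define e where "e i = fs ! the_inv_into {..<8} h i" for i
  have inj: "inj_on h {..<8}" using h bij_betw_def by blast
  have eh: "e (h k) = fs ! k" if "k < 8" for k
    using that inj by (simp add: e_def the_inv_into_f_f)
  have "\<exists>k<8. i = h k" for i using h unfolding bij_betw_def by (metis UNIV_I image_iff lessThan_iff)
  then have "unitary_basis e"
    using assms inj unfolding unitary_basis_def unitary_list_def
    by (metis eh inj_on_eq_iff lessThan_iff)
  from unitary_basis_rows[OF this, of a b] show ?thesis
    using sum.reindex_bij_betw[OF h, of "\<lambda>i. e i $ a * cnj (e i $ b)"] by (simp add: eh)
qed

lemma \<Omega>_vanish:
  "x \<in> set [a, b, c, d] \<Longrightarrow> x \<in> X2 \<Longrightarrow> \<Omega>1 [a, b, c, d] = 0"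
  "x \<in> set [a, b, c, d] \<Longrightarrow> x \<in> X1 \<Longrightarrow> \<Omega>2 [a, b, c, d] = 0"
  unfolding \<Omega>_eq_vol4 vol4_eq X1_def X2_def by auto

lemma length_4_list:
  assumes "length xs = 4"
  obtains a b c d where "xs = [a, b, c, d]"
  using assms by (auto simp: numeral_eq_Suc length_Suc_conv)

text \<open>A permutation that does not preserve the first half moves some index from the second
  half into it and some index of the first half out of it. Under either alternative of the
  hypothesis one of the two volume forms then meets a vector on which it vanishes.\<close>

lemma \<Omega>12_block:
  assumes l: "length us = 8"
    and X: "(\<forall>i<4. us ! i \<in> X1) \<or> (\<forall>i. 4 \<le> i \<and> i < 8 \<longrightarrow> us ! i \<in> X2)"
  shows "\<Omega>12 us = \<Omega>1 (take 4 us) * \<Omega>2 (drop 4 us)"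
  unfolding \<Omega>12_def
proof (rule wedge_first_block)
  show "antisym_form 4 \<Omega>1" "antisym_form 4 \<Omega>2"
    unfolding \<Omega>_eq_vol4 by (rule alt_form_antisym[OF alt_form_vol_pieces(3)])+
  show "length us = 4 + 4" using l by simp
  fix p assume "p permutes {..<4 + 4::nat}" and ne: "p ` {..<4} \<noteq> {..<4}"
  then have p: "p permutes {..<8}" by simp
  let ?ys = "permute_list p us"
  have nth: "?ys ! i = us ! p i" if "i < 8" for i using permute_list_nth[of p us i] p l that by simp
  have lt: "p i < 8" if "i < 8" for i using permutes_in_image[OF p, of i] that by simp
  obtain a b c d where abcd: "take 4 ?ys = [a, b, c, d]" by (rule length_4_list[of "take 4 ?ys"]) (simp add: l)
  obtain a' b' c' d' where abcd': "drop 4 ?ys = [a', b', c', d']" by (rule length_4_list[of "drop 4 ?ys"]) (simp add: l)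
  have inj: "inj_on p {..<4}" using permutes_inj[OF p] inj_on_subset by blast
  have n1: "\<not> p ` {..<4} \<subseteq> {..<4}"
    using ne endo_inj_surj[OF _ _ inj] by auto
  then obtain i where i: "i < 4" "4 \<le> p i" by (meson image_subsetI lessThan_iff not_less)
  have "\<not> {..<4} \<subseteq> p ` {..<4}"
    using ne card_subset_eq[of "p ` {..<4}" "{..<4}"] card_image[OF inj] by auto
  then obtain m where m: "m < 4" "m \<notin> p ` {..<4}" by auto
  have "m \<in> p ` {..<8}" using m(1) permutes_image[OF p] by simp
  then obtain j where j: "j < 8" "p j = m" by auto
  have j4: "4 \<le> j"
    using m(2) j by (metis imageI lessThan_iff not_le)
  show "\<Omega>1 (take 4 ?ys) * \<Omega>2 (drop 4 ?ys) = 0"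
    using X
  proof
    assume "\<forall>i<4. us ! i \<in> X1"
    then have "?ys ! j \<in> X1" using j m nth by simp
    moreover have "?ys ! j = drop 4 ?ys ! (j - 4)" using j4 l j by simp
    moreover have "drop 4 ?ys ! (j - 4) \<in> set (drop 4 ?ys)" using j j4 l by (intro nth_mem) simp
    ultimately show ?thesis using \<Omega>_vanish(2) unfolding abcd' by (metis mult_zero_right)
  next
    assume "\<forall>i. 4 \<le> i \<and> i < 8 \<longrightarrow> us ! i \<in> X2"
    then have "?ys ! i \<in> X2" using i nth lt by simp
    moreover have "?ys ! i = take 4 ?ys ! i" using i by simp
    moreover have "take 4 ?ys ! i \<in> set (take 4 ?ys)" using i l by (intro nth_mem) simp
    ultimately show ?thesis using \<Omega>_vanish(1) unfolding abcd by (metis mult_zero_left)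
  qed
qed

abbreviation ax :: "8 \<Rightarrow> C8" where "ax i \<equiv> axis i 1"

lemma \<Omega>_axis: "\<Omega>1 [ax 1, ax 2, ax 3, ax 4] = 1" "\<Omega>2 [ax 5, ax 6, ax 7, ax 8] = 1"
  unfolding \<Omega>_eq_vol4 vol4_eq by (simp_all add: axis_def)

text \<open>
  Jacobi's identity between complementary minors of a unitary matrix: writing the first four
  coordinate vectors in the basis and substituting them for \<open>f1, ..., f4\<close> multiplies the complex
  volume by the conjugate minor.
\<close>

lemma unitary_complementary_minor:
  assumes U: "unitary_list [f1, f2, f3, f4, f5, f6, f7, f8]"
  shows "\<Omega>2 [f5, f6, f7, f8] = \<Omega>12 [f1, f2, f3, f4, f5, f6, f7, f8] * cnj (\<Omega>1 [f1, f2, f3, f4])"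
proof -
  let ?fs = "[f1, f2, f3, f4, f5, f6, f7, f8]"
  let ?ix = "[1, 2, 3, 4, 5, 6, 7, 8] :: 8 list"
  let ?es = "[ax 1, ax 2, ax 3, ax 4, ax 5, ax 6, ax 7, ax 8]"
  \<comment> \<open>One coefficient matrix is used twice: it expresses \<open>?xs\<close> through
    \<open>?fs\<close> and \<open>?ys\<close> through the coordinate vectors. Comparing the two
    expansions eliminates the uncomputed determinant \<open>?det\<close>.\<close>
  let ?a = "\<lambda>i j. if i < 4 then cnj (?fs ! j $ (?ix ! i)) else if i = j then 1 else (0::complex)"
  define g where "g i = (\<Sum>j<8. ?a i j *s ?es ! j)" for i
  let ?xs = "[ax 1, ax 2, ax 3, ax 4, f5, f6, f7, f8]"
  let ?ys = "[g 0, g 1, g 2, g 3, ax 5, ax 6, ax 7, ax 8]"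
  let ?det = "\<Sum>p | p permutes {..<8}. of_int (sign p) * (\<Prod>i<8. ?a i (p i))"
  have cases8: "i = 0 \<or> i = 1 \<or> i = 2 \<or> i = 3 \<or> i = 4 \<or> i = 5 \<or> i = 6 \<or> i = 7" if "i < 8" for i :: nat
    using that by auto
  have row: "(\<Sum>k<8. cnj (?fs ! k $ a) *s ?fs ! k) = ax a" for a
    unfolding vec_eq_iff
    using unitary_list_rows[OF U, of _ a]
    by (auto simp: axis_def mult.commute[of "cnj _"] simp del: nth_Cons_numeral)
  have unit: "(\<Sum>j<8. (if i = j then 1 else (0::complex)) *s vs ! j) = vs ! i" if "i < 8" for i and vs :: "C8 list"
  proof -
    have "(\<Sum>j<8. (if i = j then 1 else (0::complex)) *s vs ! j) = (\<Sum>j<8. if i = j then vs ! j else 0)"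
      by (rule sum.cong) auto
    then show ?thesis using that by simp
  qed
  have "\<Omega>12 ?xs = ?det * \<Omega>12 ?fs"
  proof (rule alt_form_linear_combination[OF alt_form_\<Omega>12])
    fix i :: nat assume i: "i < 8"
    show "?xs ! i = (\<Sum>j<8. ?a i j *s ?fs ! j)"
    proof (cases "i < 4")
      case True
      then have "i = 0 \<or> i = 1 \<or> i = 2 \<or> i = 3" by auto
      then have "?xs ! i = ax (?ix ! i)" by auto
      then show ?thesis using row[of "?ix ! i"] True by (simp only: if_True)
    next
      case False
      then have "i = 4 \<or> i = 5 \<or> i = 6 \<or> i = 7" using i by auto
      then have "?xs ! i = ?fs ! i" by auto
      then show ?thesis using unit[OF i, of ?fs] False by (simp only: if_False)
    qed
  qed simp_all
  moreover have "\<Omega>12 ?ys = ?det * \<Omega>12 ?es"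
  proof (rule alt_form_linear_combination[OF alt_form_\<Omega>12])
    fix i :: nat assume i: "i < 8"
    show "?ys ! i = (\<Sum>j<8. ?a i j *s ?es ! j)"
    proof (cases "i < 4")
      case True
      then have "i = 0 \<or> i = 1 \<or> i = 2 \<or> i = 3" by auto
      then have "?ys ! i = g i" by auto
      then show ?thesis by (simp only: g_def)
    next
      case False
      then have "i = 4 \<or> i = 5 \<or> i = 6 \<or> i = 7" using i by auto
      then have "?ys ! i = ?es ! i" by auto
      then show ?thesis using unit[OF i, of ?es] False by (simp only: if_False)
    qed
  qed simp_all
  moreover have e1: "\<Omega>12 ?es = 1"
    using \<Omega>12_block[of ?es] \<Omega>_axis by (auto simp: X1_def axis_def less_Suc_eq numeral_eq_Suc)
  moreover have "\<Omega>12 ?xs = \<Omega>2 [f5, f6, f7, f8]"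
    using \<Omega>12_block[of ?xs] \<Omega>_axis by (auto simp: X1_def axis_def less_Suc_eq numeral_eq_Suc)
  moreover have "\<Omega>12 ?ys = \<Omega>1 [g 0, g 1, g 2, g 3]"
  proof -
    have "\<forall>i. 4 \<le> i \<and> i < 8 \<longrightarrow> ?ys ! i \<in> X2"
    proof (intro allI impI)
      fix i :: nat assume "4 \<le> i \<and> i < 8"
      then have "i = 4 \<or> i = 5 \<or> i = 6 \<or> i = 7" by auto
      then show "?ys ! i \<in> X2" by (elim disjE) (simp_all add: X2_def axis_def)
    qed
    then have "\<Omega>12 ?ys = \<Omega>1 (take 4 ?ys) * \<Omega>2 (drop 4 ?ys)" by (intro \<Omega>12_block) simp_all
    then show ?thesis using \<Omega>_axis(2) by simp
  qed
  moreover have "\<Omega>1 [g 0, g 1, g 2, g 3] = cnj (\<Omega>1 [f1, f2, f3, f4])"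
  proof -
    have g: "g i $ 1 = cnj (f1 $ (?ix ! i))" "g i $ 2 = cnj (f2 $ (?ix ! i))"
      "g i $ 3 = cnj (f3 $ (?ix ! i))" "g i $ 4 = cnj (f4 $ (?ix ! i))" if "i < 4" for i
      using that by (simp_all add: g_def lessThan_small axis_def)
    show ?thesis
      unfolding \<Omega>_eq_vol4 vol4_eq
      by (simp add: g[of 0, simplified] g[of 1, simplified] g[of 2, simplified] g[of 3, simplified])
        (simp add: algebra_simps)
  qed
  ultimately show ?thesis by (simp add: mult.commute)
qed

section \<open>Two-by-two minors, Pfaffians and volume bounds\<close>

definition minor2 :: "C8 \<Rightarrow> C8 \<Rightarrow> 8 \<Rightarrow> 8 \<Rightarrow> complex" where
  "minor2 a b i j = a $ i * b $ j - b $ i * a $ j"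

text \<open>Laplace expansion along the first two vectors; a pair of vectors enters only through its
  minors.\<close>

lemma vol4_minor2:
  "vol4 i j k l [a, b, c, d] = minor2 a b i j * minor2 c d k l - minor2 a b i k * minor2 c d j l
    + minor2 a b i l * minor2 c d j k + minor2 a b j k * minor2 c d i l
    - minor2 a b j l * minor2 c d i k + minor2 a b k l * minor2 c d i j"
  unfolding vol4_eq minor2_def by (simp add: algebra_simps)

text \<open>The Pluecker relation: the bivector of \<open>a\<close> and \<open>b\<close> is
  decomposable, so its square vanishes. It removes the terms with a squared phase from the Pfaffian
  below.\<close>

lemma minor2_pluecker:
  "minor2 a b i j * minor2 a b k l - minor2 a b i k * minor2 a b j l + minor2 a b i l * minor2 a b j k = 0"
  unfolding minor2_def by (simp add: algebra_simps)

text \<open>The entries of the skew matrix \<open>E J E\<^sup>T\<close>, where \<open>E\<close> has the columns \<open>e 1, \<dots>, e 8\<close>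
  and \<open>J = diag (t1 J2, t2 J2, t3 J2, t4 J2)\<close>.\<close>

definition skew_entry :: "complex \<Rightarrow> complex \<Rightarrow> complex \<Rightarrow> complex \<Rightarrow> (8 \<Rightarrow> C8) \<Rightarrow> 8 \<Rightarrow> 8 \<Rightarrow> complex" where
  "skew_entry t1 t2 t3 t4 e a b = t1 * minor2 (e 1) (e 2) a b + t2 * minor2 (e 3) (e 4) a b
     + t3 * minor2 (e 5) (e 6) a b + t4 * minor2 (e 7) (e 8) a b"

lemma skew_entry_antisym: "skew_entry t1 t2 t3 t4 e b a = - skew_entry t1 t2 t3 t4 e a b"
  unfolding skew_entry_def minor2_def by (simp add: algebra_simps)

text \<open>The value of \<open>\<psi>\<close> on half the exterior square of the bivector t1 e1 e2
  + t2 e3 e4 + t3 e5 e6 + t4 e7 e8.\<close>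

definition pair_volumes :: "complex \<Rightarrow> complex \<Rightarrow> complex \<Rightarrow> complex \<Rightarrow> (8 \<Rightarrow> C8) \<Rightarrow> (C8 list \<Rightarrow> complex) \<Rightarrow> complex" where
  "pair_volumes t1 t2 t3 t4 e \<psi> = t1 * t2 * \<psi> [e 1, e 2, e 3, e 4] + t3 * t4 * \<psi> [e 5, e 6, e 7, e 8]
     + t1 * t3 * \<psi> [e 1, e 2, e 5, e 6] + t2 * t4 * \<psi> [e 3, e 4, e 7, e 8]
     + t1 * t4 * \<psi> [e 1, e 2, e 7, e 8] + t2 * t3 * \<psi> [e 3, e 4, e 5, e 6]"

text \<open>The right side is the Pfaffian of the block with indices i, j, k, l. Expanded, its mixed
  products are Laplace expansions and its pure products cancel by the Pluecker relation.\<close>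

lemma pair_volumes_pfaffian:
  "pair_volumes t1 t2 t3 t4 e (vol4 i j k l) =
    skew_entry t1 t2 t3 t4 e i j * skew_entry t1 t2 t3 t4 e k l
    - skew_entry t1 t2 t3 t4 e i k * skew_entry t1 t2 t3 t4 e j l
    + skew_entry t1 t2 t3 t4 e i l * skew_entry t1 t2 t3 t4 e j k" (is "?l = ?r")
proof -
  let ?P = "\<lambda>a b. minor2 a b i j * minor2 a b k l - minor2 a b i k * minor2 a b j l + minor2 a b i l * minor2 a b j k"
  have "?r = ?l + t1\<^sup>2 * ?P (e 1) (e 2) + t2\<^sup>2 * ?P (e 3) (e 4) + t3\<^sup>2 * ?P (e 5) (e 6) + t4\<^sup>2 * ?P (e 7) (e 8)"
    unfolding skew_entry_def pair_volumes_def vol4_minor2 by (simp add: algebra_simps power2_eq_square)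
  then show ?thesis unfolding minor2_pluecker by simp
qed

text \<open>The matrix of these entries is a product of unitary matrices. Concretely, its row
  \<open>a\<close> is the vector \<open>m\<close>, whose coefficients in the basis are, up to phase
  and order, the entries of row \<open>a\<close> of the basis matrix.\<close>

lemma skew_entry_row_norm:
  assumes e: "unitary_basis e" and t: "norm t1 = 1" "norm t2 = 1" "norm t3 = 1" "norm t4 = 1"
  shows "(\<Sum>b\<in>UNIV. (norm (skew_entry t1 t2 t3 t4 e a b))\<^sup>2) = 1"
proof -
  define m where "m = (t1 * e 1 $ a) *s e 2 - (t1 * e 2 $ a) *s e 1 + ((t2 * e 3 $ a) *s e 4 - (t2 * e 4 $ a) *s e 3)
    + ((t3 * e 5 $ a) *s e 6 - (t3 * e 6 $ a) *s e 5) + ((t4 * e 7 $ a) *s e 8 - (t4 * e 8 $ a) *s e 7)"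
  have m: "m $ b = skew_entry t1 t2 t3 t4 e a b" for b
    unfolding m_def skew_entry_def minor2_def by (simp add: algebra_simps)
  have ee: "herm (e i) (e j) = (if i = j then 1 else 0)" for i j
    using e unfolding unitary_basis_def by blast
  have tt: "t * (cnj t * x) = x" if "norm t = 1" for t x :: complex
  proof -
    have "t * cnj t = 1" using that by (simp add: complex_norm_square[symmetric])
    then show ?thesis by (simp add: mult.assoc[symmetric])
  qed
  have "herm m m = (\<Sum>k\<in>UNIV. e k $ a * cnj (e k $ a))"
    unfolding m_def sum_8 by (simp add: ee algebra_simps tt[OF t(1)] tt[OF t(2)] tt[OF t(3)] tt[OF t(4)])
  then have "herm m m = 1" using unitary_basis_rows[OF e, of a a] by simp
  moreover have "herm m m = of_real (\<Sum>b\<in>UNIV. (norm (m $ b))\<^sup>2)"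
    unfolding herm_def of_real_sum complex_norm_square by (intro sum.cong refl mult.commute)
  ultimately show ?thesis unfolding m by (simp only: of_real_eq_1_iff)
qed

text \<open>The hypotheses are the four row sums of a skew 4 x 4 matrix. Each of the six entries
  lies in two rows, so the six squares sum to at most 2, and the inequality of arithmetic and
  geometric means bounds the three products by 1.\<close>

lemma pfaffian_bound:
  fixes a b c a' b' c' :: complex
  assumes "(norm a)\<^sup>2 + (norm b)\<^sup>2 + (norm c)\<^sup>2 \<le> 1" "(norm a)\<^sup>2 + (norm b')\<^sup>2 + (norm c')\<^sup>2 \<le> 1"
    "(norm a')\<^sup>2 + (norm b)\<^sup>2 + (norm c')\<^sup>2 \<le> 1" "(norm a')\<^sup>2 + (norm b')\<^sup>2 + (norm c)\<^sup>2 \<le> 1"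
  shows "norm (a * a' - b * b' + c * c') \<le> 1"
    and "a * a' - b * b' + c * c' = 1 \<Longrightarrow> a' = cnj a \<and> b' = - cnj b \<and> c' = cnj c \<and>
      (norm a)\<^sup>2 + (norm b)\<^sup>2 + (norm c)\<^sup>2 = 1"
proof -
  have am: "norm (x * y) \<le> ((norm x)\<^sup>2 + (norm y)\<^sup>2) / 2" for x y :: complex
    using sum_squares_bound[of "norm x" "norm y"] by (simp add: norm_mult)
  have "norm (a * a' - b * b' + c * c') \<le> norm (a * a') + norm (b * b') + norm (c * c')"
    by (meson add_mono_thms_linordered_semiring(3) norm_triangle_ineq norm_triangle_ineq4 order_trans)
  then show "norm (a * a' - b * b' + c * c') \<le> 1"
    using am[of a a'] am[of b b'] am[of c c'] assms by argo
  assume 1: "a * a' - b * b' + c * c' = 1"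
  have sq: "(norm (x - cnj y))\<^sup>2 = (norm x)\<^sup>2 + (norm y)\<^sup>2 - 2 * Re (x * y)" for x y :: complex
    unfolding cmod_power2 by (simp add: power2_eq_square algebra_simps)
  have "Re (a * a') - Re (b * b') + Re (c * c') = 1" using 1 by (metis minus_complex.sel(1) one_complex.sel(1) plus_complex.sel(1))
  \<comment> \<open>Written out, the left side is the sum of the six squares, at most 2, minus twice
    the real part of the Pfaffian, which is 1.\<close>
  then have z: "(norm (a' - cnj a))\<^sup>2 + (norm (b' - cnj (- b)))\<^sup>2 + (norm (c' - cnj c))\<^sup>2 \<le> 0"
    unfolding sq using assms by (simp add: mult.commute[of a'] mult.commute[of b'] mult.commute[of c'])
  then have "a' = cnj a" "b' = - cnj b" "c' = cnj c"
    by (smt (verit) complex_cnj_minus eq_iff_diff_eq_0 norm_eq_zero zero_le_power2 power_eq_0_iff)+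
  moreover from this have "(norm a)\<^sup>2 + (norm b)\<^sup>2 + (norm c)\<^sup>2 = 1"
  proof -
    have "complex_of_real ((norm a)\<^sup>2 + (norm b)\<^sup>2 + (norm c)\<^sup>2) = 1"
      using 1 calculation unfolding of_real_add complex_norm_square by simp
    then show ?thesis by (simp only: of_real_eq_1_iff)
  qed
  ultimately show "a' = cnj a \<and> b' = - cnj b \<and> c' = cnj c \<and> (norm a)\<^sup>2 + (norm b)\<^sup>2 + (norm c)\<^sup>2 = 1"
    by blast
qed

text \<open>The equality clause also records that the block exhausts its first row; this is what
  later annihilates the entries outside the block.\<close>

lemma pair_volumes_bound:
  assumes e: "unitary_basis e" and t: "norm t1 = 1" "norm t2 = 1" "norm t3 = 1" "norm t4 = 1"
    and d: "distinct [i, j, k, l]"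
  shows "norm (pair_volumes t1 t2 t3 t4 e (vol4 i j k l)) \<le> 1"
    and "pair_volumes t1 t2 t3 t4 e (vol4 i j k l) = 1 \<Longrightarrow>
      skew_entry t1 t2 t3 t4 e k l = cnj (skew_entry t1 t2 t3 t4 e i j) \<and>
      skew_entry t1 t2 t3 t4 e j l = - cnj (skew_entry t1 t2 t3 t4 e i k) \<and>
      skew_entry t1 t2 t3 t4 e j k = cnj (skew_entry t1 t2 t3 t4 e i l) \<and>
      (norm (skew_entry t1 t2 t3 t4 e i j))\<^sup>2 + (norm (skew_entry t1 t2 t3 t4 e i k))\<^sup>2
        + (norm (skew_entry t1 t2 t3 t4 e i l))\<^sup>2 = 1"
proof -
  let ?X = "skew_entry t1 t2 t3 t4 e"
  have row: "(norm (?X a b))\<^sup>2 + (norm (?X a c))\<^sup>2 + (norm (?X a d))\<^sup>2 \<le> 1" if "distinct [b, c, d]" for a b c d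
  proof -
    have "(\<Sum>x\<in>{b, c, d}. (norm (?X a x))\<^sup>2) \<le> (\<Sum>x\<in>UNIV. (norm (?X a x))\<^sup>2)"
      by (rule sum_mono2) auto
    then show ?thesis using skew_entry_row_norm[OF e t, of a] that by (simp add: add.assoc)
  qed
  have s: "norm (?X b a) = norm (?X a b)" for a b using skew_entry_antisym[of t1 t2 t3 t4 e b a] by simp
  have r: "(norm (?X i j))\<^sup>2 + (norm (?X i k))\<^sup>2 + (norm (?X i l))\<^sup>2 \<le> 1"
    "(norm (?X i j))\<^sup>2 + (norm (?X j l))\<^sup>2 + (norm (?X j k))\<^sup>2 \<le> 1"
    "(norm (?X k l))\<^sup>2 + (norm (?X i k))\<^sup>2 + (norm (?X j k))\<^sup>2 \<le> 1"
    "(norm (?X k l))\<^sup>2 + (norm (?X j l))\<^sup>2 + (norm (?X i l))\<^sup>2 \<le> 1"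
    using row[of j k l i] row[of i l k j] row[of l i j k] row[of k j i l] d s[of i j] s[of i k] s[of j k] s[of i l] s[of j l] s[of k l]
    by auto
  show "norm (pair_volumes t1 t2 t3 t4 e (vol4 i j k l)) \<le> 1"
    unfolding pair_volumes_pfaffian by (rule pfaffian_bound(1)[OF r])
  show "pair_volumes t1 t2 t3 t4 e (vol4 i j k l) = 1 \<Longrightarrow>
      ?X k l = cnj (?X i j) \<and> ?X j l = - cnj (?X i k) \<and> ?X j k = cnj (?X i l) \<and>
      (norm (?X i j))\<^sup>2 + (norm (?X i k))\<^sup>2 + (norm (?X i l))\<^sup>2 = 1"
    unfolding pair_volumes_pfaffian by (rule pfaffian_bound(2)[OF r])
qed

text \<open>Hadamard's inequality, from the Laplace expansion by \<open>2 \<times> 2\<close> minors and Lagrange's identity.\<close>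

lemma sum_minor2_le:
  fixes i j k l :: 8
  defines "n \<equiv> \<lambda>a :: C8. (norm (a $ i))\<^sup>2 + (norm (a $ j))\<^sup>2 + (norm (a $ k))\<^sup>2 + (norm (a $ l))\<^sup>2"
  shows "(norm (minor2 a b i j))\<^sup>2 + (norm (minor2 a b i k))\<^sup>2 + (norm (minor2 a b i l))\<^sup>2 + (norm (minor2 a b j k))\<^sup>2
    + (norm (minor2 a b j l))\<^sup>2 + (norm (minor2 a b k l))\<^sup>2 \<le> n a * n b" (is "?s \<le> _")
proof -
  let ?h = "cnj (a $ i) * b $ i + cnj (a $ j) * b $ j + cnj (a $ k) * b $ k + cnj (a $ l) * b $ l"
  have "complex_of_real (?s + (norm ?h)\<^sup>2) = complex_of_real (n a * n b)"
    unfolding n_def of_real_add of_real_mult complex_norm_square minor2_def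
    by (simp add: algebra_simps)
  then have "?s + (norm ?h)\<^sup>2 = n a * n b" by (simp only: of_real_eq_iff)
  then show ?thesis using zero_le_power2[of "norm ?h"] by linarith
qed

lemma vol4_hadamard:
  fixes i j k l :: 8
  defines "n \<equiv> \<lambda>a :: C8. (norm (a $ i))\<^sup>2 + (norm (a $ j))\<^sup>2 + (norm (a $ k))\<^sup>2 + (norm (a $ l))\<^sup>2"
  shows "(norm (vol4 i j k l [a, b, c, d]))\<^sup>2 \<le> n a * n b * (n c * n d)"
proof -
  let ?x = "[minor2 a b i j, minor2 a b i k, minor2 a b i l, minor2 a b j k, minor2 a b j l, minor2 a b k l]"
  let ?y = "[minor2 c d k l, minor2 c d j l, minor2 c d j k, minor2 c d i l, minor2 c d i k, minor2 c d i j]"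
  have s6: "sum f {..<6::nat} = f 0 + f 1 + f 2 + f 3 + f 4 + f 5" for f :: "nat \<Rightarrow> real"
    by (simp add: numeral_eq_Suc)
  have "norm (vol4 i j k l [a, b, c, d]) \<le> (\<Sum>m<6. norm (?x ! m) * norm (?y ! m))"
    unfolding vol4_minor2 s6 norm_mult[symmetric]
    by (simp, intro norm_triangle_le norm_triangle_le_diff add_mono order_refl)
  then have "(norm (vol4 i j k l [a, b, c, d]))\<^sup>2 \<le> (\<Sum>m<6. norm (?x ! m) * norm (?y ! m))\<^sup>2"
    by (rule power_mono) simp
  also have "\<dots> \<le> (\<Sum>m<6. (norm (?x ! m))\<^sup>2) * (\<Sum>m<6. (norm (?y ! m))\<^sup>2)"
    by (rule Cauchy_Schwarz_ineq_sum)
  also have "\<dots> \<le> (n a * n b) * (n c * n d)"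
    using sum_minor2_le[of a b i j k l] sum_minor2_le[of c d i j k l]
    unfolding n_def s6 by (intro mult_mono) (simp_all add: add_nonneg_nonneg algebra_simps)
  finally show ?thesis .
qed

section \<open>The numerical inequality and its equality case\<close>


lemma unit_pairs:
  fixes c s c' s' :: real
  assumes "c\<^sup>2 + s\<^sup>2 = 1" "c'\<^sup>2 + s'\<^sup>2 = 1"
  shows "\<bar>c * c'\<bar> + \<bar>s * s'\<bar> \<le> 1"
    and "\<bar>c * c'\<bar> + \<bar>s * s'\<bar> = 1 \<Longrightarrow> \<bar>c\<bar> = \<bar>c'\<bar> \<and> \<bar>s\<bar> = \<bar>s'\<bar>"
proof -
  have id: "(\<bar>c\<bar> - \<bar>c'\<bar>)\<^sup>2 + (\<bar>s\<bar> - \<bar>s'\<bar>)\<^sup>2 = 2 - 2 * (\<bar>c * c'\<bar> + \<bar>s * s'\<bar>)"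
    using assms by (simp add: power2_diff abs_mult)
  show "\<bar>c * c'\<bar> + \<bar>s * s'\<bar> \<le> 1"
  proof -
    have "0 \<le> (\<bar>c\<bar> - \<bar>c'\<bar>)\<^sup>2 + (\<bar>s\<bar> - \<bar>s'\<bar>)\<^sup>2" by simp
    then show ?thesis unfolding id by simp
  qed
  assume "\<bar>c * c'\<bar> + \<bar>s * s'\<bar> = 1"
  then have "(\<bar>c\<bar> - \<bar>c'\<bar>)\<^sup>2 + (\<bar>s\<bar> - \<bar>s'\<bar>)\<^sup>2 = 0" using id by simp
  then show "\<bar>c\<bar> = \<bar>c'\<bar> \<and> \<bar>s\<bar> = \<bar>s'\<bar>" by (simp add: sum_power2_eq_zero_iff)
qed

text \<open>Grouping the factors in twos reduces the claim to p p' + q q' with p + q \<le> 1 and p'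
  + q' \<le> 1. It is used for cosines and sines of the angles and again for the lengths of the
  projections to \<open>X1\<close> and \<open>X2\<close>.\<close>

lemma unit_pairs_product:
  fixes c1 c2 c3 c4 s1 s2 s3 s4 :: real
  assumes u: "c1\<^sup>2 + s1\<^sup>2 = 1" "c2\<^sup>2 + s2\<^sup>2 = 1" "c3\<^sup>2 + s3\<^sup>2 = 1" "c4\<^sup>2 + s4\<^sup>2 = 1"
  shows "\<bar>c1 * c2 * c3 * c4\<bar> + \<bar>s1 * s2 * s3 * s4\<bar> \<le> 1"
    and "\<bar>c1 * c2 * c3 * c4\<bar> + \<bar>s1 * s2 * s3 * s4\<bar> = 1 \<Longrightarrow>
      (s1 = 0 \<and> s2 = 0 \<and> s3 = 0 \<and> s4 = 0) \<or> (c1 = 0 \<and> c2 = 0 \<and> c3 = 0 \<and> c4 = 0)"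
proof -
  define p q p' q' where "p = \<bar>c1 * c2\<bar>" and "q = \<bar>s1 * s2\<bar>" and "p' = \<bar>c3 * c4\<bar>" and "q' = \<bar>s3 * s4\<bar>"
  have pq: "p + q \<le> 1" "p' + q' \<le> 1" "0 \<le> p" "0 \<le> q" "0 \<le> p'" "0 \<le> q'"
    using unit_pairs(1)[OF u(1,2)] unit_pairs(1)[OF u(3,4)] by (simp_all add: p_def q_def p'_def q'_def)
  have eq: "\<bar>c1 * c2 * c3 * c4\<bar> + \<bar>s1 * s2 * s3 * s4\<bar> = p * p' + q * q'"
    by (simp add: p_def q_def p'_def q'_def abs_mult)
  have "p * p' \<le> p * 1" "q * q' \<le> q * 1" using pq by (intro mult_left_mono; linarith)+
  then show "\<bar>c1 * c2 * c3 * c4\<bar> + \<bar>s1 * s2 * s3 * s4\<bar> \<le> 1" unfolding eq using pq by linarith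
  assume "\<bar>c1 * c2 * c3 * c4\<bar> + \<bar>s1 * s2 * s3 * s4\<bar> = 1"
  then have 1: "p * p' + q * q' = 1" unfolding eq .
  have pp: "p * (1 - p') + q * (1 - q') = 0"
    using 1 pq \<open>p * p' \<le> p * 1\<close> \<open>q * q' \<le> q * 1\<close> by (simp add: algebra_simps)
  have nn: "0 \<le> p * (1 - p')" "0 \<le> q * (1 - q')" using pq by (intro mult_nonneg_nonneg; linarith)+
  then have z: "p * (1 - p') = 0" "q * (1 - q') = 0" using pp by linarith+
  have sum: "p + q = 1" using 1 \<open>p * p' \<le> p * 1\<close> \<open>q * q' \<le> q * 1\<close> pq by linarith
  have one: "\<bar>x\<bar> = 1 \<and> \<bar>y\<bar> = 1" if "\<bar>x * y\<bar> = 1" "x\<^sup>2 \<le> 1" "y\<^sup>2 \<le> 1" for x y :: real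
  proof -
    have "\<bar>x\<bar> \<le> 1" "\<bar>y\<bar> \<le> 1" using that by (simp_all add: abs_square_le_1)
    moreover have "\<bar>x\<bar> * \<bar>y\<bar> = 1" using that(1) by (simp add: abs_mult)
    moreover have "\<bar>x\<bar> * \<bar>y\<bar> \<le> \<bar>x\<bar> * 1" "\<bar>x\<bar> * \<bar>y\<bar> \<le> 1 * \<bar>y\<bar>"
      using calculation(1,2) by (intro mult_left_mono mult_right_mono; simp)+
    ultimately show ?thesis by linarith
  qed
  have le: "c1\<^sup>2 \<le> 1" "c2\<^sup>2 \<le> 1" "c3\<^sup>2 \<le> 1" "c4\<^sup>2 \<le> 1" "s1\<^sup>2 \<le> 1" "s2\<^sup>2 \<le> 1" "s3\<^sup>2 \<le> 1" "s4\<^sup>2 \<le> 1"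
    using u zero_le_power2 by (smt (verit))+
  have zero: "y = 0" if "\<bar>x\<bar> = 1" "x\<^sup>2 + y\<^sup>2 = 1 \<or> y\<^sup>2 + x\<^sup>2 = 1" for x y :: real
  proof -
    have "x\<^sup>2 = 1" using that(1) by (metis abs_square_eq_1)
    then show ?thesis using that(2) by auto
  qed
  show "(s1 = 0 \<and> s2 = 0 \<and> s3 = 0 \<and> s4 = 0) \<or> (c1 = 0 \<and> c2 = 0 \<and> c3 = 0 \<and> c4 = 0)"
  proof (cases "p = 0")
    case True
    then have "q = 1" "q' = 1" using sum z by auto
    then have "\<bar>s1\<bar> = 1" "\<bar>s2\<bar> = 1" "\<bar>s3\<bar> = 1" "\<bar>s4\<bar> = 1"
      using one[of s1 s2] one[of s3 s4] le unfolding q_def q'_def by blast+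
    then show ?thesis using zero u by blast
  next
    case False
    then have "p' = 1" using z by simp
    then have "q' = 0" using pq by linarith
    then have "p = 1" using z sum by simp
    then have "\<bar>c1\<bar> = 1" "\<bar>c2\<bar> = 1" "\<bar>c3\<bar> = 1" "\<bar>c4\<bar> = 1"
      using one[of c1 c2] one[of c3 c4] le \<open>p' = 1\<close> unfolding p_def p'_def by blast+
    then show ?thesis using zero u by blast
  qed
qed

lemma norm_unit_combination:
  fixes c s c' s' :: real and z :: complex
  assumes "c\<^sup>2 + s\<^sup>2 = 1" "c'\<^sup>2 + s'\<^sup>2 = 1" "norm z = 1"
  shows "norm (of_real (c * c') + z * of_real (s * s')) \<le> 1"
    and "norm (of_real (c * c') + z * of_real (s * s')) = 1 \<Longrightarrow> \<bar>c\<bar> = \<bar>c'\<bar> \<and> \<bar>s\<bar> = \<bar>s'\<bar>"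
proof -
  have "norm (of_real (c * c') + z * of_real (s * s')) \<le> \<bar>c * c'\<bar> + \<bar>s * s'\<bar>"
    using norm_triangle_ineq[of "of_real (c * c')" "z * of_real (s * s')"] assms(3)
    by (simp only: norm_mult norm_of_real mult_1_left)
  then show "norm (of_real (c * c') + z * of_real (s * s')) \<le> 1"
    "norm (of_real (c * c') + z * of_real (s * s')) = 1 \<Longrightarrow> \<bar>c\<bar> = \<bar>c'\<bar> \<and> \<bar>s\<bar> = \<bar>s'\<bar>"
    using unit_pairs[OF assms(1,2)] by linarith+
qed

text \<open>For cosines and sines of two angles and z = 1 this is the cosine of their
  difference.\<close>

definition phase_factor :: "real \<Rightarrow> real \<Rightarrow> real \<Rightarrow> real \<Rightarrow> complex \<Rightarrow> complex" where
  "phase_factor c s c' s' z = of_real (c * c') + z * of_real (s * s')"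

text \<open>Up to the weight \<open>norm \<beta>\<close>, the terms belonging to one pairing of the four planes factor.\<close>

lemma pairing_term:
  fixes c1 c2 c3 c4 s1 s2 s3 s4 :: real and \<kappa> \<beta> :: complex
  assumes u: "c1\<^sup>2 + s1\<^sup>2 = 1" "c2\<^sup>2 + s2\<^sup>2 = 1" "c3\<^sup>2 + s3\<^sup>2 = 1" "c4\<^sup>2 + s4\<^sup>2 = 1"
    and \<kappa>: "norm \<kappa> = 1"
  defines "T \<equiv> norm \<beta> * (c1 * c2 * c3 * c4 + Re (\<kappa>\<^sup>2) * (s1 * s2 * s3 * s4))
      + s1 * s2 * c3 * c4 * Re (\<kappa> * \<beta>) + c1 * c2 * s3 * s4 * Re (\<kappa> * cnj \<beta>)"
  shows "T \<le> norm \<beta>"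
    and "T = norm \<beta> \<Longrightarrow> \<beta> \<noteq> 0 \<Longrightarrow> \<exists>b. norm b = 1 \<and> \<beta> = of_real (norm \<beta>) * b \<and>
      \<bar>c1\<bar> = \<bar>c2\<bar> \<and> \<bar>s1\<bar> = \<bar>s2\<bar> \<and> \<bar>c3\<bar> = \<bar>c4\<bar> \<and> \<bar>s3\<bar> = \<bar>s4\<bar> \<and>
      norm (phase_factor c1 s1 c2 s2 (\<kappa> * b)) = 1 \<and>
      phase_factor c1 s1 c2 s2 (\<kappa> * b) * phase_factor c3 s3 c4 s4 (\<kappa> * cnj b) = 1"
proof -
  obtain b where b: "norm b = 1" "\<beta> = of_real (norm \<beta>) * b"
  proof (cases "\<beta> = 0")
    case True then show ?thesis using that[of 1] by simp
  next
    case False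
    then show ?thesis using that[of "\<beta> / of_real (norm \<beta>)"] by (simp add: norm_divide)
  qed
  let ?P = "phase_factor c1 s1 c2 s2 (\<kappa> * b)" and ?Q = "phase_factor c3 s3 c4 s4 (\<kappa> * cnj b)"
  have bb: "b * cnj b = 1" using b(1) by (simp add: complex_norm_square[symmetric])
  have kb: "norm (\<kappa> * b) = 1" "norm (\<kappa> * cnj b) = 1" using \<kappa> b(1) by (simp_all add: norm_mult)
  have P: "norm ?P \<le> 1" "norm ?Q \<le> 1" "norm ?P = 1 \<Longrightarrow> \<bar>c1\<bar> = \<bar>c2\<bar> \<and> \<bar>s1\<bar> = \<bar>s2\<bar>"
    "norm ?Q = 1 \<Longrightarrow> \<bar>c3\<bar> = \<bar>c4\<bar> \<and> \<bar>s3\<bar> = \<bar>s4\<bar>"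
    unfolding phase_factor_def
    using norm_unit_combination[OF u(1,2) kb(1)] norm_unit_combination[OF u(3,4) kb(2)] by blast+
  have PQ: "norm (?P * ?Q) \<le> 1" using P(1,2) by (simp add: norm_mult mult_le_one)
  \<comment> \<open>The phase \<open>b\<close> cancels where all four sines meet, leaving
    \<kappa>^2; the two mixed terms carry \<open>b\<close> and its conjugate, as in
    \<open>T\<close>.\<close>
  have "?P * ?Q = of_real (c1 * c2 * c3 * c4) + \<kappa>\<^sup>2 * (b * cnj b) * of_real (s1 * s2 * s3 * s4)
      + \<kappa> * b * of_real (s1 * s2 * c3 * c4) + \<kappa> * cnj b * of_real (c1 * c2 * s3 * s4)"
    unfolding phase_factor_def by (simp add: algebra_simps power2_eq_square)
  then have RePQ: "Re (?P * ?Q) = c1 * c2 * c3 * c4 + Re (\<kappa>\<^sup>2) * (s1 * s2 * s3 * s4)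
      + Re (\<kappa> * b) * (s1 * s2 * c3 * c4) + Re (\<kappa> * cnj b) * (c1 * c2 * s3 * s4)"
    unfolding bb by simp
  have k\<beta>: "Re (\<kappa> * \<beta>) = norm \<beta> * Re (\<kappa> * b)" "Re (\<kappa> * cnj \<beta>) = norm \<beta> * Re (\<kappa> * cnj b)"
    by (subst b(2), simp add: algebra_simps)+
  have T: "T = norm \<beta> * Re (?P * ?Q)"
    unfolding T_def RePQ k\<beta> by (simp add: algebra_simps)
  have le: "Re (?P * ?Q) \<le> 1" using complex_Re_le_cmod[of "?P * ?Q"] PQ by linarith
  then show "T \<le> norm \<beta>" unfolding T using mult_left_mono[OF le, of "norm \<beta>"] by simp
  assume "T = norm \<beta>" "\<beta> \<noteq> 0"
  then have Re1: "Re (?P * ?Q) = 1" unfolding T by simp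
  then have "norm (?P * ?Q) = 1" using complex_Re_le_cmod[of "?P * ?Q"] PQ by linarith
  moreover from this have "Im (?P * ?Q) = 0" using cmod_power2[of "?P * ?Q"] unfolding Re1 by simp
  ultimately have "norm (?P * ?Q) = 1" and "?P * ?Q = 1" using Re1 by (simp_all only: complex_eq_iff one_complex.sel)
  moreover have "norm ?P = 1" "norm ?Q = 1"
  proof -
    have "norm ?P * norm ?Q = 1" using \<open>norm (?P * ?Q) = 1\<close> by (simp add: norm_mult)
    moreover have "norm ?P * norm ?Q \<le> norm ?P * 1" "norm ?P * norm ?Q \<le> 1 * norm ?Q"
      using P(1,2) by (intro mult_left_mono mult_right_mono; simp)+
    ultimately show "norm ?P = 1" "norm ?Q = 1" using P(1,2) by linarith+
  qed
  ultimately show "\<exists>b. norm b = 1 \<and> \<beta> = of_real (norm \<beta>) * b \<and>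
      \<bar>c1\<bar> = \<bar>c2\<bar> \<and> \<bar>s1\<bar> = \<bar>s2\<bar> \<and> \<bar>c3\<bar> = \<bar>c4\<bar> \<and> \<bar>s3\<bar> = \<bar>s4\<bar> \<and>
      norm (phase_factor c1 s1 c2 s2 (\<kappa> * b)) = 1 \<and>
      phase_factor c1 s1 c2 s2 (\<kappa> * b) * phase_factor c3 s3 c4 s4 (\<kappa> * cnj b) = 1"
    using b P(3,4) by blast
qed

text \<open>Strict convexity of the unit disc, applied to the points 1 and \<open>z\<close>.\<close>

lemma unit_convex_combination:
  fixes z :: complex
  assumes "0 < x" "0 < y" "x + y = 1" "norm z = 1" "norm (of_real x + z * of_real y) = 1"
  shows "z = 1"
proof -
  have zz: "(Re z)\<^sup>2 + (Im z)\<^sup>2 = 1" using assms(4) by (metis cmod_power2 power_one)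
  have "(x + Re z * y)\<^sup>2 + (Im z * y)\<^sup>2 = 1"
    using assms(5) cmod_power2[of "of_real x + z * of_real y"] by simp
  then have "x\<^sup>2 + 2 * x * y * Re z + y\<^sup>2 * ((Re z)\<^sup>2 + (Im z)\<^sup>2) = 1"
    by (simp add: power2_sum power_mult_distrib algebra_simps)
  moreover have "x\<^sup>2 + 2 * x * y + y\<^sup>2 = 1"
    using arg_cong[OF assms(3), of "\<lambda>t. t\<^sup>2"] by (simp add: power2_sum algebra_simps)
  ultimately have "2 * x * y * Re z = 2 * x * y * 1" unfolding zz by linarith
  then have "Re z = 1" using assms(1,2) by simp
  moreover from this have "Im z = 0" using zz by simp
  ultimately show ?thesis by (simp add: complex_eq_iff)
qed

text \<open>Strict convexity makes the first factor equal to 1, hence also the second. Comparing the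
  real part of the second with c^2 + s^2 = 1, both of its summands must be maximal, which also
  decides the sign of \<open>c4\<close>.\<close>

lemma phase_factors_rigid:
  assumes c: "0 < c" and s: "0 < s" and cs: "c\<^sup>2 + s\<^sup>2 = 1" and c4: "\<bar>c4\<bar> = c"
    and z: "norm z = 1" "norm w = 1" and P: "norm (phase_factor c s c s z) = 1"
    and PQ: "phase_factor c s c s z * phase_factor c s c4 s w = 1"
  shows "c4 = c \<and> z = 1 \<and> w = 1"
proof -
  have z1: "z = 1"
    using P c s cs z(1) unit_convex_combination[of "c * c" "s * s" z]
    by (simp add: phase_factor_def power2_eq_square)
  then have "phase_factor c s c s z = 1"
    using cs by (simp add: phase_factor_def power2_eq_square flip: of_real_add of_real_mult)
  then have Q: "of_real (c * c4) + w * of_real (s * s) = (1::complex)"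
    using PQ by (simp add: phase_factor_def)
  have "Re (of_real (c * c4) + w * of_real (s * s)) = 1" unfolding Q by simp
  then have Re: "c * c4 + Re w * (s * s) = 1" by simp
  have "Re w \<le> 1" using complex_Re_le_cmod[of w] z(2) by simp
  then have "Re w * (s * s) \<le> 1 * (s * s)" by (rule mult_right_mono) simp
  moreover have "c * c4 \<le> c * c" using c c4 by (intro mult_left_mono) auto
  ultimately have eq: "c * c4 = c * c" "Re w * (s * s) = 1 * (s * s)"
    using Re cs unfolding power2_eq_square by linarith+
  then have "c4 = c" "Re w = 1" using c s by auto
  moreover have "Im w = 0"
    using \<open>Re w = 1\<close> z(2) cmod_power2[of w] by simp
  ultimately show ?thesis using z1 by (simp add: complex_eq_iff)
qed

lemma pairing_phases_bound:
  fixes a12 a34 a13 a24 a14 a23 \<kappa> :: complex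
  assumes \<kappa>: "norm \<kappa> = 1"
    and bound: "\<And>t1 t2 t3 t4. norm t1 = 1 \<Longrightarrow> norm t2 = 1 \<Longrightarrow> norm t3 = 1 \<Longrightarrow> norm t4 = 1 \<Longrightarrow>
      norm (t1 * t2 * a12 + t3 * t4 * a34 + t1 * t3 * a13 + t2 * t4 * a24 + t1 * t4 * a14 + t2 * t3 * a23) \<le> 1"
  shows "norm (cnj \<kappa> * a12 + \<kappa> * cnj a34) + norm (cnj \<kappa> * a13 + \<kappa> * cnj a24) + norm (cnj \<kappa> * a14 + \<kappa> * cnj a23) \<le> 1"
proof -
  have "\<exists>u. norm u = 1 \<and> Re (u * \<beta>) = norm \<beta>" for \<beta> :: complex
  proof (cases "\<beta> = 0")
    case False
    have "cnj \<beta> * \<beta> = of_real (norm \<beta>) * of_real (norm \<beta>)"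
      using complex_norm_square[of \<beta>] by (simp add: mult.commute power2_eq_square)
    then have "cnj \<beta> / of_real (norm \<beta>) * \<beta> = of_real (norm \<beta>)"
      using False by simp
    then show ?thesis using False by (intro exI[of _ "cnj \<beta> / of_real (norm \<beta>)"]) (simp add: norm_divide)
  qed (auto intro: exI[of _ 1])
  then obtain u where u: "\<And>\<beta> :: complex. norm (u \<beta>) = 1" "\<And>\<beta>. Re (u \<beta> * \<beta>) = norm \<beta>" by metis
  define u1 u2 u3 where "u1 = u (cnj \<kappa> * a12 + \<kappa> * cnj a34)" and "u2 = u (cnj \<kappa> * a13 + \<kappa> * cnj a24)"
    and "u3 = u (cnj \<kappa> * a14 + \<kappa> * cnj a23)"
  \<comment> \<open>For the phases t, u1 / t, u2 / t, u3 / t the products of the first with the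
    others are u1, u2, u3. The choice of t^2 makes the complementary products their
    conjugates.\<close>
  define t where "t = csqrt (u1 * u2 * u3)"
  have nu: "norm u1 = 1" "norm u2 = 1" "norm u3 = 1" by (simp_all add: u1_def u2_def u3_def u)
  then have uc: "u1 * cnj u1 = 1" "u2 * cnj u2 = 1" "u3 * cnj u3 = 1" by (simp_all add: complex_norm_square[symmetric])
  have t2: "t * t = u1 * u2 * u3" unfolding t_def power2_eq_square[symmetric] by simp
  have "norm (t * t) = 1" unfolding t2 by (simp add: norm_mult nu)
  then have "(norm t)\<^sup>2 = 1\<^sup>2" by (simp add: norm_mult power2_eq_square)
  then have nt: "norm t = 1" by (rule power2_eq_imp_eq) simp_all
  then have t0: "t \<noteq> 0" by auto
  have prods: "t * (u1 / t) = u1" "t * (u2 / t) = u2" "t * (u3 / t) = u3" using t0 by simp_all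
  have quot: "x / t * (y / t) = cnj z" if "x * y * z = t * t" "z * cnj z = 1" for x y z
  proof -
    have "x / t * (y / t) * z = 1" using that(1) t0 by (simp add: field_simps)
    then show ?thesis using that(2) by (metis mult.assoc mult.commute mult_1_left)
  qed
  have q: "u2 / t * (u3 / t) = cnj u1" "u1 / t * (u3 / t) = cnj u2" "u1 / t * (u2 / t) = cnj u3"
    using quot[of u2 u3 u1] quot[of u1 u3 u2] quot[of u1 u2 u3] uc t2 by (simp_all add: ac_simps)
  let ?S = "u1 * a12 + cnj u1 * a34 + u2 * a13 + cnj u2 * a24 + u3 * a14 + cnj u3 * a23"
  have "norm ?S \<le> 1"
    using bound[of t "u1 / t" "u2 / t" "u3 / t"] unfolding prods q by (simp add: nt nu norm_divide)
  then have "Re (cnj \<kappa> * ?S) \<le> 1"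
    using complex_Re_le_cmod[of "cnj \<kappa> * ?S"] by (simp add: norm_mult \<kappa>)
  \<comment> \<open>The terms with a conjugated phase are replaced by their conjugates, which have
    the same real part.\<close>
  moreover have "Re (cnj \<kappa> * ?S) = Re (u1 * (cnj \<kappa> * a12 + \<kappa> * cnj a34)) + Re (u2 * (cnj \<kappa> * a13 + \<kappa> * cnj a24))
      + Re (u3 * (cnj \<kappa> * a14 + \<kappa> * cnj a23))"
    by (simp add: algebra_simps)
  ultimately show ?thesis unfolding u1_def u2_def u3_def u by simp
qed

lemma comass_equality:
  fixes c1 c2 c3 c4 s1 s2 s3 s4 :: real and \<kappa> \<beta>1 \<beta>2 \<beta>3 :: complex
  assumes u: "c1\<^sup>2 + s1\<^sup>2 = 1" "c2\<^sup>2 + s2\<^sup>2 = 1" "c3\<^sup>2 + s3\<^sup>2 = 1" "c4\<^sup>2 + s4\<^sup>2 = 1"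
    and nn: "0 \<le> c1" "0 \<le> c2" "0 \<le> c3" "0 \<le> s1" "0 \<le> s2" "0 \<le> s3" "0 \<le> s4"
    and \<kappa>: "norm \<kappa> = 1" and \<beta>: "norm \<beta>1 + norm \<beta>2 + norm \<beta>3 \<le> 1"
    and F: "c1 * c2 * c3 * c4 + Re (\<kappa>\<^sup>2) * (s1 * s2 * s3 * s4)
      + s1 * s2 * c3 * c4 * Re (\<kappa> * \<beta>1) + c1 * c2 * s3 * s4 * Re (\<kappa> * cnj \<beta>1)
      + s1 * s3 * c2 * c4 * Re (\<kappa> * \<beta>2) + c1 * c3 * s2 * s4 * Re (\<kappa> * cnj \<beta>2)
      + s1 * s4 * c2 * c3 * Re (\<kappa> * \<beta>3) + c1 * c4 * s2 * s3 * Re (\<kappa> * cnj \<beta>3) = 1"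
  shows "(s1 = 0 \<and> s2 = 0 \<and> s3 = 0 \<and> s4 = 0) \<or> (c1 = 0 \<and> c2 = 0 \<and> c3 = 0 \<and> c4 = 0)
    \<or> norm \<beta>1 = 1 \<or> norm \<beta>2 = 1 \<or> norm \<beta>3 = 1
    \<or> (c2 = c1 \<and> c3 = c1 \<and> c4 = c1 \<and> s2 = s1 \<and> s3 = s1 \<and> s4 = s1 \<and> \<kappa>\<^sup>2 = 1 \<and>
        \<kappa> * \<beta>1 = of_real (norm \<beta>1) \<and> \<kappa> * \<beta>2 = of_real (norm \<beta>2) \<and> \<kappa> * \<beta>3 = of_real (norm \<beta>3) \<and>
        norm \<beta>1 + norm \<beta>2 + norm \<beta>3 = 1)"
    (is "?S \<or> ?C \<or> _ \<or> _ \<or> _ \<or> ?E")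
proof -
  let ?G = "c1 * c2 * c3 * c4 + Re (\<kappa>\<^sup>2) * (s1 * s2 * s3 * s4)"
  let ?r = "norm \<beta>1 + norm \<beta>2 + norm \<beta>3"
  define T1 T2 T3 where
    "T1 = norm \<beta>1 * ?G + s1 * s2 * c3 * c4 * Re (\<kappa> * \<beta>1) + c1 * c2 * s3 * s4 * Re (\<kappa> * cnj \<beta>1)" and
    "T2 = norm \<beta>2 * ?G + s1 * s3 * c2 * c4 * Re (\<kappa> * \<beta>2) + c1 * c3 * s2 * s4 * Re (\<kappa> * cnj \<beta>2)" and
    "T3 = norm \<beta>3 * ?G + s1 * s4 * c2 * c3 * Re (\<kappa> * \<beta>3) + c1 * c4 * s2 * s3 * Re (\<kappa> * cnj \<beta>3)"
  have perm: "c1 * c3 * c2 * c4 = c1 * c2 * c3 * c4" "s1 * s3 * s2 * s4 = s1 * s2 * s3 * s4"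
    "c1 * c4 * c2 * c3 = c1 * c2 * c3 * c4" "s1 * s4 * s2 * s3 = s1 * s2 * s3 * s4" by simp_all
  note p1 = pairing_term[OF u \<kappa>, of \<beta>1, folded T1_def]
  note p2 = pairing_term[OF u(1,3,2,4) \<kappa>, of \<beta>2, unfolded perm, folded T2_def]
  note p3 = pairing_term[OF u(1,4,2,3) \<kappa>, of \<beta>3, unfolded perm, folded T3_def]
  have Gle: "?G \<le> \<bar>c1 * c2 * c3 * c4\<bar> + \<bar>s1 * s2 * s3 * s4\<bar>"
  proof -
    have "\<bar>Re (\<kappa>\<^sup>2)\<bar> \<le> 1" using abs_Re_le_cmod[of "\<kappa>\<^sup>2"] \<kappa> by (simp add: norm_power)
    then have "\<bar>Re (\<kappa>\<^sup>2) * (s1 * s2 * s3 * s4)\<bar> \<le> 1 * \<bar>s1 * s2 * s3 * s4\<bar>"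
      unfolding abs_mult[of "Re (\<kappa>\<^sup>2)"] by (intro mult_right_mono) simp_all
    then show ?thesis by linarith
  qed
  then have G1: "?G \<le> 1" using unit_pairs_product(1)[OF u] by linarith
  define D where "D = (1 - ?r) * ?G"
  have sum: "T1 + T2 + T3 + D = 1"
    using F unfolding T1_def T2_def T3_def D_def by (simp add: algebra_simps)
  have "(1 - ?r) * ?G \<le> (1 - ?r) * 1" using \<beta> G1 by (intro mult_left_mono) linarith+
  then have "D \<le> 1 - ?r" unfolding D_def by simp
  \<comment> \<open>The upper bounds of the four summands add up to 1, which is their sum, so each
    bound is attained.\<close>
  then have eq: "T1 = norm \<beta>1" "T2 = norm \<beta>2" "T3 = norm \<beta>3" "D = 1 - ?r"
    using sum p1(1) p2(1) p3(1) by linarith+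
  show ?thesis
  proof (cases "?r = 1")
    case False
    then have "?G = 1" using eq(4) unfolding D_def by simp
    then have "\<bar>c1 * c2 * c3 * c4\<bar> + \<bar>s1 * s2 * s3 * s4\<bar> = 1"
      using Gle unit_pairs_product(1)[OF u] by linarith
    then show ?thesis using unit_pairs_product(2)[OF u] by blast
  next
    case r1: True
    show ?thesis
    proof (rule ccontr)
      assume neg: "\<not> ?thesis"
      have nS: "\<not> ?S" and nC: "\<not> ?C" and n1: "norm \<beta>1 \<noteq> 1" "norm \<beta>2 \<noteq> 1" "norm \<beta>3 \<noteq> 1" and nE: "\<not> ?E"
        using neg by blast+
      \<comment> \<open>The three norms add up to 1 and none of them is 1, so at least two pairings
        carry weight.\<close>
      have two: "(\<beta>1 \<noteq> 0 \<and> \<beta>2 \<noteq> 0) \<or> (\<beta>1 \<noteq> 0 \<and> \<beta>3 \<noteq> 0) \<or> (\<beta>2 \<noteq> 0 \<and> \<beta>3 \<noteq> 0)"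
        using r1 n1 by auto
      have a1: "\<beta>1 \<noteq> 0 \<Longrightarrow> \<bar>c1\<bar> = \<bar>c2\<bar> \<and> \<bar>s1\<bar> = \<bar>s2\<bar> \<and> \<bar>c3\<bar> = \<bar>c4\<bar> \<and> \<bar>s3\<bar> = \<bar>s4\<bar>"
        using p1(2)[OF eq(1)] by blast
      have a2: "\<beta>2 \<noteq> 0 \<Longrightarrow> \<bar>c1\<bar> = \<bar>c3\<bar> \<and> \<bar>s1\<bar> = \<bar>s3\<bar> \<and> \<bar>c2\<bar> = \<bar>c4\<bar> \<and> \<bar>s2\<bar> = \<bar>s4\<bar>"
        using p2(2)[OF eq(2)] by blast
      have a3: "\<beta>3 \<noteq> 0 \<Longrightarrow> \<bar>c1\<bar> = \<bar>c4\<bar> \<and> \<bar>s1\<bar> = \<bar>s4\<bar> \<and> \<bar>c2\<bar> = \<bar>c3\<bar> \<and> \<bar>s2\<bar> = \<bar>s3\<bar>"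
        using p3(2)[OF eq(3)] by blast
      have abs: "\<bar>c1\<bar> = \<bar>c2\<bar> \<and> \<bar>c1\<bar> = \<bar>c3\<bar> \<and> \<bar>c1\<bar> = \<bar>c4\<bar> \<and> \<bar>s1\<bar> = \<bar>s2\<bar> \<and> \<bar>s1\<bar> = \<bar>s3\<bar> \<and> \<bar>s1\<bar> = \<bar>s4\<bar>"
        using two
      proof (elim disjE conjE)
        assume "\<beta>1 \<noteq> 0" "\<beta>2 \<noteq> 0" then show ?thesis using a1 a2 by metis
      next
        assume "\<beta>1 \<noteq> 0" "\<beta>3 \<noteq> 0" then show ?thesis using a1 a3 by metis
      next
        assume "\<beta>2 \<noteq> 0" "\<beta>3 \<noteq> 0" then show ?thesis using a2 a3 by metis
      qed
      then have c: "c2 = c1" "c3 = c1" "\<bar>c4\<bar> = c1" and s: "s2 = s1" "s3 = s1" "s4 = s1"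
        using nn by linarith+
      have "c1 \<noteq> 0" using nC c by auto
      then have c0: "0 < c1" using nn by simp
      have "s1 \<noteq> 0" using nS s by auto
      then have s0: "0 < s1" using nn by simp
      have r: "c4 = c1 \<and> \<kappa>\<^sup>2 = 1 \<and> \<kappa> * \<beta> = of_real (norm \<beta>)"
        if b: "norm b = 1" "\<beta> = of_real (norm \<beta>) * b" and kb: "c4 = c1 \<and> \<kappa> * b = 1 \<and> \<kappa> * cnj b = 1" for b \<beta>
      proof -
        have "b * cnj b = 1" using b(1) by (simp add: complex_norm_square[symmetric])
        moreover have "(\<kappa> * b) * (\<kappa> * cnj b) = \<kappa>\<^sup>2 * (b * cnj b)" by (simp add: power2_eq_square)
        ultimately have "\<kappa>\<^sup>2 = 1" using kb by simp
        moreover have "\<kappa> * \<beta> = of_real (norm \<beta>) * (\<kappa> * b)" by (subst b(2)) simp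
        ultimately show ?thesis using kb by simp
      qed
      have nk: "norm (\<kappa> * b) = 1" "norm (\<kappa> * cnj b) = 1" if "norm b = 1" for b
        using that \<kappa> by (simp_all add: norm_mult)
      have e1: "c4 = c1 \<and> \<kappa>\<^sup>2 = 1 \<and> \<kappa> * \<beta>1 = of_real (norm \<beta>1)" if nz: "\<beta>1 \<noteq> 0"
      proof -
        obtain b where b: "norm b = 1" "\<beta>1 = of_real (norm \<beta>1) * b" "norm (phase_factor c1 s1 c1 s1 (\<kappa> * b)) = 1"
          "phase_factor c1 s1 c1 s1 (\<kappa> * b) * phase_factor c1 s1 c4 s1 (\<kappa> * cnj b) = 1"
          using p1(2)[OF eq(1) nz] unfolding c s by blast
        show ?thesis using r[OF b(1,2)] phase_factors_rigid[OF c0 s0 u(1) c(3) nk[OF b(1)] b(3,4)] by blast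
      qed
      have e2: "c4 = c1 \<and> \<kappa>\<^sup>2 = 1 \<and> \<kappa> * \<beta>2 = of_real (norm \<beta>2)" if nz: "\<beta>2 \<noteq> 0"
      proof -
        obtain b where b: "norm b = 1" "\<beta>2 = of_real (norm \<beta>2) * b" "norm (phase_factor c1 s1 c1 s1 (\<kappa> * b)) = 1"
          "phase_factor c1 s1 c1 s1 (\<kappa> * b) * phase_factor c1 s1 c4 s1 (\<kappa> * cnj b) = 1"
          using p2(2)[OF eq(2) nz] unfolding c s by blast
        show ?thesis using r[OF b(1,2)] phase_factors_rigid[OF c0 s0 u(1) c(3) nk[OF b(1)] b(3,4)] by blast
      qed
      \<comment> \<open>In this pairing the fourth plane, whose cosine may be negative, sits in the
        first factor; the factors are exchanged before the rigidity lemma applies.\<close>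
      have e3: "c4 = c1 \<and> \<kappa>\<^sup>2 = 1 \<and> \<kappa> * \<beta>3 = of_real (norm \<beta>3)" if nz: "\<beta>3 \<noteq> 0"
      proof -
        obtain b where b: "norm b = 1" "\<beta>3 = of_real (norm \<beta>3) * b" "norm (phase_factor c1 s1 c4 s1 (\<kappa> * b)) = 1"
          "phase_factor c1 s1 c4 s1 (\<kappa> * b) * phase_factor c1 s1 c1 s1 (\<kappa> * cnj b) = 1"
          using p3(2)[OF eq(3) nz] unfolding c s by blast
        have "norm (phase_factor c1 s1 c4 s1 (\<kappa> * b)) * norm (phase_factor c1 s1 c1 s1 (\<kappa> * cnj b)) = 1"
          using arg_cong[OF b(4), of norm] by (simp add: norm_mult)
        then have b3: "norm (phase_factor c1 s1 c1 s1 (\<kappa> * cnj b)) = 1" using b(3) by simp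
        have b4: "phase_factor c1 s1 c1 s1 (\<kappa> * cnj b) * phase_factor c1 s1 c4 s1 (\<kappa> * b) = 1"
          using b(4) by (simp only: mult.commute)
        show ?thesis using r[OF b(1,2)] phase_factors_rigid[OF c0 s0 u(1) c(3) nk(2,1)[OF b(1)] b3 b4] by blast
      qed
      have "\<kappa> * \<beta>1 = of_real (norm \<beta>1)" "\<kappa> * \<beta>2 = of_real (norm \<beta>2)" "\<kappa> * \<beta>3 = of_real (norm \<beta>3)"
        using e1 e2 e3 by (cases "\<beta>1 = 0"; cases "\<beta>2 = 0"; cases "\<beta>3 = 0"; simp)+
      moreover have "c4 = c1 \<and> \<kappa>\<^sup>2 = 1" using two e1 e2 by blast
      ultimately have ?E using c s r1 by blast
      then show False using nE by blast
    qed
  qed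
qed

section \<open>Planes in normal form\<close>


definition plane_pair :: "C8 \<Rightarrow> C8 \<Rightarrow> real \<Rightarrow> real \<Rightarrow> C8 list" where
  "plane_pair v w c s = [v, c *\<^sub>R (\<i> *s v) + s *\<^sub>R w]"

definition frame :: "(8 \<Rightarrow> C8) \<Rightarrow> real \<Rightarrow> real \<Rightarrow> real \<Rightarrow> real \<Rightarrow> real \<Rightarrow> real \<Rightarrow> real \<Rightarrow> real \<Rightarrow> C8 list" where
  "frame e c1 s1 c2 s2 c3 s3 c4 s4 = plane_pair (e 1) (e 2) c1 s1 @ plane_pair (e 3) (e 4) c2 s2
     @ plane_pair (e 5) (e 6) c3 s3 @ plane_pair (e 7) (e 8) c4 s4"

text \<open>The component along \<open>\<i> *s v\<close> is complex dependent on \<open>v\<close>,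
  so a complex volume form sees only the sines.\<close>

lemma vol4_plane_pair:
  "vol4 i j k l (plane_pair v w c s @ plane_pair v' w' c' s') = of_real (s * s') * vol4 i j k l [v, w, v', w']"
proof -
  have m: "minor2 v (c *\<^sub>R (\<i> *s v) + s *\<^sub>R w) i j = of_real s * minor2 v w i j" for v w :: C8 and c s i j
    unfolding minor2_def scaleR_eq_of_real_scale by (simp add: algebra_simps)
  show ?thesis
    unfolding plane_pair_def append.simps vol4_minor2 m by (simp add: algebra_simps)
qed

lemma alt_form_slot:
  fixes \<psi> :: "C8 list \<Rightarrow> complex"
  assumes \<psi>: "alt_form (*s) n \<psi>" and l: "length xs = n" "k < n" "j < n" "j \<noteq> k"
  shows "\<psi> (xs[k := c *\<^sub>R (\<i> *s (xs ! j)) + s *\<^sub>R w]) = of_real s * \<psi> (xs[k := w])"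
proof -
  note M = multilinD[OF alt_formD(1)[OF \<psi>] l(1,2)]
  have "\<psi> (xs[k := xs ! j]) = 0"
    by (rule alt_formD(2)[OF \<psi>, of _ k j]) (use l in auto)
  then show ?thesis unfolding scaleR_eq_of_real_scale M by simp
qed

lemma \<Omega>12_frame:
  "\<Omega>12 (frame e c1 s1 c2 s2 c3 s3 c4 s4) =
    of_real (s1 * s2 * s3 * s4) * \<Omega>12 [e 1, e 2, e 3, e 4, e 5, e 6, e 7, e 8]"
proof -
  let ?u = "\<lambda>v w c s. c *\<^sub>R (\<i> *s v) + s *\<^sub>R w"
  note slot = alt_form_slot[OF alt_form_\<Omega>12]
  have "\<Omega>12 [e 1, ?u (e 1) (e 2) c1 s1, e 3, ?u (e 3) (e 4) c2 s2, e 5, ?u (e 5) (e 6) c3 s3, e 7, ?u (e 7) (e 8) c4 s4]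
    = of_real s1 * \<Omega>12 [e 1, e 2, e 3, ?u (e 3) (e 4) c2 s2, e 5, ?u (e 5) (e 6) c3 s3, e 7, ?u (e 7) (e 8) c4 s4]"
    using slot[of "[e 1, e 2, e 3, ?u (e 3) (e 4) c2 s2, e 5, ?u (e 5) (e 6) c3 s3, e 7, ?u (e 7) (e 8) c4 s4]" 1 0 c1 s1 "e 2"]
    by simp
  also have "\<Omega>12 [e 1, e 2, e 3, ?u (e 3) (e 4) c2 s2, e 5, ?u (e 5) (e 6) c3 s3, e 7, ?u (e 7) (e 8) c4 s4]
    = of_real s2 * \<Omega>12 [e 1, e 2, e 3, e 4, e 5, ?u (e 5) (e 6) c3 s3, e 7, ?u (e 7) (e 8) c4 s4]"
    using slot[of "[e 1, e 2, e 3, e 4, e 5, ?u (e 5) (e 6) c3 s3, e 7, ?u (e 7) (e 8) c4 s4]" 3 2 c2 s2 "e 4"]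
    by (simp add: numeral_eq_Suc)
  also have "\<Omega>12 [e 1, e 2, e 3, e 4, e 5, ?u (e 5) (e 6) c3 s3, e 7, ?u (e 7) (e 8) c4 s4]
    = of_real s3 * \<Omega>12 [e 1, e 2, e 3, e 4, e 5, e 6, e 7, ?u (e 7) (e 8) c4 s4]"
    using slot[of "[e 1, e 2, e 3, e 4, e 5, e 6, e 7, ?u (e 7) (e 8) c4 s4]" 5 4 c3 s3 "e 6"]
    by (simp add: numeral_eq_Suc)
  also have "\<Omega>12 [e 1, e 2, e 3, e 4, e 5, e 6, e 7, ?u (e 7) (e 8) c4 s4]
    = of_real s4 * \<Omega>12 [e 1, e 2, e 3, e 4, e 5, e 6, e 7, e 8]"
    using slot[of "[e 1, e 2, e 3, e 4, e 5, e 6, e 7, e 8]" 7 6 c4 s4 "e 8"]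
    by (simp add: numeral_eq_Suc)
  finally show ?thesis by (simp add: frame_def plane_pair_def)
qed

lemma all_less_8: "(\<forall>i<8::nat. P i) \<longleftrightarrow> P 0 \<and> P 1 \<and> P 2 \<and> P 3 \<and> P 4 \<and> P 5 \<and> P 6 \<and> P 7"
proof -
  have "(\<forall>i<8::nat. P i) \<longleftrightarrow> (\<forall>i\<in>{..<8}. P i)" by (simp only: Ball_def lessThan_iff)
  then show ?thesis unfolding lessThan_small by simp
qed

lemma unitary_basisD: "unitary_basis e \<Longrightarrow> herm (e i) (e j) = (if i = j then 1 else 0)"
  unfolding unitary_basis_def by blast

lemma frame_geometry:
  assumes e: "unitary_basis e"
    and u: "c1\<^sup>2 + s1\<^sup>2 = 1" "c2\<^sup>2 + s2\<^sup>2 = 1" "c3\<^sup>2 + s3\<^sup>2 = 1" "c4\<^sup>2 + s4\<^sup>2 = 1"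
  shows "adapted \<omega> (frame e c1 s1 c2 s2 c3 s3 c4 s4)"
    and "orthonormal_list (frame e c1 s1 c2 s2 c3 s3 c4 s4)"
proof -
  have L: "length (frame e c1 s1 c2 s2 c3 s3 c4 s4) = 8" by (simp add: frame_def plane_pair_def)
  show "adapted \<omega> (frame e c1 s1 c2 s2 c3 s3 c4 s4)"
    unfolding adapted_def L all_less_8 unfolding frame_def plane_pair_def append.simps
    by (simp add: \<omega>_eq_Im_herm unitary_basisD[OF e])
  show "orthonormal_list (frame e c1 s1 c2 s2 c3 s3 c4 s4)"
    using u unfolding orthonormal_list_def L all_less_8 unfolding frame_def plane_pair_def append.simps
    by (simp add: inner_eq_Re_herm unitary_basisD[OF e] power2_eq_square)
qed

lemma \<omega>_plane_pair:
  assumes "unitary_basis e" "i \<noteq> j"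
  shows "\<omega> (plane_pair (e i) (e j) c s) = c"
  using assms by (simp add: plane_pair_def \<omega>_eq_Im_herm unitary_basisD)

text \<open>Two planes placed in the complex volume forms contribute their sines; the two left to
  the Kaehler form contribute their cosines.\<close>

lemma \<Phi>_frame:
  assumes e: "unitary_basis e"
    and u: "c1\<^sup>2 + s1\<^sup>2 = 1" "c2\<^sup>2 + s2\<^sup>2 = 1" "c3\<^sup>2 + s3\<^sup>2 = 1" "c4\<^sup>2 + s4\<^sup>2 = 1"
  defines "\<alpha> \<equiv> \<lambda>ys. Re (\<Omega>1 ys + \<Omega>2 ys)"
  shows "\<Phi> (frame e c1 s1 c2 s2 c3 s3 c4 s4) =
      s1 * s2 * s3 * s4 * Re (\<Omega>12 [e 1, e 2, e 3, e 4, e 5, e 6, e 7, e 8]) + c1 * c2 * c3 * c4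
    + (s1 * s2 * c3 * c4 * \<alpha> [e 1, e 2, e 3, e 4] + s1 * s3 * c2 * c4 * \<alpha> [e 1, e 2, e 5, e 6]
    + s1 * s4 * c2 * c3 * \<alpha> [e 1, e 2, e 7, e 8] + c1 * c4 * s2 * s3 * \<alpha> [e 3, e 4, e 5, e 6]
    + c1 * c3 * s2 * s4 * \<alpha> [e 3, e 4, e 7, e 8] + c1 * c2 * s3 * s4 * \<alpha> [e 5, e 6, e 7, e 8])"
proof -
  let ?u = "\<lambda>v w c s. c *\<^sub>R (\<i> *s v) + s *\<^sub>R w"
  have fl: "frame e c1 s1 c2 s2 c3 s3 c4 s4 = [e 1, ?u (e 1) (e 2) c1 s1, e 3, ?u (e 3) (e 4) c2 s2,
      e 5, ?u (e 5) (e 6) c3 s3, e 7, ?u (e 7) (e 8) c4 s4]" by (simp add: frame_def plane_pair_def)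
  have \<alpha>: "\<alpha> [v, ?u v w c s, v', ?u v' w' c' s'] = s * s' * \<alpha> [v, w, v', w']" for v w v' w' c s c' s'
    using vol4_plane_pair[of _ _ _ _ v w c s v' w' c' s']
    unfolding \<alpha>_def \<Omega>_eq_vol4 by (simp add: plane_pair_def algebra_simps)
  have \<omega>: "\<omega> [e 1, ?u (e 1) (e 2) c1 s1] = c1" "\<omega> [e 3, ?u (e 3) (e 4) c2 s2] = c2"
    "\<omega> [e 5, ?u (e 5) (e 6) c3 s3] = c3" "\<omega> [e 7, ?u (e 7) (e 8) c4 s4] = c4"
    using \<omega>_plane_pair[OF e] by (simp_all add: plane_pair_def)
  show ?thesis
    using \<Phi>_adapted[OF frame_geometry(1)[OF e u, unfolded fl], of \<alpha>] \<Omega>12_frame[of e c1 s1 c2 s2 c3 s3 c4 s4]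
    unfolding fl \<alpha> \<omega> by (simp add: \<alpha>_def algebra_simps)
qed

text \<open>Expand the basis in the coordinate vectors, and the coordinate vectors in the basis. The
  two determinants are conjugate to each other and their product is 1.\<close>

lemma norm_\<Omega>12_unitary:
  assumes e: "unitary_basis e"
  shows "norm (\<Omega>12 [e 1, e 2, e 3, e 4, e 5, e 6, e 7, e 8]) = 1"
proof -
  let ?ix = "[1, 2, 3, 4, 5, 6, 7, 8] :: 8 list"
  let ?fs = "map e ?ix" and ?es = "map ax ?ix"
  have lt: "i < 8 \<Longrightarrow> i < length ?ix" for i :: nat by simp
  have sum8: "(\<Sum>j<8. f (?ix ! j)) = (\<Sum>k\<in>UNIV. f k)" for f :: "8 \<Rightarrow> C8"
    unfolding sum_8 by (simp add: lessThan_small ac_simps)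
  have e1: "\<Omega>12 ?es = 1"
    using \<Omega>12_block[of ?es] \<Omega>_axis by (auto simp: X1_def axis_def less_Suc_eq numeral_eq_Suc)
  have "\<Omega>12 ?fs = (\<Sum>p | p permutes {..<8}. of_int (sign p) * (\<Prod>i<8. e (?ix ! i) $ (?ix ! p i))) * \<Omega>12 ?es"
  proof (rule alt_form_linear_combination[OF alt_form_\<Omega>12])
    fix i :: nat assume i: "i < 8"
    have "(\<Sum>j<8. e (?ix ! i) $ (?ix ! j) *s ?es ! j) = (\<Sum>j<8. e (?ix ! i) $ (?ix ! j) *s ax (?ix ! j))"
      by (rule sum.cong) (simp_all only: lessThan_iff nth_map[OF lt])
    also have "\<dots> = e (?ix ! i)"
      unfolding sum8[of "\<lambda>k. e (?ix ! i) $ k *s ax k"]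
      by (simp add: vec_eq_iff axis_def if_distrib cong: if_cong)
    finally show "?fs ! i = (\<Sum>j<8. e (?ix ! i) $ (?ix ! j) *s ?es ! j)"
      by (simp only: nth_map[OF lt[OF i]])
  qed simp_all
  then have d1: "\<Omega>12 ?fs = (\<Sum>p | p permutes {..<8}. of_int (sign p) * (\<Prod>i<8. e (?ix ! i) $ (?ix ! p i)))"
    unfolding e1 by simp
  have "\<Omega>12 ?es = (\<Sum>p | p permutes {..<8}. of_int (sign p) * (\<Prod>i<8. cnj (e (?ix ! p i) $ (?ix ! i)))) * \<Omega>12 ?fs"
  proof (rule alt_form_linear_combination[OF alt_form_\<Omega>12])
    fix i :: nat assume i: "i < 8"
    have "(\<Sum>j<8. cnj (e (?ix ! j) $ (?ix ! i)) *s ?fs ! j) = (\<Sum>j<8. cnj (e (?ix ! j) $ (?ix ! i)) *s e (?ix ! j))"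
      by (rule sum.cong) (simp_all only: lessThan_iff nth_map[OF lt])
    also have "\<dots> = ax (?ix ! i)"
      unfolding sum8[of "\<lambda>k. cnj (e k $ (?ix ! i)) *s e k"] vec_eq_iff
      using unitary_basis_rows[OF e, of _ "?ix ! i"]
      by (auto simp: axis_def mult.commute[of "cnj _"])
    finally show "?es ! i = (\<Sum>j<8. cnj (e (?ix ! j) $ (?ix ! i)) *s ?fs ! j)"
      by (simp only: nth_map[OF lt[OF i]])
  qed simp_all
  moreover have "(\<Sum>p | p permutes {..<8}. of_int (sign p) * (\<Prod>i<8. cnj (e (?ix ! p i) $ (?ix ! i)))) = cnj (\<Omega>12 ?fs)"
    unfolding d1 leibniz_transpose[where a = "\<lambda>i j. e (?ix ! i) $ (?ix ! j)"] by simp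
  ultimately have "cnj (\<Omega>12 ?fs) * \<Omega>12 ?fs = 1" unfolding e1 by simp
  then have "complex_of_real ((norm (\<Omega>12 ?fs))\<^sup>2) = 1"
    unfolding complex_norm_square by (simp only: mult.commute)
  then have "(norm (\<Omega>12 ?fs))\<^sup>2 = 1\<^sup>2" by (simp only: of_real_eq_1_iff power_one)
  then have "norm (\<Omega>12 ?fs) = 1" by (rule power2_eq_imp_eq) simp_all
  then show ?thesis by simp
qed

lemma antisym_pair_swap:
  assumes "antisym_form 8 \<psi>"
  shows "\<psi> [c, d, a, b, x, y, g, h] = \<psi> [a, b, c, d, x, y, g, h]"
    "\<psi> [a, b, x, y, c, d, g, h] = \<psi> [a, b, c, d, x, y, g, h]"
    "\<psi> [a, b, c, d, g, h, x, y] = \<psi> [a, b, c, d, x, y, g, h]"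
proof -
  have sw: "\<psi> (xs[i := xs ! j, j := xs ! i]) = - \<psi> xs" if "length xs = 8" "i < 8" "j < 8" "i \<noteq> j" for xs i j
    using assms that unfolding antisym_form_def by blast
  show "\<psi> [c, d, a, b, x, y, g, h] = \<psi> [a, b, c, d, x, y, g, h]"
    using sw[of "[a, b, c, d, x, y, g, h]" 0 2] sw[of "[c, b, a, d, x, y, g, h]" 1 3]
    by (simp add: numeral_eq_Suc)
  show "\<psi> [a, b, x, y, c, d, g, h] = \<psi> [a, b, c, d, x, y, g, h]"
    using sw[of "[a, b, c, d, x, y, g, h]" 2 4] sw[of "[a, b, x, d, c, y, g, h]" 3 5]
    by (simp add: numeral_eq_Suc)
  show "\<psi> [a, b, c, d, g, h, x, y] = \<psi> [a, b, c, d, x, y, g, h]"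
    using sw[of "[a, b, c, d, x, y, g, h]" 4 6] sw[of "[a, b, c, d, g, y, x, h]" 5 7]
    by (simp add: numeral_eq_Suc)
qed

text \<open>Jacobi's identity for the other pairs: permuting the four pairs of the basis is an even
  permutation, so it does not change the volume.\<close>

lemma unitary_pair_minors:
  assumes e: "unitary_basis e"
  defines "\<delta> \<equiv> \<Omega>12 [e 1, e 2, e 3, e 4, e 5, e 6, e 7, e 8]"
  shows "\<Omega>2 [e 5, e 6, e 7, e 8] = \<delta> * cnj (\<Omega>1 [e 1, e 2, e 3, e 4])"
    "\<Omega>2 [e 1, e 2, e 3, e 4] = \<delta> * cnj (\<Omega>1 [e 5, e 6, e 7, e 8])"
    "\<Omega>2 [e 3, e 4, e 7, e 8] = \<delta> * cnj (\<Omega>1 [e 1, e 2, e 5, e 6])"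
    "\<Omega>2 [e 1, e 2, e 5, e 6] = \<delta> * cnj (\<Omega>1 [e 3, e 4, e 7, e 8])"
    "\<Omega>2 [e 3, e 4, e 5, e 6] = \<delta> * cnj (\<Omega>1 [e 1, e 2, e 7, e 8])"
    "\<Omega>2 [e 1, e 2, e 7, e 8] = \<delta> * cnj (\<Omega>1 [e 3, e 4, e 5, e 6])"
proof -
  let ?es = "[e 1, e 2, e 3, e 4, e 5, e 6, e 7, e 8]"
  note U = unitary_list_map[OF e]
  note J = unitary_complementary_minor
  note p = antisym_pair_swap[OF alt_form_antisym[OF alt_form_\<Omega>12]]
  show "\<Omega>2 [e 5, e 6, e 7, e 8] = \<delta> * cnj (\<Omega>1 [e 1, e 2, e 3, e 4])"
    unfolding \<delta>_def using J U[of "[1,2,3,4,5,6,7,8]"] by simp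
  have "\<Omega>12 [e 5, e 6, e 7, e 8, e 1, e 2, e 3, e 4] = \<delta>"
    unfolding \<delta>_def
    by (subst p(2)[of "e 5" "e 6" "e 7" "e 8" "e 1" "e 2"], subst p(1)[of "e 5" "e 6" "e 1" "e 2"], subst p(3)[of "e 1" "e 2" "e 5" "e 6" "e 7" "e 8" "e 3" "e 4"], subst p(2)[of "e 1" "e 2" "e 5" "e 6" "e 3" "e 4"], rule refl)
  then show "\<Omega>2 [e 1, e 2, e 3, e 4] = \<delta> * cnj (\<Omega>1 [e 5, e 6, e 7, e 8])"
    using J[of "e 5" "e 6" "e 7" "e 8" "e 1" "e 2" "e 3" "e 4"] U[of "[5,6,7,8,1,2,3,4]"] by simp
  have "\<Omega>12 [e 1, e 2, e 5, e 6, e 3, e 4, e 7, e 8] = \<delta>"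
    unfolding \<delta>_def by (rule p(2))
  then show "\<Omega>2 [e 3, e 4, e 7, e 8] = \<delta> * cnj (\<Omega>1 [e 1, e 2, e 5, e 6])"
    using J[of "e 1" "e 2" "e 5" "e 6" "e 3" "e 4" "e 7" "e 8"] U[of "[1,2,5,6,3,4,7,8]"] by simp
  have "\<Omega>12 [e 3, e 4, e 7, e 8, e 1, e 2, e 5, e 6] = \<delta>"
    unfolding \<delta>_def
    by (subst p(2)[of "e 3" "e 4" "e 7" "e 8" "e 1" "e 2"], subst p(1)[of "e 3" "e 4" "e 1" "e 2"], subst p(3)[of "e 1" "e 2" "e 3" "e 4" "e 7" "e 8" "e 5" "e 6"], rule refl)
  then show "\<Omega>2 [e 1, e 2, e 5, e 6] = \<delta> * cnj (\<Omega>1 [e 3, e 4, e 7, e 8])"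
    using J[of "e 3" "e 4" "e 7" "e 8" "e 1" "e 2" "e 5" "e 6"] U[of "[3,4,7,8,1,2,5,6]"] by simp
  have "\<Omega>12 [e 1, e 2, e 7, e 8, e 3, e 4, e 5, e 6] = \<delta>"
    unfolding \<delta>_def
    by (subst p(2)[of "e 1" "e 2" "e 7" "e 8" "e 3" "e 4"], subst p(3)[of "e 1" "e 2" "e 3" "e 4" "e 7" "e 8" "e 5" "e 6"], rule refl)
  then show "\<Omega>2 [e 3, e 4, e 5, e 6] = \<delta> * cnj (\<Omega>1 [e 1, e 2, e 7, e 8])"
    using J[of "e 1" "e 2" "e 7" "e 8" "e 3" "e 4" "e 5" "e 6"] U[of "[1,2,7,8,3,4,5,6]"] by simp
  have "\<Omega>12 [e 3, e 4, e 5, e 6, e 1, e 2, e 7, e 8] = \<delta>"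
    unfolding \<delta>_def
    by (subst p(2)[of "e 3" "e 4" "e 5" "e 6" "e 1" "e 2"], subst p(1)[of "e 3" "e 4" "e 1" "e 2"], rule refl)
  then show "\<Omega>2 [e 1, e 2, e 7, e 8] = \<delta> * cnj (\<Omega>1 [e 3, e 4, e 5, e 6])"
    using J[of "e 3" "e 4" "e 5" "e 6" "e 1" "e 2" "e 7" "e 8"] U[of "[3,4,5,6,1,2,7,8]"] by simp
qed


section \<open>Existence of the normal form\<close>

lemma bounded_bilinear_kaehler: "bounded_bilinear (\<lambda>u v :: C8. Im (herm u v))"
  unfolding bilinear_conv_bounded_bilinear[symmetric] bilinear_def linear_iff by simp

lemma kaehler_skew: "Im (herm u v) = - Im (herm v u)"
  using arg_cong[OF cnj_herm[of u v], of Im] by simp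

text \<open>The orientation sign \<rho> is absorbed into the last vector, so non-negative Kaehler
  values survive for all pairs but the last.\<close>

lemma Grass_adapted:
  fixes V :: "C8 set"
  assumes \<xi>: "\<xi> \<in> Grass V (2 * n)" and V: "subspace V" and n: "0 < n"
  obtains us where "length us = 2 * n" "set us \<subseteq> V" "orthonormal_list us" "adapted \<omega> us"
    "\<And>j. Suc j < n \<Longrightarrow> 0 \<le> \<omega> [us ! (2 * j), us ! Suc (2 * j)]" "\<xi> = simple_vector us"
proof -
  obtain xs where xs: "\<xi> = simple_vector xs" "length xs = 2 * n" "set xs \<subseteq> V" "gram_det xs = 1"
    using \<xi> unfolding Grass_def simple_norm_def by (auto simp: real_sqrt_eq_1_iff)
  obtain us \<rho> where us: "length us = 2 * n" "set us \<subseteq> span (set xs)" "orthonormal_list us"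
    "\<And>i j. i < 2 * n \<Longrightarrow> j < 2 * n \<Longrightarrow> i div 2 \<noteq> j div 2 \<Longrightarrow> Im (herm (us ! i) (us ! j)) = 0"
    "\<And>j. j < n \<Longrightarrow> 0 \<le> Im (herm (us ! (2 * j)) (us ! Suc (2 * j)))"
    and \<rho>: "\<rho> = 1 \<or> \<rho> = - 1"
    and ext: "\<And>\<phi>. alternating_form (2 * n) \<phi> \<Longrightarrow> \<phi> xs = \<rho> * \<phi> us"
    using simple_vector_adapted[OF bounded_bilinear_kaehler kaehler_skew xs(2,4)] by blast
  let ?k = "2 * n - 1"
  define vs where "vs = us[?k := \<rho> *\<^sub>R us ! ?k]"
  define \<sigma> where "\<sigma> i = (if i = ?k then \<rho> else 1)" for i
  have nth: "vs ! i = \<sigma> i *\<^sub>R us ! i" if "i < 2 * n" for i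
    using that us(1) by (auto simp: vs_def \<sigma>_def nth_list_update)
  have \<sigma>\<sigma>: "\<sigma> i * \<sigma> i = 1" for i using \<rho> by (auto simp: \<sigma>_def)
  have l: "length vs = 2 * n" using us(1) by (simp add: vs_def)
  have spV: "set us \<subseteq> V" using us(2) span_minimal[OF xs(3) V] by blast
  have "set vs \<subseteq> V"
  proof
    fix x assume "x \<in> set vs"
    then obtain i where "i < 2 * n" "x = vs ! i" using l by (metis in_set_conv_nth)
    then show "x \<in> V" using nth spV V us(1) by (auto intro!: subspace_scale)
  qed
  moreover have "orthonormal_list vs"
    using us(3) \<sigma>\<sigma> unfolding orthonormal_list_def l us(1) by (auto simp: nth)
  moreover have "adapted \<omega> vs"
    unfolding adapted_def l \<omega>_eq_Im_herm using us(4) by (auto simp: nth)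
  moreover have "0 \<le> \<omega> [vs ! (2 * j), vs ! Suc (2 * j)]" if "Suc j < n" for j
    unfolding \<omega>_eq_Im_herm using us(5)[of j] that by (simp add: nth \<sigma>_def)
  moreover have "\<xi> = simple_vector vs"
  proof
    fix \<phi> :: "C8 list \<Rightarrow> real"
    show "\<xi> \<phi> = simple_vector vs \<phi>"
    proof (cases "alternating_form (2 * n) \<phi>")
      case True
      then have "multilin (*\<^sub>R) (2 * n) \<phi>" using alternating_form_iff_alt_form alt_formD(1) by blast
      then have "\<phi> vs = \<rho> * \<phi> (us[?k := us ! ?k])"
        unfolding vs_def using n us(1) by (intro multilinD(2)) auto
      then show ?thesis using True ext[OF True] l xs by (simp add: simple_vector_def)
    qed (use l xs in \<open>simp add: simple_vector_def\<close>)
  qed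
  ultimately show thesis using that l by blast
qed

text \<open>For w = 0 a direction has to be invented: seven vectors and their multiples by the
  imaginary unit span at most 14 of the 16 real dimensions.\<close>

lemma unit_completion:
  fixes vs :: "C8 list" and w :: C8
  assumes l: "length vs \<le> 7" and w: "\<And>v. v \<in> set vs \<Longrightarrow> herm v w = 0"
  shows "\<exists>e. herm e e = 1 \<and> (\<forall>v\<in>set vs. herm v e = 0) \<and> w = norm w *\<^sub>R e"
proof (cases "w = 0")
  case False
  have "herm (inverse (norm w) *\<^sub>R w) (inverse (norm w) *\<^sub>R w) = 1"
    using False by (simp add: herm_self power2_eq_square)
  then show ?thesis using w False by (intro exI[of _ "inverse (norm w) *\<^sub>R w"]) simp
next
  case True
  let ?S = "set vs \<union> (\<lambda>v. \<i> *s v) ` set vs"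
  have "dim ?S \<le> card ?S" by (rule dim_le_card') simp
  also have "\<dots> \<le> card (set vs) + card (set vs)"
    using card_Un_le[of "set vs" "(\<lambda>v. \<i> *s v) ` set vs"] card_image_le[of "set vs" "\<lambda>v. \<i> *s v"] by simp
  also have "\<dots> < DIM(C8)" using l card_length[of vs] by simp
  finally obtain x where x: "x \<noteq> 0" "\<And>y. y \<in> span ?S \<Longrightarrow> orthogonal x y"
    using orthogonal_to_subspace_exists[of ?S] by auto
  have "herm v x = 0" if v: "v \<in> set vs" for v
  proof -
    have "x \<bullet> v = 0" "x \<bullet> (\<i> *s v) = 0"
      using x(2)[OF span_base, of v] x(2)[OF span_base, of "\<i> *s v"] v by (auto simp: orthogonal_def)
    then have "Re (herm x v) = 0" "Im (herm x v) = 0" by (simp_all add: inner_eq_Re_herm)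
    then have "herm x v = 0" by (simp add: complex_eq_iff)
    then show ?thesis using cnj_herm[of x v] by simp
  qed
  moreover have "herm (inverse (norm x) *\<^sub>R x) (inverse (norm x) *\<^sub>R x) = 1"
    using x(1) by (simp add: herm_self power2_eq_square)
  ultimately show ?thesis using True by (intro exI[of _ "inverse (norm x) *\<^sub>R x"]) simp
qed

lemma list_8:
  assumes "length us = 8"
  obtains u1 u2 u3 u4 u5 u6 u7 u8 where "us = [u1, u2, u3, u4, u5, u6, u7, u8]"
  using assms by (auto simp: numeral_eq_Suc length_Suc_conv)

text \<open>In an adapted pair u, v with Kaehler value c, the vector v - c \<i> u is Hermitian
  orthogonal to u and its length is the sine. Normalizing it gives the second basis vector; if it is
  zero the direction is free.\<close>

lemma frame_exists:
  assumes \<xi>: "\<xi> \<in> Grass UNIV 8"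
  obtains e c1 s1 c2 s2 c3 s3 c4 s4 where "unitary_basis e"
    "c1\<^sup>2 + s1\<^sup>2 = 1" "c2\<^sup>2 + s2\<^sup>2 = 1" "c3\<^sup>2 + s3\<^sup>2 = 1" "c4\<^sup>2 + s4\<^sup>2 = 1"
    "0 \<le> c1" "0 \<le> c2" "0 \<le> c3" "0 \<le> s1" "0 \<le> s2" "0 \<le> s3" "0 \<le> s4"
    "\<xi> = simple_vector (frame e c1 s1 c2 s2 c3 s3 c4 s4)"
proof -
  obtain us where us: "length us = 2 * 4" "orthonormal_list us" "adapted \<omega> us"
    "\<And>j. Suc j < 4 \<Longrightarrow> 0 \<le> \<omega> [us ! (2 * j), us ! Suc (2 * j)]" "\<xi> = simple_vector us"
    using Grass_adapted[of \<xi> UNIV 4] \<xi> subspace_UNIV by auto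
  obtain u1 u2 u3 u4 u5 u6 u7 u8 where u: "us = [u1, u2, u3, u4, u5, u6, u7, u8]"
    by (rule list_8[of us]) (simp add: us(1))
  define c1 c2 c3 c4 where "c1 = \<omega> [u1, u2]" and "c2 = \<omega> [u3, u4]" and "c3 = \<omega> [u5, u6]" and "c4 = \<omega> [u7, u8]"
  have L: "length us = 8" using us(1) by simp
  have hh: "herm (us ! i) (us ! j) = (if i = j then 1 else 0)" if "i < 8" "j < 8" "i div 2 \<noteq> j div 2 \<or> i = j" for i j
  proof -
    have "Re (herm (us ! i) (us ! j)) = (if i = j then 1 else 0)"
      using us(2) that unfolding orthonormal_list_def L inner_eq_Re_herm[symmetric] by simp
    moreover have "Im (herm (us ! i) (us ! j)) = 0"
    proof (cases "i = j")
      case True then show ?thesis by (simp add: herm_self)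
    next
      case False
      then show ?thesis using us(3) that unfolding adapted_def L \<omega>_eq_Im_herm by simp
    qed
    ultimately show ?thesis by (simp add: complex_eq_iff)
  qed
  have re: "us ! i \<bullet> us ! j = (if i = j then 1 else 0)" if "i < 8" "j < 8" for i j
    using us(2) that unfolding orthonormal_list_def L by simp
  have hc: "herm u1 u2 = \<i> * of_real c1" "herm u3 u4 = \<i> * of_real c2" "herm u5 u6 = \<i> * of_real c3" "herm u7 u8 = \<i> * of_real c4"
    using re[of 0 1] re[of 2 3] re[of 4 5] re[of 6 7]
    by (simp_all add: u c1_def c2_def c3_def c4_def \<omega>_eq_Im_herm complex_eq_iff inner_eq_Re_herm)
  then have hc': "herm u2 u1 = - (\<i> * of_real c1)" "herm u4 u3 = - (\<i> * of_real c2)"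
    "herm u6 u5 = - (\<i> * of_real c3)" "herm u8 u7 = - (\<i> * of_real c4)"
    using cnj_herm[of u1 u2] cnj_herm[of u3 u4] cnj_herm[of u5 u6] cnj_herm[of u7 u8] by simp_all
  have h0: "\<forall>i<8. \<forall>j<8. i div 2 \<noteq> j div 2 \<or> i = j \<longrightarrow> herm (us ! i) (us ! j) = (if i = j then 1 else 0)"
    using hh by blast
  note h = h0[unfolded all_less_8 u, simplified]
  define w1 w2 w3 w4 where "w1 = u2 - c1 *\<^sub>R (\<i> *s u1)" and "w2 = u4 - c2 *\<^sub>R (\<i> *s u3)"
    and "w3 = u6 - c3 *\<^sub>R (\<i> *s u5)" and "w4 = u8 - c4 *\<^sub>R (\<i> *s u7)"
  note w_def = w1_def w2_def w3_def w4_def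
  have ww: "herm w1 w1 = 1 - of_real c1 * of_real c1" "herm w2 w2 = 1 - of_real c2 * of_real c2"
    "herm w3 w3 = 1 - of_real c3 * of_real c3" "herm w4 w4 = 1 - of_real c4 * of_real c4"
    unfolding w_def using h hc hc' by (simp_all add: algebra_simps)
  have ws: "c\<^sup>2 + (norm w)\<^sup>2 = 1" if "herm w w = 1 - of_real c * of_real c" for w :: C8 and c
  proof -
    have "complex_of_real ((norm w)\<^sup>2) = complex_of_real (1 - c\<^sup>2)"
      using that herm_self[of w] by (simp add: power2_eq_square)
    then have "(norm w)\<^sup>2 = 1 - c\<^sup>2" by (simp only: of_real_eq_iff)
    then show ?thesis by simp
  qed
  have cyc: "herm a b = 0 \<longleftrightarrow> herm b a = 0" for a b :: C8 by (metis cnj_herm complex_cnj_zero)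
  have uw: "herm u1 w1 = 0" "herm u1 w2 = 0" "herm u1 w3 = 0" "herm u1 w4 = 0" "herm u3 w1 = 0" "herm u3 w2 = 0" "herm u3 w3 = 0" "herm u3 w4 = 0"
    "herm u5 w1 = 0" "herm u5 w2 = 0" "herm u5 w3 = 0" "herm u5 w4 = 0" "herm u7 w1 = 0" "herm u7 w2 = 0" "herm u7 w3 = 0" "herm u7 w4 = 0"
    unfolding w_def by (simp_all add: h hc)
  have w0: "herm w2 w1 = 0" "herm w3 w1 = 0" "herm w4 w1 = 0" "herm w3 w2 = 0" "herm w4 w2 = 0" "herm w4 w3 = 0"
    unfolding w_def by (simp_all add: h)
  \<comment> \<open>Each new direction is kept orthogonal to the vectors already found and to the
    w's still waiting, so a freely chosen one cannot obstruct a later step.\<close>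
  have "\<forall>v\<in>set [u1, u3, u5, u7, w2, w3, w4]. herm v w1 = 0" by (simp add: uw w0 )
  then obtain e2 where "herm e2 e2 = 1 \<and> (\<forall>v\<in>set [u1, u3, u5, u7, w2, w3, w4]. herm v e2 = 0) \<and> w1 = norm w1 *\<^sub>R e2"
    using unit_completion[of "[u1, u3, u5, u7, w2, w3, w4]" w1] by auto
  then have e2: "herm e2 e2 = 1" "w1 = norm w1 *\<^sub>R e2" "herm u1 e2 = 0" "herm u3 e2 = 0" "herm u5 e2 = 0" "herm u7 e2 = 0" "herm w2 e2 = 0" "herm w3 e2 = 0" "herm w4 e2 = 0"
    by simp_all
  then have e2': "herm e2 u1 = 0" "herm e2 u3 = 0" "herm e2 u5 = 0" "herm e2 u7 = 0" "herm e2 w2 = 0" "herm e2 w3 = 0" "herm e2 w4 = 0"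
    by (simp_all add: cyc)
  have "\<forall>v\<in>set [u1, u3, u5, u7, e2, w3, w4]. herm v w2 = 0" by (simp add: uw w0 e2')
  then obtain e4 where "herm e4 e4 = 1 \<and> (\<forall>v\<in>set [u1, u3, u5, u7, e2, w3, w4]. herm v e4 = 0) \<and> w2 = norm w2 *\<^sub>R e4"
    using unit_completion[of "[u1, u3, u5, u7, e2, w3, w4]" w2] by auto
  then have e4: "herm e4 e4 = 1" "w2 = norm w2 *\<^sub>R e4" "herm u1 e4 = 0" "herm u3 e4 = 0" "herm u5 e4 = 0" "herm u7 e4 = 0" "herm e2 e4 = 0" "herm w3 e4 = 0" "herm w4 e4 = 0"
    by simp_all
  then have e4': "herm e4 u1 = 0" "herm e4 u3 = 0" "herm e4 u5 = 0" "herm e4 u7 = 0" "herm e4 e2 = 0" "herm e4 w3 = 0" "herm e4 w4 = 0"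
    by (simp_all add: cyc)
  have "\<forall>v\<in>set [u1, u3, u5, u7, e2, e4, w4]. herm v w3 = 0" by (simp add: uw w0 e2' e4')
  then obtain e6 where "herm e6 e6 = 1 \<and> (\<forall>v\<in>set [u1, u3, u5, u7, e2, e4, w4]. herm v e6 = 0) \<and> w3 = norm w3 *\<^sub>R e6"
    using unit_completion[of "[u1, u3, u5, u7, e2, e4, w4]" w3] by auto
  then have e6: "herm e6 e6 = 1" "w3 = norm w3 *\<^sub>R e6" "herm u1 e6 = 0" "herm u3 e6 = 0" "herm u5 e6 = 0" "herm u7 e6 = 0" "herm e2 e6 = 0" "herm e4 e6 = 0" "herm w4 e6 = 0"
    by simp_all
  then have e6': "herm e6 u1 = 0" "herm e6 u3 = 0" "herm e6 u5 = 0" "herm e6 u7 = 0" "herm e6 e2 = 0" "herm e6 e4 = 0" "herm e6 w4 = 0"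
    by (simp_all add: cyc)
  have "\<forall>v\<in>set [u1, u3, u5, u7, e2, e4, e6]. herm v w4 = 0" by (simp add: uw w0 e2' e4' e6')
  then obtain e8 where "herm e8 e8 = 1 \<and> (\<forall>v\<in>set [u1, u3, u5, u7, e2, e4, e6]. herm v e8 = 0) \<and> w4 = norm w4 *\<^sub>R e8"
    using unit_completion[of "[u1, u3, u5, u7, e2, e4, e6]" w4] by auto
  then have e8: "herm e8 e8 = 1" "w4 = norm w4 *\<^sub>R e8" "herm u1 e8 = 0" "herm u3 e8 = 0" "herm u5 e8 = 0" "herm u7 e8 = 0" "herm e2 e8 = 0" "herm e4 e8 = 0" "herm e6 e8 = 0"
    by simp_all
  then have e8': "herm e8 u1 = 0" "herm e8 u3 = 0" "herm e8 u5 = 0" "herm e8 u7 = 0" "herm e8 e2 = 0" "herm e8 e4 = 0" "herm e8 e6 = 0"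
    by (simp_all add: cyc)
  define e :: "8 \<Rightarrow> C8" where "e i = (if i = 1 then u1 else if i = 2 then e2 else if i = 3 then u3 else if i = 4 then e4
    else if i = 5 then u5 else if i = 6 then e6 else if i = 7 then u7 else e8)" for i
  have "unitary_basis e"
    unfolding unitary_basis_def forall_8 e_def
    by (simp add: h e2(1,3-) e2' e4(1,3-) e4' e6(1,3-) e6' e8(1,3-) e8')
  moreover have "us = frame e c1 (norm w1) c2 (norm w2) c3 (norm w3) c4 (norm w4)"
    using e2(2) e4(2) e6(2) e8(2)
    unfolding u frame_def plane_pair_def by (simp add: e_def w_def algebra_simps)
  moreover have "0 \<le> c1" "0 \<le> c2" "0 \<le> c3"
    using us(4)[of 0] us(4)[of 1] us(4)[of 2] by (simp_all add: u c1_def c2_def c3_def)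
  ultimately show thesis using that ws[OF ww(1)] ws[OF ww(2)] ws[OF ww(3)] ws[OF ww(4)] us(5) norm_ge_zero by blast
qed

text \<open>Translates \<open>comass_equality\<close> back to the basis. In its equal-angle
  alternative \<delta> = \<kappa>^2 = 1, so the real parts of the six minors add up to the sum of
  the |\<beta>_k|, which is 1. The Pfaffian bound leaves no imaginary part, and Jacobi carries the
  value over to \<open>\<Omega>2\<close>.\<close>

lemma frame_equality_cases:
  assumes e: "unitary_basis e"
    and u: "c1\<^sup>2 + s1\<^sup>2 = 1" "c2\<^sup>2 + s2\<^sup>2 = 1" "c3\<^sup>2 + s3\<^sup>2 = 1" "c4\<^sup>2 + s4\<^sup>2 = 1"
    and nn: "0 \<le> c1" "0 \<le> c2" "0 \<le> c3" "0 \<le> s1" "0 \<le> s2" "0 \<le> s3" "0 \<le> s4"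
    and \<Phi>: "\<Phi> (frame e c1 s1 c2 s2 c3 s3 c4 s4) = 1"
  shows "(s1 = 0 \<and> s2 = 0 \<and> s3 = 0 \<and> s4 = 0) \<or> (c1 = 0 \<and> c2 = 0 \<and> c3 = 0 \<and> c4 = 0)
    \<or> 1 \<le> norm (\<Omega>1 [e 1, e 2, e 3, e 4]) + norm (\<Omega>1 [e 5, e 6, e 7, e 8])
    \<or> 1 \<le> norm (\<Omega>1 [e 1, e 2, e 5, e 6]) + norm (\<Omega>1 [e 3, e 4, e 7, e 8])
    \<or> 1 \<le> norm (\<Omega>1 [e 1, e 2, e 7, e 8]) + norm (\<Omega>1 [e 3, e 4, e 5, e 6])
    \<or> (c2 = c1 \<and> c3 = c1 \<and> c4 = c1 \<and> s2 = s1 \<and> s3 = s1 \<and> s4 = s1 \<and>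
        pair_volumes 1 1 1 1 e \<Omega>1 = 1 \<and> pair_volumes 1 1 1 1 e \<Omega>2 = 1)"
proof -
  define \<delta> where "\<delta> = \<Omega>12 [e 1, e 2, e 3, e 4, e 5, e 6, e 7, e 8]"
  define \<kappa> where "\<kappa> = csqrt \<delta>"
  have k2: "\<kappa>\<^sup>2 = \<delta>" by (simp add: \<kappa>_def)
  have "norm \<kappa> ^ 2 = 1 ^ 2" using norm_\<Omega>12_unitary[OF e] unfolding \<delta>_def[symmetric] k2[symmetric] by (simp add: norm_power)
  then have nk: "norm \<kappa> = 1" by (rule power2_eq_imp_eq) simp_all
  have kk: "\<kappa> * cnj \<kappa> = 1" using nk by (simp add: complex_norm_square[symmetric])
  let ?a = "\<Omega>1 [e 1, e 2, e 3, e 4]" and ?a' = "\<Omega>1 [e 5, e 6, e 7, e 8]"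
  let ?b = "\<Omega>1 [e 1, e 2, e 5, e 6]" and ?b' = "\<Omega>1 [e 3, e 4, e 7, e 8]"
  let ?d = "\<Omega>1 [e 1, e 2, e 7, e 8]" and ?d' = "\<Omega>1 [e 3, e 4, e 5, e 6]"
  let ?\<beta> = "\<lambda>x y. cnj \<kappa> * x + \<kappa> * cnj y"
  have kb: "\<kappa> * ?\<beta> x y = x + \<delta> * cnj y" "\<kappa> * cnj (?\<beta> x y) = \<delta> * cnj x + y" for x y
  proof -
    have "\<kappa> * ?\<beta> x y = (\<kappa> * cnj \<kappa>) * x + \<kappa>\<^sup>2 * cnj y" "\<kappa> * cnj (?\<beta> x y) = \<kappa>\<^sup>2 * cnj x + (\<kappa> * cnj \<kappa>) * y"
      by (simp_all add: algebra_simps power2_eq_square)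
    then show "\<kappa> * ?\<beta> x y = x + \<delta> * cnj y" "\<kappa> * cnj (?\<beta> x y) = \<delta> * cnj x + y"
      unfolding kk k2 by simp_all
  qed
  note D = unitary_pair_minors[OF e, folded \<delta>_def]
  have bound: "norm (?\<beta> ?a ?a') + norm (?\<beta> ?b ?b') + norm (?\<beta> ?d ?d') \<le> 1"
  proof (rule pairing_phases_bound[OF nk])
    fix t1 t2 t3 t4 :: complex
    assume t: "norm t1 = 1" "norm t2 = 1" "norm t3 = 1" "norm t4 = 1"
    show "norm (t1 * t2 * ?a + t3 * t4 * ?a' + t1 * t3 * ?b + t2 * t4 * ?b' + t1 * t4 * ?d + t2 * t3 * ?d') \<le> 1"
      using pair_volumes_bound(1)[OF e t, of 1 2 3 4] unfolding pair_volumes_def \<Omega>_eq_vol4 by simp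
  qed
  have "c1 * c2 * c3 * c4 + Re (\<kappa>\<^sup>2) * (s1 * s2 * s3 * s4)
      + s1 * s2 * c3 * c4 * Re (\<kappa> * ?\<beta> ?a ?a') + c1 * c2 * s3 * s4 * Re (\<kappa> * cnj (?\<beta> ?a ?a'))
      + s1 * s3 * c2 * c4 * Re (\<kappa> * ?\<beta> ?b ?b') + c1 * c3 * s2 * s4 * Re (\<kappa> * cnj (?\<beta> ?b ?b'))
      + s1 * s4 * c2 * c3 * Re (\<kappa> * ?\<beta> ?d ?d') + c1 * c4 * s2 * s3 * Re (\<kappa> * cnj (?\<beta> ?d ?d')) = 1"
    unfolding kb k2 using \<Phi> unfolding \<Phi>_frame[OF e u] D \<delta>_def[symmetric] plus_complex.sel
    by (simp only: ac_simps)
  note cases = comass_equality[OF u nn nk bound this]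
  \<comment> \<open>The phases are dropped here, because Hadamard's inequality needs only the moduli
    of the two minors.\<close>
  have big: "1 \<le> norm x + norm y" if "norm (?\<beta> x y) = 1" for x y
    using norm_triangle_ineq[of "cnj \<kappa> * x" "\<kappa> * cnj y"] that by (simp add: norm_mult nk)
  have last: "pair_volumes 1 1 1 1 e \<Omega>1 = 1 \<and> pair_volumes 1 1 1 1 e \<Omega>2 = 1"
    if k: "\<kappa>\<^sup>2 = 1" and b: "\<kappa> * ?\<beta> ?a ?a' = of_real (norm (?\<beta> ?a ?a'))" "\<kappa> * ?\<beta> ?b ?b' = of_real (norm (?\<beta> ?b ?b'))"
      "\<kappa> * ?\<beta> ?d ?d' = of_real (norm (?\<beta> ?d ?d'))"
      and s: "norm (?\<beta> ?a ?a') + norm (?\<beta> ?b ?b') + norm (?\<beta> ?d ?d') = 1"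
  proof -
    have d1: "\<delta> = 1" using k k2 by simp
    have r: "Re x + Re y = norm (?\<beta> x y)" if "\<kappa> * ?\<beta> x y = of_real (norm (?\<beta> x y))" for x y
      using arg_cong[OF that, of Re] unfolding kb d1 by simp
    let ?V = "pair_volumes 1 1 1 1 e \<Omega>1"
    have "Re ?V = (Re ?a + Re ?a') + (Re ?b + Re ?b') + (Re ?d + Re ?d')"
      unfolding pair_volumes_def by simp
    then have Re: "Re ?V = 1" unfolding r[OF b(1)] r[OF b(2)] r[OF b(3)] using s by simp
    have "norm ?V \<le> 1"
      using pair_volumes_bound(1)[OF e, of 1 1 1 1 1 2 3 4] unfolding \<Omega>_eq_vol4 by simp
    then have "(norm ?V)\<^sup>2 \<le> 1" by (simp add: abs_square_le_1)
    then have "(Im ?V)\<^sup>2 \<le> 0" using cmod_power2[of ?V] unfolding Re by simp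
    then have V: "?V = 1" using Re by (simp add: complex_eq_iff)
    have "pair_volumes 1 1 1 1 e \<Omega>2 = \<delta> * cnj ?V"
      unfolding pair_volumes_def D by (simp add: algebra_simps)
    then show ?thesis using V d1 by simp
  qed
  show ?thesis using cases big last by blast
qed

text \<open>Hadamard bounds the two volumes by the products of the lengths p and q of the
  projections to \<open>X1\<close> and \<open>X2\<close>. Since p^2 + q^2 = 1 for each vector, this
  is the equality case of \<open>unit_pairs_product\<close>.\<close>

lemma X_dichotomy:
  assumes n: "herm a a = 1" "herm b b = 1" "herm c c = 1" "herm d d = 1"
    and big: "1 \<le> norm (\<Omega>1 [a, b, c, d]) + norm (\<Omega>2 [a, b, c, d])"
  shows "(a \<in> X1 \<and> b \<in> X1 \<and> c \<in> X1 \<and> d \<in> X1) \<or> (a \<in> X2 \<and> b \<in> X2 \<and> c \<in> X2 \<and> d \<in> X2)"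
proof -
  define p q where "p v = sqrt ((norm (v $ 1))\<^sup>2 + (norm (v $ 2))\<^sup>2 + (norm (v $ 3))\<^sup>2 + (norm (v $ 4))\<^sup>2)"
    and "q v = sqrt ((norm (v $ 5))\<^sup>2 + (norm (v $ 6))\<^sup>2 + (norm (v $ 7))\<^sup>2 + (norm (v $ 8))\<^sup>2)" for v :: C8
  have p2: "(p v)\<^sup>2 = (norm (v $ 1))\<^sup>2 + (norm (v $ 2))\<^sup>2 + (norm (v $ 3))\<^sup>2 + (norm (v $ 4))\<^sup>2"
    and q2: "(q v)\<^sup>2 = (norm (v $ 5))\<^sup>2 + (norm (v $ 6))\<^sup>2 + (norm (v $ 7))\<^sup>2 + (norm (v $ 8))\<^sup>2" for v
    by (simp_all add: p_def q_def)
  have p0: "0 \<le> p v" "0 \<le> q v" for v by (simp_all add: p_def q_def)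
  have pq: "(p v)\<^sup>2 + (q v)\<^sup>2 = 1" if "herm v v = 1" for v
  proof -
    have "complex_of_real ((p v)\<^sup>2 + (q v)\<^sup>2) = herm v v"
      unfolding p2 q2 herm_def sum_8 of_real_add complex_norm_square by (simp add: mult.commute)
    then have "complex_of_real ((p v)\<^sup>2 + (q v)\<^sup>2) = 1" using that by (simp only:)
    then show ?thesis by (simp only: of_real_eq_1_iff)
  qed
  have "(norm (\<Omega>1 [a, b, c, d]))\<^sup>2 \<le> (p a * p b * p c * p d)\<^sup>2"
    using vol4_hadamard[of 1 2 3 4 a b c d] unfolding \<Omega>_eq_vol4 power_mult_distrib p2 by (simp add: mult.assoc)
  then have A: "norm (\<Omega>1 [a, b, c, d]) \<le> p a * p b * p c * p d"
    by (rule power2_le_imp_le) (simp add: p0)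
  have "(norm (\<Omega>2 [a, b, c, d]))\<^sup>2 \<le> (q a * q b * q c * q d)\<^sup>2"
    using vol4_hadamard[of 5 6 7 8 a b c d] unfolding \<Omega>_eq_vol4 power_mult_distrib q2 by (simp add: mult.assoc)
  then have B: "norm (\<Omega>2 [a, b, c, d]) \<le> q a * q b * q c * q d"
    by (rule power2_le_imp_le) (simp add: p0)
  have "\<bar>p a * p b * p c * p d\<bar> + \<bar>q a * q b * q c * q d\<bar> = 1"
    using unit_pairs_product(1)[OF pq[OF n(1)] pq[OF n(2)] pq[OF n(3)] pq[OF n(4)]] A B big by linarith
  from unit_pairs_product(2)[OF pq[OF n(1)] pq[OF n(2)] pq[OF n(3)] pq[OF n(4)] this]
  have "(q a = 0 \<and> q b = 0 \<and> q c = 0 \<and> q d = 0) \<or> (p a = 0 \<and> p b = 0 \<and> p c = 0 \<and> p d = 0)" .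
  moreover have "q v = 0 \<Longrightarrow> v \<in> X1" "p v = 0 \<Longrightarrow> v \<in> X2" for v
    unfolding X1_def X2_def p_def q_def by (auto simp: add_nonneg_eq_0_iff)
  ultimately show ?thesis by blast
qed

section \<open>Cayley planes and products\<close>


lemma simple_vector_apply:
  "alt_form (*\<^sub>R) n \<phi> \<Longrightarrow> length xs = n \<Longrightarrow> simple_vector xs \<phi> = \<phi> xs"
  by (simp add: simple_vector_def alternating_form_iff_alt_form)

lemma simple_vector_eqI:
  assumes "length xs = n" "length ys = n" "\<And>\<phi>. alt_form (*\<^sub>R) n \<phi> \<Longrightarrow> \<phi> xs = \<phi> ys"
  shows "simple_vector xs = simple_vector ys"
  using assms by (auto simp: simple_vector_def alternating_form_iff_alt_form fun_eq_iff)

lemma orthonormal_in_Grass: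
  assumes "orthonormal_list us" "set us \<subseteq> V" "length us = m"
  shows "simple_vector us \<in> Grass V m"
  using assms gram_det_orthonormal[OF assms(1)] unfolding Grass_def simple_norm_def by auto

lemma length_frame: "length (frame e c1 s1 c2 s2 c3 s3 c4 s4) = 8"
  by (simp add: frame_def plane_pair_def)

lemma X1_subspace: "subspace X1" and X1_scale: "v \<in> X1 \<Longrightarrow> a *s v \<in> X1"
  and X2_subspace: "subspace X2" and X2_scale: "v \<in> X2 \<Longrightarrow> a *s v \<in> X2"
  by (simp_all add: subspace_def X1_def X2_def)

lemma kaehler_restrict:
  "v \<in> X1 \<Longrightarrow> \<omega>1 [v, w] = \<omega> [v, w]" "v \<in> X2 \<Longrightarrow> \<omega>2 [v, w] = \<omega> [v, w]"
  "v \<in> X1 \<Longrightarrow> w \<in> X2 \<Longrightarrow> \<omega> [v, w] = 0" "v \<in> X2 \<Longrightarrow> w \<in> X1 \<Longrightarrow> \<omega> [v, w] = 0"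
  unfolding \<omega>_def \<omega>1_def \<omega>2_def kahler_complex(2) X1_def X2_def by simp_all

definition cayley_form1 :: "C8 list \<Rightarrow> real" where
  "cayley_form1 xs = Re (\<Omega>1 xs) + 1 / 2 * wedge_power 2 \<omega>1 2 xs"

definition cayley_form2 :: "C8 list \<Rightarrow> real" where
  "cayley_form2 xs = Re (\<Omega>2 xs) + 1 / 2 * wedge_power 2 \<omega>2 2 xs"

lemma alt_form_cayley: "alt_form (*\<^sub>R) 4 cayley_form1" "alt_form (*\<^sub>R) 4 cayley_form2"
proof -
  have e: "2 * 2 = (4::nat)" by simp
  note w = alt_form_\<omega>(2,3)[THEN alt_formD(1), THEN alt_form_wedge_power, where n = 2, unfolded e, THEN alt_form_cmult]
  have "alt_form (*\<^sub>R) 4 (\<lambda>xs. Re (\<Omega>1 xs) + 1 / 2 * wedge_power 2 \<omega>1 2 xs)"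
    "alt_form (*\<^sub>R) 4 (\<lambda>xs. Re (\<Omega>2 xs) + 1 / 2 * wedge_power 2 \<omega>2 2 xs)"
    unfolding \<Omega>_eq_vol4 by (intro alt_form_add alt_form_Re alt_form_vol_pieces w)+
  then show "alt_form (*\<^sub>R) 4 cayley_form1" "alt_form (*\<^sub>R) 4 cayley_form2"
    unfolding cayley_form1_def[abs_def] cayley_form2_def[abs_def] by blast+
qed

lemma cayley_iff:
  "cayley1 \<xi> \<longleftrightarrow> \<xi> \<in> Grass X1 4 \<and> \<xi> cayley_form1 = 1"
  "cayley2 \<xi> \<longleftrightarrow> \<xi> \<in> Grass X2 4 \<and> \<xi> cayley_form2 = 1"
  unfolding cayley1_def cayley2_def calibrates_def cayley_form1_def[abs_def] cayley_form2_def[abs_def] by blast+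

lemma cayley_form_adapted:
  assumes ad: "adapted \<omega> [a, b, c, d]"
  shows "set [a, b, c, d] \<subseteq> X1 \<Longrightarrow> cayley_form1 [a, b, c, d] = Re (\<Omega>1 [a, b, c, d]) + \<omega> [a, b] * \<omega> [c, d]"
    "set [a, b, c, d] \<subseteq> X2 \<Longrightarrow> cayley_form2 [a, b, c, d] = Re (\<Omega>2 [a, b, c, d]) + \<omega> [a, b] * \<omega> [c, d]"
proof -
  have adz: "\<omega> [[a, b, c, d] ! i, [a, b, c, d] ! j] = 0" if "i < 4" "j < 4" "i div 2 \<noteq> j div 2" for i j
    using ad that unfolding adapted_def by simp
  have z: "\<omega> [a, c] = 0" "\<omega> [a, d] = 0" "\<omega> [b, c] = 0" "\<omega> [b, d] = 0"
    using adz[of 0 2] adz[of 0 3] adz[of 1 2] adz[of 1 3] by simp_all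
  show "set [a, b, c, d] \<subseteq> X1 \<Longrightarrow> cayley_form1 [a, b, c, d] = Re (\<Omega>1 [a, b, c, d]) + \<omega> [a, b] * \<omega> [c, d]"
    "set [a, b, c, d] \<subseteq> X2 \<Longrightarrow> cayley_form2 [a, b, c, d] = Re (\<Omega>2 [a, b, c, d]) + \<omega> [a, b] * \<omega> [c, d]"
    unfolding cayley_form1_def cayley_form2_def wedge_power_2_2[OF alt_form_\<omega>(2)] wedge_power_2_2[OF alt_form_\<omega>(3)]
    by (simp_all add: kaehler_restrict(1,2) z)
qed

lemma cayley_product:
  assumes "orthonormal_list [a, b, c, d]" "set [a, b, c, d] \<subseteq> X1" "cayley_form1 [a, b, c, d] = 1"
    and "orthonormal_list [a', b', c', d']" "set [a', b', c', d'] \<subseteq> X2" "cayley_form2 [a', b', c', d'] = 1"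
  shows "\<exists>\<xi>1 \<xi>2. cayley1 \<xi>1 \<and> cayley2 \<xi>2 \<and> simple_vector [a, b, c, d, a', b', c', d'] = vwedge \<xi>1 4 4 \<xi>2"
proof (intro exI conjI)
  show "cayley1 (simple_vector [a, b, c, d])" "cayley2 (simple_vector [a', b', c', d'])"
    unfolding cayley_iff using assms alt_form_cayley
    by (auto simp: simple_vector_apply[where n = 4] intro!: orthonormal_in_Grass)
  show "simple_vector [a, b, c, d, a', b', c', d'] = vwedge (simple_vector [a, b, c, d]) 4 4 (simple_vector [a', b', c', d'])"
    using vwedge_simple[of "[a, b, c, d]" "[a', b', c', d']"] by (simp add: numeral_eq_Suc)
qed

text \<open>A non-real \<open>A\<close> in the unit disc makes the triangle inequality strict unless
  one of the two terms vanishes. So c c' = 0 and |s s'| = 1, and equality in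
  \<open>unit_pairs\<close> gives |c| = |c'|. This separates special Lagrangian planes from products
  of Cayley planes.\<close>

lemma nonreal_phase:
  fixes c s c' s' :: real and A :: complex
  assumes u: "c\<^sup>2 + s\<^sup>2 = 1" "c'\<^sup>2 + s'\<^sup>2 = 1" and A: "norm A \<le> 1"
    and f: "norm (of_real (c * c') + of_real (s * s') * A) = 1"
    and im: "Im (of_real (c * c') + of_real (s * s') * A) \<noteq> 0"
  shows "c = 0 \<and> c' = 0"
proof -
  define p q where "p = c * c'" and "q = s * s'"
  have pq: "\<bar>p\<bar> + \<bar>q\<bar> \<le> 1" using unit_pairs(1)[OF u] unfolding p_def q_def .
  have q: "q \<noteq> 0" "Im A \<noteq> 0" using im unfolding p_def[symmetric] q_def[symmetric] by auto
  have "(norm A)\<^sup>2 \<le> 1" using A by (simp add: abs_square_le_1)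
  then have A2: "(Re A)\<^sup>2 + (Im A)\<^sup>2 \<le> 1" unfolding cmod_power2 .
  have "(p + q * Re A)\<^sup>2 + (q * Im A)\<^sup>2 = 1"
    using f cmod_power2[of "of_real p + of_real q * A"] unfolding p_def[symmetric] q_def[symmetric] by simp
  then have eq: "p\<^sup>2 + 2 * (p * q * Re A) + q\<^sup>2 * ((Re A)\<^sup>2 + (Im A)\<^sup>2) = 1"
    by (simp add: power2_sum power_mult_distrib algebra_simps)
  have "0 < (Im A)\<^sup>2" using q by simp
  then have "(Re A)\<^sup>2 < 1" using A2 by linarith
  then have re: "\<bar>Re A\<bar> < 1" by (simp add: abs_square_less_1)
  have "q\<^sup>2 * ((Re A)\<^sup>2 + (Im A)\<^sup>2) \<le> q\<^sup>2 * 1" by (rule mult_left_mono[OF A2]) simp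
  then have a: "1 \<le> p\<^sup>2 + 2 * (p * q * Re A) + q\<^sup>2" using eq by simp
  have b: "(\<bar>p\<bar> + \<bar>q\<bar>)\<^sup>2 \<le> 1" using pq by (simp add: abs_square_le_1)
  then have "p\<^sup>2 + 2 * (\<bar>p\<bar> * \<bar>q\<bar>) + q\<^sup>2 \<le> 1" by (simp add: power2_sum)
  then have "\<bar>p\<bar> * \<bar>q\<bar> \<le> p * q * Re A" using a by linarith
  also have "\<dots> \<le> \<bar>p * q * Re A\<bar>" by simp
  also have "\<dots> = \<bar>p\<bar> * \<bar>q\<bar> * \<bar>Re A\<bar>" by (simp add: abs_mult)
  finally have "\<bar>p\<bar> * \<bar>q\<bar> * (1 - \<bar>Re A\<bar>) \<le> 0" by (simp add: algebra_simps)
  then have "\<bar>p\<bar> * \<bar>q\<bar> \<le> 0" using re by (simp add: mult_le_0_iff)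
  then have p0: "p = 0" using q by (simp add: mult_le_0_iff)
  then have "1 \<le> q\<^sup>2" using a by simp
  then have "1 \<le> \<bar>q\<bar>" using abs_square_less_1[of q] by linarith
  then have "\<bar>c * c'\<bar> + \<bar>s * s'\<bar> = 1" using pq p0 unfolding p_def q_def by simp
  then have "\<bar>c\<bar> = \<bar>c'\<bar>" using unit_pairs(2)[OF u] by blast
  then show ?thesis using p0 unfolding p_def by auto
qed

lemma all_less_4: "(\<forall>i<4::nat. P i) \<longleftrightarrow> P 0 \<and> P 1 \<and> P 2 \<and> P 3"
proof -
  have "(\<forall>i<4::nat. P i) \<longleftrightarrow> (\<forall>i\<in>{..<4}. P i)" by (simp only: Ball_def lessThan_iff)
  then show ?thesis unfolding lessThan_small by simp
qed

text \<open>The sign on the last vector selects the orientation: a product of two planes determines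
  the orientations of its factors only up to a common sign.\<close>

lemma signed_plane_pairs:
  fixes \<sigma> :: real
  assumes e: "unitary_basis e" and d: "distinct [i, j, k, l]"
    and u: "c\<^sup>2 + s\<^sup>2 = 1" "c'\<^sup>2 + s'\<^sup>2 = 1" and \<sigma>: "\<sigma> = 1 \<or> \<sigma> = - 1"
  shows "orthonormal_list [e i, c *\<^sub>R (\<i> *s e i) + s *\<^sub>R e j, e k, \<sigma> *\<^sub>R (c' *\<^sub>R (\<i> *s e k) + s' *\<^sub>R e l)]"
    (is "orthonormal_list ?us")
    and "adapted \<omega> [e i, c *\<^sub>R (\<i> *s e i) + s *\<^sub>R e j, e k, \<sigma> *\<^sub>R (c' *\<^sub>R (\<i> *s e k) + s' *\<^sub>R e l)]"
    and "\<omega> [e i, c *\<^sub>R (\<i> *s e i) + s *\<^sub>R e j] = c"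
    and "\<omega> [e k, \<sigma> *\<^sub>R (c' *\<^sub>R (\<i> *s e k) + s' *\<^sub>R e l)] = \<sigma> * c'"
proof -
  have L: "length ?us = 4" by simp
  show "orthonormal_list ?us"
    unfolding orthonormal_list_def L all_less_4
    using u d \<sigma> by (auto simp: inner_eq_Re_herm unitary_basisD[OF e] power2_eq_square)
  show "adapted \<omega> ?us"
    unfolding adapted_def L all_less_4
    using d by (auto simp: \<omega>_eq_Im_herm unitary_basisD[OF e])
  show "\<omega> [e i, c *\<^sub>R (\<i> *s e i) + s *\<^sub>R e j] = c"
    "\<omega> [e k, \<sigma> *\<^sub>R (c' *\<^sub>R (\<i> *s e k) + s' *\<^sub>R e l)] = \<sigma> * c'"
    using d by (auto simp: \<omega>_eq_Im_herm unitary_basisD[OF e])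
qed

lemma frame_special_lagrangian:
  assumes e: "unitary_basis e"
    and u: "c1\<^sup>2 + s1\<^sup>2 = 1" "c2\<^sup>2 + s2\<^sup>2 = 1" "c3\<^sup>2 + s3\<^sup>2 = 1" "c4\<^sup>2 + s4\<^sup>2 = 1"
    and c: "c1 = 0" "c2 = 0" "c3 = 0" "c4 = 0"
    and \<Phi>: "\<Phi> (frame e c1 s1 c2 s2 c3 s3 c4 s4) = 1"
  shows "special_lagrangian (simple_vector (frame e c1 s1 c2 s2 c3 s3 c4 s4))"
proof -
  let ?F = "frame e c1 s1 c2 s2 c3 s3 c4 s4"
  have "Re (\<Omega>12 ?F) = 1"
    using \<Phi> \<Phi>_frame[OF e u] \<Omega>12_frame[of e c1 s1 c2 s2 c3 s3 c4 s4] c by simp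
  moreover have "simple_vector ?F \<in> Grass UNIV 8"
    by (rule orthonormal_in_Grass[OF frame_geometry(2)[OF e u]]) (simp_all add: length_frame)
  ultimately show ?thesis
    unfolding special_lagrangian_def calibrates_def \<Omega>12_def[symmetric]
    using simple_vector_apply[OF alt_form_\<Phi>(1) length_frame] by simp
qed

lemma sum_norm_4_le:
  fixes x :: C8
  assumes x: "herm x x = of_real t" and d: "distinct [i, j, k, l]"
  shows "(norm (x $ i))\<^sup>2 + (norm (x $ j))\<^sup>2 + (norm (x $ k))\<^sup>2 + (norm (x $ l))\<^sup>2 \<le> t"
proof -
  have "(\<Sum>b\<in>{i, j, k, l}. (norm (x $ b))\<^sup>2) \<le> (\<Sum>b\<in>UNIV. (norm (x $ b))\<^sup>2)"
    by (rule sum_mono2) auto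
  also have "complex_of_real (\<Sum>b\<in>UNIV. (norm (x $ b))\<^sup>2) = herm x x"
    unfolding herm_def of_real_sum complex_norm_square by (intro sum.cong refl mult.commute)
  then have "(\<Sum>b\<in>UNIV. (norm (x $ b))\<^sup>2) = t" unfolding x by (simp only: of_real_eq_iff)
  finally show ?thesis using d by (simp add: add.assoc)
qed

text \<open>For a split basis \<Phi> is the real part of f g, where the real parts of f and g are
  the Cayley values of the two factors. Both lie in the unit disc, so f g = 1. If f is not real, all
  cosines vanish; otherwise f = g = 1 or f = g = -1, and a common sign is moved into the two
  orientations.\<close>

lemma frame_product_split:
  assumes e: "unitary_basis e"
    and u: "c1\<^sup>2 + s1\<^sup>2 = 1" "c2\<^sup>2 + s2\<^sup>2 = 1" "c3\<^sup>2 + s3\<^sup>2 = 1" "c4\<^sup>2 + s4\<^sup>2 = 1"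
    and X: "e 1 \<in> X1" "e 2 \<in> X1" "e 3 \<in> X1" "e 4 \<in> X1" "e 5 \<in> X2" "e 6 \<in> X2" "e 7 \<in> X2" "e 8 \<in> X2"
    and \<Phi>: "\<Phi> (frame e c1 s1 c2 s2 c3 s3 c4 s4) = 1"
  shows "special_lagrangian (simple_vector (frame e c1 s1 c2 s2 c3 s3 c4 s4)) \<or>
    (\<exists>\<xi>1 \<xi>2. cayley1 \<xi>1 \<and> cayley2 \<xi>2 \<and> simple_vector (frame e c1 s1 c2 s2 c3 s3 c4 s4) = vwedge \<xi>1 4 4 \<xi>2)"
proof -
  let ?F = "frame e c1 s1 c2 s2 c3 s3 c4 s4"
  let ?A = "\<Omega>1 [e 1, e 2, e 3, e 4]" and ?D = "\<Omega>2 [e 5, e 6, e 7, e 8]"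
  have \<delta>: "\<Omega>12 [e 1, e 2, e 3, e 4, e 5, e 6, e 7, e 8] = ?A * ?D"
    using \<Omega>12_block[of "[e 1, e 2, e 3, e 4, e 5, e 6, e 7, e 8]"] X by (simp add: all_less_4)
  have z: "\<Omega>2 [e 1, e 2, e 3, e 4] = 0" "\<Omega>1 [e 5, e 6, e 7, e 8] = 0" "\<Omega>1 [e 1, e 2, e 5, e 6] = 0" "\<Omega>2 [e 1, e 2, e 5, e 6] = 0"
    "\<Omega>1 [e 1, e 2, e 7, e 8] = 0" "\<Omega>2 [e 1, e 2, e 7, e 8] = 0" "\<Omega>1 [e 3, e 4, e 5, e 6] = 0" "\<Omega>2 [e 3, e 4, e 5, e 6] = 0"
    "\<Omega>1 [e 3, e 4, e 7, e 8] = 0" "\<Omega>2 [e 3, e 4, e 7, e 8] = 0"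
    using X unfolding \<Omega>_eq_vol4 vol4_eq X1_def X2_def by simp_all
  define f where "f = of_real (c1 * c2) + of_real (s1 * s2) * ?A"
  define g where "g = of_real (c3 * c4) + of_real (s3 * s4) * ?D"
  have "norm ?A * norm ?D = 1"
    using norm_\<Omega>12_unitary[OF e] unfolding \<delta> by (simp add: norm_mult)
  have nle: "norm (vol4 i j k l [e a, e b, e c, e d]) \<le> 1" if "distinct [i, j, k, l]" for i j k l a b c d
  proof -
    have n: "(norm (e a $ i))\<^sup>2 + (norm (e a $ j))\<^sup>2 + (norm (e a $ k))\<^sup>2 + (norm (e a $ l))\<^sup>2 \<le> 1" for a
      by (rule sum_norm_4_le[OF _ that]) (simp add: unitary_basisD[OF e])
    have "(norm (vol4 i j k l [e a, e b, e c, e d]))\<^sup>2 \<le> 1 * 1 * (1 * 1)"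
      by (rule order_trans[OF vol4_hadamard]) (intro mult_mono n; simp)
    then show ?thesis by (simp add: abs_square_le_1)
  qed
  have A: "norm ?A \<le> 1" "norm ?D \<le> 1" unfolding \<Omega>_eq_vol4 by (rule nle; simp)+
  have fg: "norm f \<le> 1" "norm g \<le> 1"
  proof -
    have "norm (of_real (c * c') + of_real (s * s') * B) \<le> 1"
      if "c\<^sup>2 + s\<^sup>2 = 1" "c'\<^sup>2 + s'\<^sup>2 = 1" "norm B \<le> 1" for c s c' s' :: real and B :: complex
    proof -
      have "norm (of_real (c * c') + of_real (s * s') * B) \<le> norm (complex_of_real (c * c')) + norm (of_real (s * s') * B)"
        by (rule norm_triangle_ineq)
      also have "\<dots> \<le> \<bar>c * c'\<bar> + \<bar>s * s'\<bar> * 1"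
        unfolding norm_mult[of _ B] norm_of_real by (intro add_left_mono mult_left_mono that(3)) simp
      finally show ?thesis using unit_pairs(1)[OF that(1,2)] by simp
    qed
    then show "norm f \<le> 1" "norm g \<le> 1" unfolding f_def g_def using u A by blast+
  qed
  have "\<Phi> ?F = Re (f * g)"
    unfolding \<Phi>_frame[OF e u] \<delta> z f_def g_def by (simp add: algebra_simps)
  then have Re1: "Re (f * g) = 1" using \<Phi> by simp
  have "norm f * norm g \<le> norm f * 1" "norm f * norm g \<le> 1 * norm g"
    using fg by (intro mult_left_mono mult_right_mono; simp)+
  then have nfg: "norm f = 1" "norm g = 1" "norm (f * g) = 1"
    using complex_Re_le_cmod[of "f * g"] fg unfolding Re1 norm_mult by linarith+
  then have "Im (f * g) = 0" using cmod_power2[of "f * g"] unfolding Re1 by simp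
  then have fg1: "f * g = 1" using Re1 by (simp add: complex_eq_iff)
  show ?thesis
  proof (cases "Im f = 0")
    case False
    then have c12: "c1 = 0 \<and> c2 = 0" using nonreal_phase[OF u(1,2) A(1)] nfg(1) unfolding f_def by blast
    have "Im g \<noteq> 0"
    proof
      assume g0: "Im g = 0"
      have "Im (f * g) = Im f * Re g" using g0 by simp
      then have "Im f * Re g = 0" using \<open>Im (f * g) = 0\<close> by (simp only:)
      then have "Re g = 0" using False by simp
      then have "g = 0" using g0 by (simp add: complex_eq_iff)
      then show False using fg1 by simp
    qed
    then have "c3 = 0 \<and> c4 = 0" using nonreal_phase[OF u(3,4) A(2)] nfg(2) unfolding g_def by blast
    then show ?thesis using frame_special_lagrangian[OF e u _ _ _ _ \<Phi>] c12 by blast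
  next
    case True
    define \<sigma> where "\<sigma> = Re f"
    have f\<sigma>: "f = of_real \<sigma>" using True by (simp add: \<sigma>_def complex_eq_iff)
    have "\<bar>\<sigma>\<bar> = 1" using nfg(1) unfolding f\<sigma> by simp
    then have \<sigma>: "\<sigma> = 1 \<or> \<sigma> = - 1" by linarith
    have g\<sigma>: "g = of_real \<sigma>"
    proof -
      have "\<sigma> * \<sigma> = 1" using \<sigma> by auto
      then have "complex_of_real \<sigma> * (complex_of_real \<sigma> * g) = g"
        by (simp add: mult.assoc[symmetric] flip: of_real_mult)
      then show ?thesis using fg1 unfolding f\<sigma> by simp
    qed
    let ?u2 = "c1 *\<^sub>R (\<i> *s e 1) + s1 *\<^sub>R e 2" and ?u4 = "c2 *\<^sub>R (\<i> *s e 3) + s2 *\<^sub>R e 4"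
    let ?u6 = "c3 *\<^sub>R (\<i> *s e 5) + s3 *\<^sub>R e 6" and ?u8 = "c4 *\<^sub>R (\<i> *s e 7) + s4 *\<^sub>R e 8"
    let ?L1 = "[e 1, ?u2, e 3, \<sigma> *\<^sub>R ?u4]" and ?L2 = "[e 5, ?u6, e 7, \<sigma> *\<^sub>R ?u8]"
    have d: "distinct [1, 2, 3, 4 :: 8]" "distinct [5, 6, 7, 8 :: 8]" by simp_all
    have in1: "set ?L1 \<subseteq> X1" "set ?L2 \<subseteq> X2"
      using X by (auto intro!: subspace_add subspace_scale X1_subspace X2_subspace X1_scale X2_scale)
    have vol: "vol4 i j k l [a, x, b, \<sigma> *\<^sub>R y] = of_real \<sigma> * vol4 i j k l [a, x, b, y]" for i j k l a b x y
      using multilinD(2)[OF alt_formD(1)[OF alt_form_vol_pieces(3)], of "[a, x, b, y]" 3 i j k l "of_real \<sigma>" y]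
      unfolding scaleR_eq_of_real_scale by (simp add: numeral_3_eq_3)
    have v1: "\<Omega>1 [e 1, ?u2, e 3, ?u4] = of_real (s1 * s2) * ?A" "\<Omega>2 [e 5, ?u6, e 7, ?u8] = of_real (s3 * s4) * ?D"
      using vol4_plane_pair[of 1 2 3 4 "e 1" "e 2" c1 s1 "e 3" "e 4" c2 s2]
        vol4_plane_pair[of 5 6 7 8 "e 5" "e 6" c3 s3 "e 7" "e 8" c4 s4]
      unfolding \<Omega>_eq_vol4 plane_pair_def by simp_all
    have "cayley_form1 ?L1 = \<sigma> * Re f"
      using cayley_form_adapted(1)[OF signed_plane_pairs(2)[OF e d(1) u(1,2) \<sigma>] in1(1)]
        signed_plane_pairs(3,4)[OF e d(1) u(1,2) \<sigma>] v1(1)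
      unfolding \<Omega>_eq_vol4 vol f_def by (simp add: algebra_simps)
    then have C1: "cayley_form1 ?L1 = 1" using \<sigma> unfolding f\<sigma> by auto
    have "cayley_form2 ?L2 = \<sigma> * Re g"
      using cayley_form_adapted(2)[OF signed_plane_pairs(2)[OF e d(2) u(3,4) \<sigma>] in1(2)]
        signed_plane_pairs(3,4)[OF e d(2) u(3,4) \<sigma>] v1(2)
      unfolding \<Omega>_eq_vol4 vol g_def by (simp add: algebra_simps)
    then have C2: "cayley_form2 ?L2 = 1" using \<sigma> unfolding g\<sigma> by auto
    have "simple_vector ?F = simple_vector (?L1 @ ?L2)"
    proof (rule simple_vector_eqI)
      fix \<phi> :: "C8 list \<Rightarrow> real" assume \<phi>: "alt_form (*\<^sub>R) 8 \<phi>"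
      note M = multilinD(2)[OF alt_formD(1)[OF \<phi>]]
      have "\<phi> (?L1 @ ?L2) = \<sigma> * \<phi> [e 1, ?u2, e 3, ?u4, e 5, ?u6, e 7, \<sigma> *\<^sub>R ?u8]"
        using M[of "?L1 @ ?L2" 3 \<sigma> ?u4] by (simp add: numeral_eq_Suc)
      also have "\<phi> [e 1, ?u2, e 3, ?u4, e 5, ?u6, e 7, \<sigma> *\<^sub>R ?u8] = \<sigma> * \<phi> ?F"
        using M[of "[e 1, ?u2, e 3, ?u4, e 5, ?u6, e 7, \<sigma> *\<^sub>R ?u8]" 7 \<sigma> ?u8]
        by (simp add: numeral_eq_Suc frame_def plane_pair_def)
      finally show "\<phi> ?F = \<phi> (?L1 @ ?L2)" using \<sigma> by auto
    qed (simp_all add: length_frame)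
    then show ?thesis
      using cayley_product[OF signed_plane_pairs(1)[OF e d(1) u(1,2) \<sigma>] in1(1) C1
          signed_plane_pairs(1)[OF e d(2) u(3,4) \<sigma>] in1(2) C2] by simp
  qed
qed

lemma antisym_pair_rearrange:
  assumes "antisym_form 8 \<psi>"
  shows "\<psi> [x, y, g, h, a, b, c, d] = \<psi> [a, b, c, d, x, y, g, h]"
    "\<psi> [a, b, g, h, x, y, c, d] = \<psi> [a, b, c, d, x, y, g, h]"
  using antisym_pair_swap[OF assms] by metis+

lemma unitary_basis_compose:
  assumes "unitary_basis e" "inj \<pi>"
  shows "unitary_basis (\<lambda>i. e (\<pi> i))"
  using assms unfolding unitary_basis_def by (simp add: inj_eq)

text \<open>By Jacobi, \<open>\<Omega>2\<close> on one quadruple has the modulus of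
  \<open>\<Omega>1\<close> on the other, so the dichotomy applies to each quadruple. Both cannot lie
  in the same \<open>X1\<close> or \<open>X2\<close>, since then all the volumes involved would
  vanish.\<close>

lemma frame_product_case:
  assumes e: "unitary_basis e"
    and u: "c1\<^sup>2 + s1\<^sup>2 = 1" "c2\<^sup>2 + s2\<^sup>2 = 1" "c3\<^sup>2 + s3\<^sup>2 = 1" "c4\<^sup>2 + s4\<^sup>2 = 1"
    and big: "1 \<le> norm (\<Omega>1 [e 1, e 2, e 3, e 4]) + norm (\<Omega>1 [e 5, e 6, e 7, e 8])"
    and \<Phi>: "\<Phi> (frame e c1 s1 c2 s2 c3 s3 c4 s4) = 1"
  shows "special_lagrangian (simple_vector (frame e c1 s1 c2 s2 c3 s3 c4 s4)) \<or>
    (\<exists>\<xi>1 \<xi>2. cayley1 \<xi>1 \<and> cayley2 \<xi>2 \<and> simple_vector (frame e c1 s1 c2 s2 c3 s3 c4 s4) = vwedge \<xi>1 4 4 \<xi>2)"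
proof -
  let ?F = "frame e c1 s1 c2 s2 c3 s3 c4 s4"
  let ?A = "\<Omega>1 [e 1, e 2, e 3, e 4]" and ?A' = "\<Omega>1 [e 5, e 6, e 7, e 8]"
  let ?D = "\<Omega>2 [e 1, e 2, e 3, e 4]" and ?D' = "\<Omega>2 [e 5, e 6, e 7, e 8]"
  have D: "norm ?D = norm ?A'" "norm ?D' = norm ?A"
    using unitary_pair_minors(1,2)[OF e] norm_\<Omega>12_unitary[OF e] by (simp_all add: norm_mult)
  have ee: "herm (e i) (e i) = 1" for i by (simp add: unitary_basisD[OF e])
  note dich = X_dichotomy[OF ee ee ee ee]
  have 1: "(e 1 \<in> X1 \<and> e 2 \<in> X1 \<and> e 3 \<in> X1 \<and> e 4 \<in> X1) \<or> (e 1 \<in> X2 \<and> e 2 \<in> X2 \<and> e 3 \<in> X2 \<and> e 4 \<in> X2)"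
    by (rule dich) (use big D in simp)
  have 2: "(e 5 \<in> X1 \<and> e 6 \<in> X1 \<and> e 7 \<in> X1 \<and> e 8 \<in> X1) \<or> (e 5 \<in> X2 \<and> e 6 \<in> X2 \<and> e 7 \<in> X2 \<and> e 8 \<in> X2)"
    by (rule dich) (use big D in simp)
  have v1: "\<Omega>2 [a, b, c, d] = 0" if "a \<in> X1" for a b c d by (rule \<Omega>_vanish(2)[of a]) (use that in auto)
  have v2: "\<Omega>1 [a, b, c, d] = 0" if "a \<in> X2" for a b c d by (rule \<Omega>_vanish(1)[of a]) (use that in auto)
  have no1: "\<not> (e 1 \<in> X1 \<and> e 5 \<in> X1)" using big D v1 by fastforce
  have no2: "\<not> (e 1 \<in> X2 \<and> e 5 \<in> X2)" using big v2 by fastforce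
  show ?thesis
  proof (cases "e 1 \<in> X1")
    case True
    then have "e 1 \<in> X1" "e 2 \<in> X1" "e 3 \<in> X1" "e 4 \<in> X1" "e 5 \<in> X2" "e 6 \<in> X2" "e 7 \<in> X2" "e 8 \<in> X2"
    proof -
      have "e 5 \<in> X2" using True 2 no1 by blast
      moreover have "e 1 \<notin> X2" using no2 calculation by blast
      ultimately show "e 1 \<in> X1" "e 2 \<in> X1" "e 3 \<in> X1" "e 4 \<in> X1" "e 5 \<in> X2" "e 6 \<in> X2" "e 7 \<in> X2" "e 8 \<in> X2"
        using True 1 2 no1 by blast+
    qed
    then show ?thesis using frame_product_split[OF e u _ _ _ _ _ _ _ _ \<Phi>] by blast
  next
    case False
    then have X: "e 1 \<in> X2" "e 2 \<in> X2" "e 3 \<in> X2" "e 4 \<in> X2" "e 5 \<in> X1" "e 6 \<in> X1" "e 7 \<in> X1" "e 8 \<in> X1"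
      using 1 2 no2 by blast+
    \<comment> \<open>Addition in the index type is modulo 8, so this exchanges the two halves of
      the basis.\<close>
    define \<pi> :: "8 \<Rightarrow> 8" where "\<pi> i = i + 4" for i
    have "inj \<pi>" by (auto simp: \<pi>_def inj_on_def)
    then have e': "unitary_basis (\<lambda>i. e (\<pi> i))" by (rule unitary_basis_compose[OF e])
    have \<pi>: "\<pi> 1 = 5" "\<pi> 2 = 6" "\<pi> 3 = 7" "\<pi> 4 = 8" "\<pi> 5 = 1" "\<pi> 6 = 2" "\<pi> 7 = 3" "\<pi> 8 = 4"
      by (simp_all add: \<pi>_def)
    let ?F' = "frame (\<lambda>i. e (\<pi> i)) c3 s3 c4 s4 c1 s1 c2 s2"
    have eq: "\<phi> ?F = \<phi> ?F'" if "alt_form (*\<^sub>R) 8 \<phi>" for \<phi>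
      using antisym_pair_rearrange(1)[OF alt_form_antisym[OF that]]
      by (simp add: frame_def plane_pair_def \<pi>)
    have sv: "simple_vector ?F = simple_vector ?F'"
      by (rule simple_vector_eqI[OF _ _ eq]) (simp_all add: length_frame)
    show ?thesis
      unfolding sv by (rule frame_product_split[OF e' u(3,4,1,2)]) (use X eq[OF alt_form_\<Phi>(5)] \<Phi> in \<open>simp_all add: \<pi>\<close>)
  qed
qed

text \<open>Exchanging plane 2 with plane 3, or with plane 4, is an even permutation of the eight
  vectors and turns the other two pairings into the first.\<close>

lemma frame_pairing_case:
  assumes e: "unitary_basis e"
    and u: "c1\<^sup>2 + s1\<^sup>2 = 1" "c2\<^sup>2 + s2\<^sup>2 = 1" "c3\<^sup>2 + s3\<^sup>2 = 1" "c4\<^sup>2 + s4\<^sup>2 = 1"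
    and big: "1 \<le> norm (\<Omega>1 [e 1, e 2, e 3, e 4]) + norm (\<Omega>1 [e 5, e 6, e 7, e 8])
      \<or> 1 \<le> norm (\<Omega>1 [e 1, e 2, e 5, e 6]) + norm (\<Omega>1 [e 3, e 4, e 7, e 8])
      \<or> 1 \<le> norm (\<Omega>1 [e 1, e 2, e 7, e 8]) + norm (\<Omega>1 [e 3, e 4, e 5, e 6])"
    and \<Phi>: "\<Phi> (frame e c1 s1 c2 s2 c3 s3 c4 s4) = 1"
  shows "special_lagrangian (simple_vector (frame e c1 s1 c2 s2 c3 s3 c4 s4)) \<or>
    (\<exists>\<xi>1 \<xi>2. cayley1 \<xi>1 \<and> cayley2 \<xi>2 \<and> simple_vector (frame e c1 s1 c2 s2 c3 s3 c4 s4) = vwedge \<xi>1 4 4 \<xi>2)"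
  using big
proof (elim disjE)
  let ?F = "frame e c1 s1 c2 s2 c3 s3 c4 s4"
  assume big: "1 \<le> norm (\<Omega>1 [e 1, e 2, e 5, e 6]) + norm (\<Omega>1 [e 3, e 4, e 7, e 8])"
  define \<pi> :: "8 \<Rightarrow> 8" where "\<pi> i = (if i = 3 then 5 else if i = 4 then 6 else if i = 5 then 3 else if i = 6 then 4 else i)" for i
  have "inj \<pi>" unfolding inj_on_def \<pi>_def by simp
  then have e': "unitary_basis (\<lambda>i. e (\<pi> i))" by (rule unitary_basis_compose[OF e])
  let ?F' = "frame (\<lambda>i. e (\<pi> i)) c1 s1 c3 s3 c2 s2 c4 s4"
  have eq: "\<phi> ?F = \<phi> ?F'" if "alt_form (*\<^sub>R) 8 \<phi>" for \<phi>
    using antisym_pair_swap(2)[OF alt_form_antisym[OF that]]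
    by (simp add: frame_def plane_pair_def \<pi>_def)
  have sv: "simple_vector ?F = simple_vector ?F'"
    by (rule simple_vector_eqI[OF _ _ eq]) (simp_all add: length_frame)
  show ?thesis
    unfolding sv by (rule frame_product_case[OF e' u(1,3,2,4)]) (use big eq[OF alt_form_\<Phi>(5)] \<Phi> in \<open>simp_all add: \<pi>_def\<close>)
next
  let ?F = "frame e c1 s1 c2 s2 c3 s3 c4 s4"
  assume big: "1 \<le> norm (\<Omega>1 [e 1, e 2, e 7, e 8]) + norm (\<Omega>1 [e 3, e 4, e 5, e 6])"
  define \<pi> :: "8 \<Rightarrow> 8" where "\<pi> i = (if i = 3 then 7 else if i = 4 then 8 else if i = 7 then 3 else if i = 8 then 4 else i)" for i
  have "inj \<pi>" unfolding inj_on_def \<pi>_def by simp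
  then have e': "unitary_basis (\<lambda>i. e (\<pi> i))" by (rule unitary_basis_compose[OF e])
  let ?F' = "frame (\<lambda>i. e (\<pi> i)) c1 s1 c4 s4 c3 s3 c2 s2"
  have eq: "\<phi> ?F = \<phi> ?F'" if "alt_form (*\<^sub>R) 8 \<phi>" for \<phi>
    using antisym_pair_rearrange(2)[OF alt_form_antisym[OF that]]
    by (simp add: frame_def plane_pair_def \<pi>_def)
  have sv: "simple_vector ?F = simple_vector ?F'"
    by (rule simple_vector_eqI[OF _ _ eq]) (simp_all add: length_frame)
  have "\<Omega>1 [e 5, e 6, e 3, e 4] = \<Omega>1 [e 3, e 4, e 5, e 6]" unfolding \<Omega>_eq_vol4 by (rule vol4_swap)
  then show ?thesis
    unfolding sv by (intro frame_product_case[OF e' u(1,4,3,2)]) (use big eq[OF alt_form_\<Phi>(5)] \<Phi> in \<open>simp_all add: \<pi>_def\<close>)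
next
  assume "1 \<le> norm (\<Omega>1 [e 1, e 2, e 3, e 4]) + norm (\<Omega>1 [e 5, e 6, e 7, e 8])"
  then show ?thesis by (rule frame_product_case[OF e u _ \<Phi>])
qed

section \<open>Symplectic matrices\<close>


definition J4 :: "complex ^ 4 ^ 4" where
  "J4 = (\<chi> i j. if (i, j) \<in> {(1, 2), (3, 4)} then 1 else if (j, i) \<in> {(1, 2), (3, 4)} then - 1 else 0)"

abbreviation tr :: "complex ^ 'n ^ 'm \<Rightarrow> complex ^ 'm ^ 'n" where
  "tr \<equiv> Finite_Cartesian_Product.transpose"

lemma block_diag_mult: "block_diag A B ** block_diag C D = block_diag (A ** C) (B ** D)"
  by (simp add: vec_eq_iff forall_8 matrix_matrix_mult_def sum_8 sum_4 block_diag_def block_pos_def)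

lemma block_diag_transpose: "tr (block_diag A B) = block_diag (tr A) (tr B)"
  by (simp add: vec_eq_iff forall_8 block_diag_def block_pos_def Finite_Cartesian_Product.transpose_def)

lemma block_diag_adjoint: "adjoint_matrix (block_diag A B) = block_diag (adjoint_matrix A) (adjoint_matrix B)"
  by (simp add: vec_eq_iff forall_8 block_diag_def block_pos_def adjoint_matrix_def)

lemma block_diag_one: "block_diag (mat 1) (mat 1) = mat 1"
  by (simp add: vec_eq_iff forall_8 block_diag_def block_pos_def mat_def)

lemma J8_block: "J8 = block_diag J4 J4"
  by (simp add: vec_eq_iff forall_8 block_diag_def block_pos_def J8_def J4_def)

lemma unitary_block_diag:
  "unitary_matrix A \<Longrightarrow> unitary_matrix B \<Longrightarrow> unitary_matrix (block_diag A B)"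
  unfolding unitary_matrix_def block_diag_adjoint block_diag_mult by (simp add: block_diag_one)

lemma adjoint_mult: "adjoint_matrix (A ** B) = adjoint_matrix B ** adjoint_matrix (A :: complex ^ 'n ^ 'm)"
  by (simp add: vec_eq_iff adjoint_matrix_def matrix_matrix_mult_def mult.commute)

lemma adjoint_adjoint: "adjoint_matrix (adjoint_matrix A) = A"
  by (simp add: vec_eq_iff adjoint_matrix_def)

lemma unitary_matrix_mult:
  assumes "unitary_matrix A" "unitary_matrix B"
  shows "unitary_matrix (A ** B)"
proof -
  have "adjoint_matrix B ** adjoint_matrix A ** (A ** B) = adjoint_matrix B ** (adjoint_matrix A ** A) ** B"
    "A ** B ** (adjoint_matrix B ** adjoint_matrix A) = A ** (B ** adjoint_matrix B) ** adjoint_matrix A"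
    by (simp_all only: matrix_mul_assoc)
  then show ?thesis using assms unfolding unitary_matrix_def adjoint_mult by simp
qed

lemma unitary_matrix_adjoint: "unitary_matrix A \<Longrightarrow> unitary_matrix (adjoint_matrix A)"
  unfolding unitary_matrix_def adjoint_adjoint by blast

lemma unitary_transpose:
  assumes "unitary_matrix B"
  shows "tr B ** tr (adjoint_matrix B) = mat 1"
proof -
  have "tr (adjoint_matrix B ** B) = mat 1"
    using assms unfolding unitary_matrix_def by (simp add: transpose_mat)
  then show ?thesis by (simp only: matrix_transpose_mul)
qed

lemma J8_square: "J8 ** J8 = - mat 1"
  by (simp add: vec_eq_iff forall_8 matrix_matrix_mult_def sum_8 J8_def mat_def)

text \<open>\<open>J8\<close> squares to -1, so the hypothesis exhibits
  \<open>J8 ** tr S ** (- J8)\<close> as a right inverse of the square matrix \<open>S\<close>,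
  hence as a left inverse.\<close>

lemma symplectic_transpose:
  fixes S :: "complex ^ 8 ^ 8"
  assumes "S ** J8 ** tr S = J8"
  shows "tr S ** J8 ** S = J8"
proof -
  have neg: "A ** (- B) = - (A ** B)" "(- A) ** B = - (A ** B)" for A B :: "complex ^ 8 ^ 8"
    by (simp_all add: vec_eq_iff matrix_matrix_mult_def sum_negf)
  have "S ** (J8 ** tr S ** (- J8)) = (S ** J8 ** tr S) ** (- J8)" by (simp only: matrix_mul_assoc)
  also have "\<dots> = mat 1" unfolding assms neg J8_square by simp
  finally have "(J8 ** tr S ** (- J8)) ** S = mat 1" by (simp only: matrix_left_right_inverse)
  then have "J8 ** ((J8 ** tr S ** (- J8)) ** S) = J8" by simp
  then have "(J8 ** J8) ** (tr S ** (- J8) ** S) = J8" by (simp only: matrix_mul_assoc)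
  then show ?thesis unfolding J8_square neg by simp
qed

lemma skew_entry_matrix:
  "(matrix_of_columns e ** J8 ** tr (matrix_of_columns e)) $ a $ b = skew_entry 1 1 1 1 e a b"
  unfolding matrix_matrix_mult_def Finite_Cartesian_Product.transpose_def skew_entry_def minor2_def
  by (simp add: sum_8 J8_def matrix_of_columns_def)

lemma det_4:
  "det (A :: complex ^ 4 ^ 4) =
    A $ 1 $ 1 * (A $ 2 $ 2 * (A $ 3 $ 3 * A $ 4 $ 4 - A $ 3 $ 4 * A $ 4 $ 3)
      - A $ 2 $ 3 * (A $ 3 $ 2 * A $ 4 $ 4 - A $ 3 $ 4 * A $ 4 $ 2)
      + A $ 2 $ 4 * (A $ 3 $ 2 * A $ 4 $ 3 - A $ 3 $ 3 * A $ 4 $ 2))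
  - A $ 1 $ 2 * (A $ 2 $ 1 * (A $ 3 $ 3 * A $ 4 $ 4 - A $ 3 $ 4 * A $ 4 $ 3)
      - A $ 2 $ 3 * (A $ 3 $ 1 * A $ 4 $ 4 - A $ 3 $ 4 * A $ 4 $ 1)
      + A $ 2 $ 4 * (A $ 3 $ 1 * A $ 4 $ 3 - A $ 3 $ 3 * A $ 4 $ 1))
  + A $ 1 $ 3 * (A $ 2 $ 1 * (A $ 3 $ 2 * A $ 4 $ 4 - A $ 3 $ 4 * A $ 4 $ 2)
      - A $ 2 $ 2 * (A $ 3 $ 1 * A $ 4 $ 4 - A $ 3 $ 4 * A $ 4 $ 1)
      + A $ 2 $ 4 * (A $ 3 $ 1 * A $ 4 $ 2 - A $ 3 $ 2 * A $ 4 $ 1))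
  - A $ 1 $ 4 * (A $ 2 $ 1 * (A $ 3 $ 2 * A $ 4 $ 3 - A $ 3 $ 3 * A $ 4 $ 2)
      - A $ 2 $ 2 * (A $ 3 $ 1 * A $ 4 $ 3 - A $ 3 $ 3 * A $ 4 $ 1)
      + A $ 2 $ 3 * (A $ 3 $ 1 * A $ 4 $ 2 - A $ 3 $ 2 * A $ 4 $ 1))"
proof -
  have f1234: "finite {2, 3, 4 :: 4}" "1 \<notin> {2, 3, 4 :: 4}" by auto
  have f234: "finite {3, 4 :: 4}" "2 \<notin> {3, 4 :: 4}" by auto
  have f34: "finite {4 :: 4}" "3 \<notin> {4 :: 4}" by auto
  show ?thesis
    unfolding det_def UNIV_4
    unfolding sum_over_permutations_insert[OF f1234]
    unfolding sum_over_permutations_insert[OF f234]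
    unfolding sum_over_permutations_insert[OF f34]
    unfolding permutes_sing
    by (simp add: sign_swap_id permutation_swap_id permutation_compose sign_compose sign_id swap_id_eq)
      (simp add: algebra_simps)
qed

text \<open>The classical rule that congruence by \<open>U\<close> multiplies the Pfaffian by the
  determinant of \<open>U\<close>; the Pfaffian of \<open>J4\<close> is 1.\<close>

lemma pfaffian_congruence:
  fixes U :: "complex ^ 4 ^ 4"
  defines "X \<equiv> U ** J4 ** tr U"
  shows "X $ 1 $ 2 * X $ 3 $ 4 - X $ 1 $ 3 * X $ 2 $ 4 + X $ 1 $ 4 * X $ 2 $ 3 = det U"
proof -
  have X: "X $ a $ b = U $ a $ 1 * U $ b $ 2 - U $ a $ 2 * U $ b $ 1 + (U $ a $ 3 * U $ b $ 4 - U $ a $ 4 * U $ b $ 3)" for a b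
    unfolding X_def by (simp add: matrix_matrix_mult_def Finite_Cartesian_Product.transpose_def sum_4 J4_def)
  show ?thesis unfolding X det_4 by (simp add: algebra_simps)
qed

text \<open>
  The first row \<open>v = (p, q, r)\<close> determines a unitary skew matrix of Pfaffian 1; it is
  \<open>U J4 U\<^sup>T\<close> for \<open>U = 1 \<oplus> (v, g, h)\<close>, where \<open>g\<close> is a unit vector orthogonal to \<open>v\<close> and
  \<open>h\<close> is the conjugate of the cross product of \<open>v\<close> and \<open>g\<close>.
\<close>

lemma unitary_skew_factor:
  fixes X :: "complex ^ 4 ^ 4"
  assumes skew: "\<And>a b. X $ b $ a = - X $ a $ b"
    and X: "X $ 3 $ 4 = cnj (X $ 1 $ 2)" "X $ 2 $ 4 = - cnj (X $ 1 $ 3)" "X $ 2 $ 3 = cnj (X $ 1 $ 4)"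
    and n: "(norm (X $ 1 $ 2))\<^sup>2 + (norm (X $ 1 $ 3))\<^sup>2 + (norm (X $ 1 $ 4))\<^sup>2 = 1"
  shows "\<exists>U\<in>SU4. U ** J4 ** tr U = X"
proof -
  define p q r where "p = X $ 1 $ 2" and "q = X $ 1 $ 3" and "r = X $ 1 $ 4"
  have pqr: "p * cnj p + q * cnj q + r * cnj r = 1"
    using arg_cong[OF n, of complex_of_real] unfolding of_real_add complex_norm_square p_def q_def r_def by simp
  \<comment> \<open>The vector (-cnj q, cnj p, 0) is orthogonal to (p, q, r) and can be normalized
    unless p = q = 0, when (1, 0, 0) serves.\<close>
  obtain g1 g2 g3 where g: "g1 * cnj g1 + g2 * cnj g2 + g3 * cnj g3 = 1" "cnj p * g1 + cnj q * g2 + cnj r * g3 = 0"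
  proof (cases "p = 0 \<and> q = 0")
    case True
    then show ?thesis using that[of 1 0 0] by simp
  next
    case False
    define t where "t = sqrt ((norm p)\<^sup>2 + (norm q)\<^sup>2)"
    have "0 < (norm p)\<^sup>2 + (norm q)\<^sup>2" using False by (simp add: sum_power2_gt_zero_iff)
    then have t: "t \<noteq> 0" "t * t = (norm p)\<^sup>2 + (norm q)\<^sup>2" using False by (auto simp: t_def)
    have tt: "complex_of_real t * complex_of_real t = p * cnj p + q * cnj q"
      using arg_cong[OF t(2), of complex_of_real] unfolding of_real_add of_real_mult complex_norm_square .
    have "- cnj q / of_real t * cnj (- cnj q / of_real t) + cnj p / of_real t * cnj (cnj p / of_real t) + 0 * cnj 0
        = (p * cnj p + q * cnj q) / (of_real t * of_real t)"
      by (simp add: add_divide_distrib mult.commute)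
    also have "\<dots> = 1" unfolding tt[symmetric] using t(1) by simp
    finally show ?thesis using that[of "- cnj q / of_real t" "cnj p / of_real t" 0] by (simp add: mult.commute)
  qed
  have g': "p * cnj g1 + q * cnj g2 + r * cnj g3 = 0"
    using arg_cong[OF g(2), of cnj] by simp
  define h1 h2 h3 where "h1 = cnj q * cnj g3 - cnj r * cnj g2" and "h2 = cnj r * cnj g1 - cnj p * cnj g3"
    and "h3 = cnj p * cnj g2 - cnj q * cnj g1"
  define U :: "complex ^ 4 ^ 4" where
    "U = (\<chi> i j. if i = 1 then (if j = 1 then 1 else 0)
      else if i = 2 then (if j = 1 then 0 else if j = 2 then p else if j = 3 then g1 else h1)
      else if i = 3 then (if j = 1 then 0 else if j = 2 then q else if j = 3 then g2 else h2)
      else (if j = 1 then 0 else if j = 2 then r else if j = 3 then g3 else h3))"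
  have U: "U $ 1 $ 1 = 1" "U $ 1 $ 2 = 0" "U $ 1 $ 3 = 0" "U $ 1 $ 4 = 0"
    "U $ 2 $ 1 = 0" "U $ 2 $ 2 = p" "U $ 2 $ 3 = g1" "U $ 2 $ 4 = h1"
    "U $ 3 $ 1 = 0" "U $ 3 $ 2 = q" "U $ 3 $ 3 = g2" "U $ 3 $ 4 = h2"
    "U $ 4 $ 1 = 0" "U $ 4 $ 2 = r" "U $ 4 $ 3 = g3" "U $ 4 $ 4 = h3"
    by (simp_all add: U_def)
  have hh: "h1 * cnj h1 + h2 * cnj h2 + h3 * cnj h3 = 1"
    unfolding h1_def h2_def h3_def complex_cnj_diff complex_cnj_mult complex_cnj_cnj
    using pqr g g' by algebra
  have ph: "cnj p * h1 + cnj q * h2 + cnj r * h3 = 0" "cnj g1 * h1 + cnj g2 * h2 + cnj g3 * h3 = 0"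
    unfolding h1_def h2_def h3_def by (simp_all add: algebra_simps)
  have ph': "p * cnj h1 + q * cnj h2 + r * cnj h3 = 0" "g1 * cnj h1 + g2 * cnj h2 + g3 * cnj h3 = 0"
    using arg_cong[OF ph(1), of cnj] arg_cong[OF ph(2), of cnj] by simp_all
  have "adjoint_matrix U ** U = mat 1"
    using pqr g g' hh ph ph'
    by (simp add: vec_eq_iff forall_4 adjoint_matrix_def matrix_matrix_mult_def sum_4 U mat_def ac_simps)
  then have un: "unitary_matrix U" unfolding unitary_matrix_def using matrix_left_right_inverse by blast
  have gh: "g1 * h2 - h1 * g2 = cnj r" "g1 * h3 - h1 * g3 = - cnj q" "g2 * h3 - h2 * g3 = cnj p"
    unfolding h1_def h2_def h3_def using g by algebra+
  have Xd: "X $ a $ a = 0" for a using skew[of a a] by simp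
  have Xu: "X $ 1 $ 2 = p" "X $ 1 $ 3 = q" "X $ 1 $ 4 = r" "X $ 2 $ 3 = cnj r" "X $ 2 $ 4 = - cnj q" "X $ 3 $ 4 = cnj p"
    using X by (simp_all add: p_def q_def r_def)
  have XX: "U ** J4 ** tr U = X"
    using gh Xu Xd skew[of 2 1] skew[of 3 1] skew[of 4 1] skew[of 3 2] skew[of 4 2] skew[of 4 3]
    by (simp add: vec_eq_iff forall_4 matrix_matrix_mult_def Finite_Cartesian_Product.transpose_def sum_4 J4_def U algebra_simps)
  \<comment> \<open>The determinant is the Pfaffian of \<open>X\<close>, which by the given entries
    is |p|^2 + |q|^2 + |r|^2.\<close>
  have "det U = 1"
    using pfaffian_congruence[of U] pqr unfolding XX Xu by (simp add: algebra_simps)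
  then show ?thesis using un XX unfolding SU4_def by blast
qed


text \<open>The basis matrix and \<open>M\<close> carry \<open>J8\<close> to the same skew matrix by
  congruence, so the inverse of \<open>M\<close> times the basis matrix preserves
  \<open>J8\<close>.\<close>

lemma symplectic_frame:
  assumes e: "unitary_basis e"
    and V: "pair_volumes 1 1 1 1 e \<Omega>1 = 1" "pair_volumes 1 1 1 1 e \<Omega>2 = 1"
  shows "\<exists>U1 U2 S. S \<in> Sp4 \<and> U1 \<in> SU4 \<and> U2 \<in> SU4 \<and> matrix_of_columns e = block_diag U1 U2 ** S"
proof -
  let ?E = "matrix_of_columns e" and ?x = "skew_entry 1 1 1 1 e"
  let ?K = "?E ** J8 ** tr ?E"
  have sk: "?x b a = - ?x a b" for a b by (rule skew_entry_antisym)
  have dg: "?x a a = 0" for a using sk[of a a] by simp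
  have p1: "?x 3 4 = cnj (?x 1 2) \<and> ?x 2 4 = - cnj (?x 1 3) \<and> ?x 2 3 = cnj (?x 1 4) \<and>
      (norm (?x 1 2))\<^sup>2 + (norm (?x 1 3))\<^sup>2 + (norm (?x 1 4))\<^sup>2 = 1"
    by (rule pair_volumes_bound(2)[OF e _ _ _ _ _ V(1)[unfolded \<Omega>_eq_vol4]]) simp_all
  have p2: "?x 7 8 = cnj (?x 5 6) \<and> ?x 6 8 = - cnj (?x 5 7) \<and> ?x 6 7 = cnj (?x 5 8) \<and>
      (norm (?x 5 6))\<^sup>2 + (norm (?x 5 7))\<^sup>2 + (norm (?x 5 8))\<^sup>2 = 1"
    by (rule pair_volumes_bound(2)[OF e _ _ _ _ _ V(2)[unfolded \<Omega>_eq_vol4]]) simp_all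
  define A :: "complex ^ 4 ^ 4" where "A = (\<chi> i j. ?x (if i = 1 then 1 else if i = 2 then 2 else if i = 3 then 3 else 4)
    (if j = 1 then 1 else if j = 2 then 2 else if j = 3 then 3 else 4))"
  define B :: "complex ^ 4 ^ 4" where "B = (\<chi> i j. ?x (if i = 1 then 5 else if i = 2 then 6 else if i = 3 then 7 else 8)
    (if j = 1 then 5 else if j = 2 then 6 else if j = 3 then 7 else 8))"
  have "\<exists>U\<in>SU4. U ** J4 ** tr U = A"
  proof (rule unitary_skew_factor)
    show "A $ b $ a = - A $ a $ b" for a b unfolding A_def vec_lambda_beta by (rule sk)
  qed (use p1 in \<open>simp_all add: A_def\<close>)
  then obtain U1 where U1: "U1 \<in> SU4" "U1 ** J4 ** tr U1 = A" by blast
  have "\<exists>U\<in>SU4. U ** J4 ** tr U = B"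
  proof (rule unitary_skew_factor)
    show "B $ b $ a = - B $ a $ b" for a b unfolding B_def vec_lambda_beta by (rule sk)
  qed (use p2 in \<open>simp_all add: B_def\<close>)
  then obtain U2 where U2: "U2 \<in> SU4" "U2 ** J4 ** tr U2 = B" by blast
  have row: "(\<Sum>b\<in>UNIV. (norm (?x a b))\<^sup>2) = 1" for a
    by (rule skew_entry_row_norm[OF e]) simp_all
  have nsk: "(norm (?x 2 1))\<^sup>2 = (norm (?x 1 2))\<^sup>2" "(norm (?x 3 1))\<^sup>2 = (norm (?x 1 3))\<^sup>2" "(norm (?x 4 1))\<^sup>2 = (norm (?x 1 4))\<^sup>2"
    "(norm (?x 3 2))\<^sup>2 = (norm (?x 2 3))\<^sup>2" "(norm (?x 4 2))\<^sup>2 = (norm (?x 2 4))\<^sup>2" "(norm (?x 4 3))\<^sup>2 = (norm (?x 3 4))\<^sup>2"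
    using sk[of 2 1] sk[of 3 1] sk[of 4 1] sk[of 3 2] sk[of 4 2] sk[of 4 3] by simp_all
  have np: "norm (?x 3 4) = norm (?x 1 2)" "norm (?x 2 4) = norm (?x 1 3)" "norm (?x 2 3) = norm (?x 1 4)"
    using p1 by simp_all
  \<comment> \<open>Every row of the skew matrix has norm 1, and its part inside the diagonal block
    already has norm 1.\<close>
  have zero: "?x a b = 0" if "a \<in> {1, 2, 3, 4}" "b \<in> {5, 6, 7, 8}" for a b
  proof -
    have "(norm (?x a 5))\<^sup>2 + (norm (?x a 6))\<^sup>2 + (norm (?x a 7))\<^sup>2 + (norm (?x a 8))\<^sup>2 = 0"
      using row[of a, unfolded sum_8] that(1) p1 nsk dg unfolding np by auto
    then have "norm (?x a 5) = 0 \<and> norm (?x a 6) = 0 \<and> norm (?x a 7) = 0 \<and> norm (?x a 8) = 0"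
      by (simp add: add_nonneg_eq_0_iff)
    then show ?thesis using that(2) by auto
  qed
  have zero': "?x b a = 0" if "a \<in> {1, 2, 3, 4}" "b \<in> {5, 6, 7, 8}" for a b
    using zero[OF that] sk[of b a] by simp
  have K: "?K = block_diag A B"
    unfolding vec_eq_iff skew_entry_matrix forall_8
    by (simp add: block_diag_def block_pos_def A_def B_def zero zero')
  define M where "M = block_diag U1 U2"
  have un: "unitary_matrix U1" "unitary_matrix U2" using U1(1) U2(1) unfolding SU4_def by blast+
  have M: "unitary_matrix M" unfolding M_def by (rule unitary_block_diag[OF un])
  have E: "unitary_matrix ?E" using e unitary_matrix_of_columns by blast
  have MM: "adjoint_matrix M ** M = mat 1" "M ** adjoint_matrix M = mat 1"
    using M unfolding unitary_matrix_def by blast+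
  have KM: "?K = M ** J8 ** tr M"
    unfolding K unfolding M_def J8_block block_diag_transpose block_diag_mult U1(2) U2(2) ..
  define S where "S = adjoint_matrix M ** ?E"
  have "S ** J8 ** tr S = adjoint_matrix M ** ?K ** tr (adjoint_matrix M)"
    unfolding S_def matrix_transpose_mul by (simp only: matrix_mul_assoc)
  also have "\<dots> = (adjoint_matrix M ** M) ** J8 ** (tr M ** tr (adjoint_matrix M))"
    unfolding KM by (simp only: matrix_mul_assoc)
  also have "\<dots> = J8" unfolding MM unitary_transpose[OF M] by simp
  finally have "tr S ** J8 ** S = J8" by (rule symplectic_transpose)
  moreover have "unitary_matrix S"
    unfolding S_def by (rule unitary_matrix_mult[OF unitary_matrix_adjoint[OF M] E])
  ultimately have "S \<in> Sp4" unfolding Sp4_def by blast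
  moreover have "?E = M ** S" unfolding S_def matrix_mul_assoc MM by simp
  ultimately show ?thesis using U1(1) U2(1) unfolding M_def by blast
qed

text \<open>\<open>S\<close> preserves \<open>J8\<close> and drops out of the skew matrix. What
  remains is block diagonal, with Pfaffians \<open>det U1\<close> and \<open>det U2\<close>.\<close>

lemma symplectic_frame_volumes:
  assumes S: "S \<in> Sp4" and U: "U1 \<in> SU4" "U2 \<in> SU4"
    and E: "matrix_of_columns e = block_diag U1 U2 ** S"
  shows "pair_volumes 1 1 1 1 e \<Omega>1 = 1" "pair_volumes 1 1 1 1 e \<Omega>2 = 1"
proof -
  have tt: "tr (tr S) = S" by (simp add: vec_eq_iff Finite_Cartesian_Product.transpose_def)
  have "tr S ** J8 ** tr (tr S) = J8" using S unfolding Sp4_def tt by blast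
  from symplectic_transpose[OF this] have SJ: "S ** J8 ** tr S = J8" unfolding tt .
  let ?M = "block_diag U1 U2" and ?x = "skew_entry 1 1 1 1 e"
  have "matrix_of_columns e ** J8 ** tr (matrix_of_columns e) = ?M ** (S ** J8 ** tr S) ** tr ?M"
    unfolding E matrix_transpose_mul by (simp only: matrix_mul_assoc)
  also have "\<dots> = block_diag (U1 ** J4 ** tr U1) (U2 ** J4 ** tr U2)"
    unfolding SJ unfolding J8_block block_diag_transpose block_diag_mult ..
  finally have x: "?x a b = block_diag (U1 ** J4 ** tr U1) (U2 ** J4 ** tr U2) $ a $ b" for a b
    unfolding skew_entry_matrix[symmetric] by simp
  show "pair_volumes 1 1 1 1 e \<Omega>1 = 1" "pair_volumes 1 1 1 1 e \<Omega>2 = 1"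
    unfolding \<Omega>_eq_vol4 pair_volumes_pfaffian x
    using pfaffian_congruence[of U1] pfaffian_congruence[of U2] U
    by (simp_all add: block_diag_def block_pos_def SU4_def)
qed

text \<open>Summing Jacobi's identities relates the two pair volumes by \<delta>, so \<delta> = 1,
  and \<Phi> becomes the square of c^2 + s^2.\<close>

lemma equal_angles_calibrated:
  assumes e: "unitary_basis e" and u: "c\<^sup>2 + s\<^sup>2 = 1"
    and V: "pair_volumes 1 1 1 1 e \<Omega>1 = 1" "pair_volumes 1 1 1 1 e \<Omega>2 = 1"
  shows "\<Phi> (frame e c s c s c s c s) = 1"
proof -
  define \<delta> where "\<delta> = \<Omega>12 [e 1, e 2, e 3, e 4, e 5, e 6, e 7, e 8]"
  note D = unitary_pair_minors[OF e, folded \<delta>_def]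
  have "pair_volumes 1 1 1 1 e \<Omega>2 = \<delta> * cnj (pair_volumes 1 1 1 1 e \<Omega>1)"
    unfolding pair_volumes_def D by (simp add: algebra_simps)
  then have d: "\<delta> = 1" using V by simp
  have "\<Phi> (frame e c s c s c s c s) = s ^ 4 + c ^ 4 + s\<^sup>2 * c\<^sup>2 *
      Re (pair_volumes 1 1 1 1 e \<Omega>1 + pair_volumes 1 1 1 1 e \<Omega>2)"
    unfolding \<Phi>_frame[OF e u u u u] \<delta>_def[symmetric] d pair_volumes_def
    by (simp add: algebra_simps power4_eq_xxxx power2_eq_square)
  also have "\<dots> = (c\<^sup>2 + s\<^sup>2)\<^sup>2" unfolding V by (simp add: power2_eq_square power4_eq_xxxx algebra_simps)
  finally show ?thesis unfolding u by simp
qed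

lemma unitary_basis_inj:
  assumes "unitary_basis e"
  shows "e i = e j \<longleftrightarrow> i = j"
proof
  assume "e i = e j"
  then have "herm (e i) (e j) = 1" using unitary_basisD[OF assms, of i i] by simp
  then show "i = j" unfolding unitary_basisD[OF assms] by (simp split: if_splits)
qed simp

lemma vec_independent_unitary:
  assumes e: "unitary_basis (e :: 8 \<Rightarrow> C8)"
  shows "vec.independent (e ` A)"
proof
  assume "vec.dependent (e ` A)"
  then obtain v u where v: "v \<in> e ` A" "u v \<noteq> 0" and z: "(\<Sum>w\<in>e ` A. u w *s w) = 0"
    using vec.dependent_finite[of "e ` A"] by auto
  obtain i where i: "v = e i" using v by blast
  have ii: "herm (e i) w = (if w = e i then 1 else 0)" if w: "w \<in> e ` A" for w
  proof -
    obtain j where "w = e j" using w by blast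
    then show ?thesis using unitary_basisD[OF e, of i j] unitary_basis_inj[OF e, of j i] by auto
  qed
  have hs: "herm x (\<Sum>w\<in>B. f w) = (\<Sum>w\<in>B. herm x (f w))" if "finite B" for x and f :: "C8 \<Rightarrow> C8" and B
    using that by (induction B rule: finite_induct) simp_all
  have "0 = herm (e i) (\<Sum>w\<in>e ` A. u w *s w)" unfolding z by simp
  also have "\<dots> = (\<Sum>w\<in>e ` A. u w * herm (e i) w)" by (simp add: hs)
  also have "\<dots> = (\<Sum>w\<in>e ` A. if w = e i then u w else 0)" by (rule sum.cong) (simp_all add: ii)
  also have "\<dots> = u v" using v(1) i by simp
  finally show False using v(2) by simp
qed

lemma frame_complex_plane:
  assumes e: "unitary_basis e"
  shows "complex_plane 4 (simple_vector (frame e 1 0 1 0 1 0 1 0))"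
proof -
  let ?vs = "[e 1, e 3, e 5, e 7]" and ?F = "frame e 1 0 1 0 1 0 1 0"
  let ?W = "vec.span (set ?vs)"
  have F: "?F = concat (map (\<lambda>v. [v, \<i> *s v]) ?vs)" by (simp add: frame_def plane_pair_def)
  have dist: "distinct ?vs" by (simp add: unitary_basis_inj[OF e])
  have "set ?vs = e ` {1, 3, 5, 7}" by simp
  then have ind: "vec.independent (set ?vs)" using vec_independent_unitary[OF e] by metis
  have "vec.dim ?W = card (set ?vs)"
    by (rule vec.dim_span_eq_card_independent[OF ind])
  then have dim: "vec.dim ?W = 4" using distinct_card[OF dist] by simp
  have "set ?F \<subseteq> ?W"
    unfolding F by (auto intro!: vec.span_base vec.span_scale)
  then have "simple_vector ?F \<in> Grass ?W (2 * 4)"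
    by (intro orthonormal_in_Grass frame_geometry(2)[OF e]) (simp_all add: length_frame)
  moreover have "simple_vector ?F = (\<lambda>\<phi>. 1 * simple_vector (concat (map (\<lambda>v. [v, \<i> *s v]) ?vs)) \<phi>)"
    unfolding F[symmetric] by simp
  ultimately show ?thesis
    unfolding complex_plane_def using dist ind dim vec.subspace_span
    by (intro exI[of _ ?W] conjI exI[of _ ?vs] exI[of _ "1::real"]) simp_all
qed

section \<open>Complex planes\<close>


definition complex_pairs :: "C8 list \<Rightarrow> C8 list" where
  "complex_pairs vs = concat (map (\<lambda>v. [v, \<i> *s v]) vs)"

lemma complex_pairs_simps:
  "complex_pairs [] = []" "complex_pairs (v # vs) = [v, \<i> *s v] @ complex_pairs vs"
  "complex_pairs (vs @ ws) = complex_pairs vs @ complex_pairs ws"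
  by (simp_all add: complex_pairs_def)

lemma length_complex_pairs: "length (complex_pairs vs) = 2 * length vs"
  by (induction vs) (simp_all add: complex_pairs_simps)

lemma alt_form_span_slot:
  fixes \<phi> :: "'v::real_vector list \<Rightarrow> real"
  assumes \<phi>: "alt_form (*\<^sub>R) n \<phi>" and l: "length L = n" "k < n"
    and A: "\<And>a. a \<in> A \<Longrightarrow> \<exists>i<n. i \<noteq> k \<and> L ! i = a" and y: "y \<in> span A"
  shows "\<phi> (L[k := x + y]) = \<phi> (L[k := x])"
proof -
  note M = multilinD[OF alt_formD(1)[OF \<phi>] l]
  have "subspace {z. \<phi> (L[k := z]) = 0}"
  proof (rule subspaceI)
    show "0 \<in> {z. \<phi> (L[k := z]) = 0}" using M(2)[of 0 0] by simp
  qed (simp_all add: M)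
  moreover have "\<phi> (L[k := a]) = 0" if a: "a \<in> A" for a
  proof -
    obtain i where "i < n" "i \<noteq> k" "L ! i = a" using A[OF a] by blast
    then show ?thesis using alt_formD(2)[OF \<phi>, of "L[k := a]" i k] l by simp
  qed
  ultimately have "\<phi> (L[k := y]) = 0" using span_induct[OF y] by blast
  then show ?thesis by (simp add: M)
qed

lemma complex_scale_in_real_span:
  fixes v :: C8
  assumes "v \<in> A" "\<i> *s v \<in> A"
  shows "a *s v \<in> span A"
proof -
  have "a *s v = Re a *\<^sub>R v + Im a *\<^sub>R (\<i> *s v)"
    unfolding scaleR_eq_of_real_scale vector_smult_assoc vector_sadd_rdistrib[symmetric]
    by (simp add: complex_eq[of a, symmetric] mult.commute)
  then show ?thesis using assms by (simp add: span_add span_base span_scale)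
qed

text \<open>Each Gram-Schmidt step changes the entries \<open>v, \<i>v\<close> by a common positive factor and by real
  combinations of earlier entries.\<close>

lemma complex_gram_schmidt:
  fixes vs :: "C8 list"
  assumes "vec.independent (set vs)" "distinct vs"
  shows "\<exists>fs r. length fs = length vs \<and>
    (\<forall>i<length fs. \<forall>j<length fs. herm (fs ! i) (fs ! j) = (if i = j then 1 else 0)) \<and>
    set fs \<subseteq> vec.span (set vs) \<and> 0 < r \<and>
    (\<forall>ys \<phi>. alt_form (*\<^sub>R) (2 * length vs + length ys) \<phi> \<longrightarrow>
      \<phi> (complex_pairs vs @ ys) = r * \<phi> (complex_pairs fs @ ys))"
  using assms
proof (induction vs rule: rev_induct)
  case Nil
  then show ?case by (intro exI[of _ "[]"] exI[of _ 1]) simp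
next
  case (snoc v vs)
  have ind: "vec.independent (set vs)" "v \<notin> vec.span (set vs)" and dist: "distinct vs"
    using snoc.prems by (simp_all add: vec.independent_insert)
  obtain fs r where l: "length fs = length vs"
    and on: "\<And>i j. i < length fs \<Longrightarrow> j < length fs \<Longrightarrow> herm (fs ! i) (fs ! j) = (if i = j then 1 else 0)"
    and sp: "set fs \<subseteq> vec.span (set vs)" and r: "0 < r"
    and IH: "\<And>ys \<phi>. alt_form (*\<^sub>R) (2 * length vs + length ys) \<phi> \<Longrightarrow>
      \<phi> (complex_pairs vs @ ys) = r * \<phi> (complex_pairs fs @ ys)"
    using snoc.IH[OF ind(1) dist] by metis
  let ?m = "length fs"
  define y where "y = (\<Sum>j<?m. herm (fs ! j) v *s fs ! j)"
  define w where "w = v - y"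
  define t where "t = norm w"
  define f where "f = inverse t *\<^sub>R w"
  have yspan: "y \<in> vec.span (set vs)"
    unfolding y_def using sp by (intro vec.span_sum vec.span_scale) auto
  then have w0: "w \<noteq> 0" using ind(2) by (auto simp: w_def)
  then have t: "0 < t" by (simp add: t_def)
  have wt: "w = t *\<^sub>R f" using t by (simp add: f_def)
  have hs: "herm x (\<Sum>j<k. g j) = (\<Sum>j<k. herm x (g j))" for x and g :: "nat \<Rightarrow> C8" and k
    by (induction k) simp_all
  have fw: "herm (fs ! i) f = 0" if i: "i < ?m" for i
  proof -
    have "herm (fs ! i) y = (\<Sum>j<?m. herm (fs ! j) v * (if i = j then 1 else 0))"
      unfolding y_def hs using on[OF i] by (intro sum.cong) auto
    also have "\<dots> = herm (fs ! i) v" using i by (simp add: if_distrib cong: if_cong)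
    finally show ?thesis by (simp add: f_def w_def)
  qed
  have ff: "herm f f = 1"
    unfolding f_def using t by (simp add: herm_self t_def[symmetric] power2_eq_square)
  have wf: "herm f (fs ! i) = 0" if "i < ?m" for i
    using fw[OF that] cnj_herm[of "fs ! i" f] by simp
  let ?fs = "fs @ [f]"
  have on': "herm (?fs ! i) (?fs ! j) = (if i = j then 1 else 0)" if "i < length ?fs" "j < length ?fs" for i j
    using that on ff fw wf by (auto simp: nth_append less_Suc_eq)
  have yv: "y \<in> vec.span (set (vs @ [v]))" using yspan vec.span_mono[of "set vs" "set (vs @ [v])"] by auto
  have "f \<in> vec.span (set (vs @ [v]))"
    unfolding f_def w_def scaleR_eq_of_real_scale
    by (intro vec.span_scale vec.span_diff yv vec.span_base) simp
  then have sp': "set ?fs \<subseteq> vec.span (set (vs @ [v]))"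
    using sp vec.span_mono[of "set vs" "set (vs @ [v])"] by auto
  have step: "\<phi> (complex_pairs (vs @ [v]) @ ys) = (r * t\<^sup>2) * \<phi> (complex_pairs ?fs @ ys)"
    if \<phi>: "alt_form (*\<^sub>R) (2 * length (vs @ [v]) + length ys) \<phi>" for ys \<phi>
  proof -
    let ?n = "2 * length (vs @ [v]) + length ys"
    let ?A = "set (complex_pairs fs)"
    let ?L = "complex_pairs fs @ [v, \<i> *s v] @ ys"
    let ?L1 = "complex_pairs fs @ [f, \<i> *s v] @ ys"
    have lA: "length (complex_pairs fs) = 2 * ?m" by (rule length_complex_pairs)
    have lL: "length ?L = ?n" "length ?L1 = ?n" using l lA by simp_all
    have A: "\<exists>i<?n. i \<noteq> k \<and> (complex_pairs fs @ zs) ! i = a" if "a \<in> ?A" "2 * ?m \<le> k" for a k zs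
    proof -
      obtain i where "i < 2 * ?m" "complex_pairs fs ! i = a" using \<open>a \<in> ?A\<close> lA by (auto simp: in_set_conv_nth)
      then show ?thesis using that(2) l lA by (intro exI[of _ i]) (simp add: nth_append)
    qed
    have inA: "x \<in> ?A \<and> \<i> *s x \<in> ?A" if "x \<in> set fs" for x
      using that by (auto simp: complex_pairs_def)
    have yA: "y \<in> span ?A"
      unfolding y_def using inA by (intro span_sum complex_scale_in_real_span) auto
    have "\<i> *s y = (\<Sum>j<?m. (\<i> * herm (fs ! j) v) *s fs ! j)"
      unfolding y_def vec_eq_iff by (simp add: sum_distrib_left mult.assoc)
    moreover have "(\<Sum>j<?m. (\<i> * herm (fs ! j) v) *s fs ! j) \<in> span ?A"
      using inA by (intro span_sum complex_scale_in_real_span) auto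
    ultimately have iyA: "\<i> *s y \<in> span ?A" by simp
    note M = multilinD(2)[OF alt_formD(1)[OF \<phi>]]
    have k: "2 * ?m < ?n" "2 * ?m + 1 < ?n" using l by simp_all
    have "\<phi> (complex_pairs (vs @ [v]) @ ys) = \<phi> (complex_pairs vs @ ([v, \<i> *s v] @ ys))"
      by (simp add: complex_pairs_simps)
    \<comment> \<open>The induction hypothesis allows an arbitrary tail; here the new pair is part
      of it.\<close>
    also have "\<dots> = r * \<phi> ?L" using IH[of "[v, \<i> *s v] @ ys" \<phi>] \<phi> by simp
    also have "?L = ?L[2 * ?m := t *\<^sub>R f + y]"
      using lA by (simp add: list_update_append wt[symmetric] w_def)
    also have "\<phi> \<dots> = \<phi> (?L[2 * ?m := t *\<^sub>R f])"
      by (rule alt_form_span_slot[OF \<phi> lL(1) k(1) A[OF _ order_refl] yA])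
    also have "\<dots> = t * \<phi> (?L[2 * ?m := f])" by (rule M[OF lL(1) k(1)])
    also have "?L[2 * ?m := f] = ?L1" using lA by (simp add: list_update_append)
    also have "?L1 = ?L1[2 * ?m + 1 := t *\<^sub>R (\<i> *s f) + \<i> *s y]"
    proof -
      have "t *\<^sub>R (\<i> *s f) + \<i> *s y = \<i> *s (t *\<^sub>R f + y)"
        unfolding scaleR_eq_of_real_scale by (simp add: vec_eq_iff algebra_simps)
      then have "t *\<^sub>R (\<i> *s f) + \<i> *s y = \<i> *s v" by (simp add: wt[symmetric] w_def)
      then show ?thesis using lA by (simp add: list_update_append)
    qed
    also have "\<phi> \<dots> = \<phi> (?L1[2 * ?m + 1 := t *\<^sub>R (\<i> *s f)])"
      by (rule alt_form_span_slot[OF \<phi> lL(2) k(2) A iyA]) simp_all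
    also have "\<dots> = t * \<phi> (?L1[2 * ?m + 1 := \<i> *s f])" by (rule M[OF lL(2) k(2)])
    also have "?L1[2 * ?m + 1 := \<i> *s f] = complex_pairs ?fs @ ys"
      using lA by (simp add: list_update_append complex_pairs_simps)
    finally show ?thesis by (simp add: power2_eq_square)
  qed
  have "0 < r * t\<^sup>2" using r t by simp
  moreover have "length ?fs = length (vs @ [v])" using l by simp
  ultimately show ?case using on' sp' step by blast
qed

text \<open>An arbitrary complex basis is first made unitary at the cost of a positive factor. Unit
  norm makes the square of the total factor 1 and positivity makes the factor itself 1; this is
  where the complex orientation enters.\<close>

lemma complex_plane_calibrated:
  assumes \<xi>: "\<xi> \<in> Grass UNIV 8" and cp: "complex_plane 4 \<xi>"
  shows "\<xi> \<Phi> = 1"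
proof -
  obtain vs c where vs: "distinct vs" "length vs = 4" "vec.independent (set vs)" "0 < c"
    and \<xi>c: "\<xi> = (\<lambda>\<phi>. c * simple_vector (complex_pairs vs) \<phi>)"
    using cp unfolding complex_plane_def complex_pairs_def by blast
  obtain fs r where fs: "length fs = 4" "0 < r"
    and on: "\<forall>i<4. \<forall>j<4. herm (fs ! i) (fs ! j) = (if i = j then 1 else 0)"
    and gs: "\<And>\<phi>. alt_form (*\<^sub>R) 8 \<phi> \<Longrightarrow> \<phi> (complex_pairs vs) = r * \<phi> (complex_pairs fs)"
  proof -
    obtain fs r where "length fs = length vs" "0 < r"
      "\<forall>i<length fs. \<forall>j<length fs. herm (fs ! i) (fs ! j) = (if i = j then 1 else 0)"
      "\<forall>ys \<phi>. alt_form (*\<^sub>R) (2 * length vs + length ys) \<phi> \<longrightarrow>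
        \<phi> (complex_pairs vs @ ys) = r * \<phi> (complex_pairs fs @ ys)"
      using complex_gram_schmidt[OF vs(3,1)] by blast
    moreover from this(4)[rule_format, of "[]"] vs(2)
    have "\<phi> (complex_pairs vs) = r * \<phi> (complex_pairs fs)" if "alt_form (*\<^sub>R) 8 \<phi>" for \<phi>
      using that by simp
    ultimately show thesis using that[of fs r] vs(2) by simp
  qed
  obtain f1 f2 f3 f4 where f: "fs = [f1, f2, f3, f4]" by (rule length_4_list[OF fs(1)])
  let ?F = "[f1, \<i> *s f1, f2, \<i> *s f2, f3, \<i> *s f3, f4, \<i> *s f4]"
  have F: "complex_pairs fs = ?F" unfolding f complex_pairs_def by simp
  note h = on[unfolded f all_less_4, simplified]
  have L: "length ?F = 8" by simp
  have onF: "orthonormal_list ?F"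
    unfolding orthonormal_list_def L all_less_8 by (simp add: inner_eq_Re_herm h)
  have adF: "adapted \<omega> ?F"
    unfolding adapted_def L all_less_8 by (simp add: \<omega>_eq_Im_herm h)
  have lv: "length (complex_pairs vs) = 8" by (simp add: length_complex_pairs vs(2))
  have \<xi>F: "\<xi> \<phi> = c * r * \<phi> ?F" if "alt_form (*\<^sub>R) 8 \<phi>" for \<phi>
    unfolding \<xi>c using simple_vector_apply[OF that lv] gs[OF that] F by simp
  obtain xs where xs: "\<xi> = simple_vector xs" "length xs = 8" "gram_det xs = 1"
    using \<xi> unfolding Grass_def simple_norm_def by auto
  have "gram_det xs = (c * r)\<^sup>2"
  proof (rule gram_det_proportional[OF _ onF])
    fix \<phi> :: "C8 list \<Rightarrow> real" assume "alternating_form (length ?F) \<phi>"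
    then have a: "alt_form (*\<^sub>R) 8 \<phi>" unfolding L alternating_form_iff_alt_form .
    show "\<phi> xs = c * r * \<phi> ?F" using \<xi>F[OF a] unfolding xs(1) simple_vector_apply[OF a xs(2)] .
  qed (simp add: xs(2))
  then have "(c * r)\<^sup>2 = 1\<^sup>2" using xs(3) by simp
  then have cr: "c * r = 1" by (rule power2_eq_imp_eq) (use vs(4) fs(2) in simp_all)
  have v0: "vol4 i j k l [a, \<i> *s a, b, \<i> *s b] = 0" for i j k l a b
    using vol4_plane_pair[of i j k l a a 1 0 b b 1 0] by (simp add: plane_pair_def)
  have \<Omega>0: "\<Omega>12 ?F = 0"
    using alt_form_slot[OF alt_form_\<Omega>12, of ?F 1 0 1 0 f1] by simp
  have \<omega>1: "\<omega> [a, \<i> *s a] = 1" if "herm a a = 1" for a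
    using that by (simp add: \<omega>_eq_Im_herm)
  have "\<Phi> ?F = 1"
    unfolding \<Phi>_adapted[OF adF refl] \<Omega>0 using h by (simp add: \<omega>1 \<Omega>_eq_vol4 v0)
  then show ?thesis unfolding \<xi>F[OF alt_form_\<Phi>(5)] cr by simp
qed

text \<open>With p and q the two Kaehler values, Hadamard gives |V|^2 \<le> (1 - p^2) (1 - q^2),
  while Re V = 1 - p q. The square of 1 - p q exceeds that bound by (p - q)^2, so nothing is left
  for the imaginary part.\<close>

lemma cayley_volume_real:
  assumes on: "orthonormal_list [a, b, c, d]" and ad: "adapted \<omega> [a, b, c, d]"
    and d: "distinct [i, j, k, l]"
    and cal: "Re (vol4 i j k l [a, b, c, d]) + \<omega> [a, b] * \<omega> [c, d] = 1"
  shows "Im (vol4 i j k l [a, b, c, d]) = 0"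
proof -
  let ?V = "vol4 i j k l [a, b, c, d]"
  define p q where "p = \<omega> [a, b]" and "q = \<omega> [c, d]"
  \<comment> \<open>Removing the component along \<i> a changes no complex minor and shortens the
    squared length from 1 to 1 - p^2; likewise for d. This sharpens Hadamard's bound.\<close>
  define b' d' where "b' = b - p *\<^sub>R (\<i> *s a)" and "d' = d - q *\<^sub>R (\<i> *s c)"
  have m: "minor2 x (y - t *\<^sub>R (\<i> *s x)) i j = minor2 x y i j" for x y t i j
    unfolding minor2_def scaleR_eq_of_real_scale by (simp add: algebra_simps)
  have V: "?V = vol4 i j k l [a, b', c, d']"
    unfolding vol4_minor2 b'_def d'_def m ..
  have in4: "[a, b, c, d] ! i \<bullet> [a, b, c, d] ! j = (if i = j then 1 else 0)" if "i < 4" "j < 4" for i j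
    using on that unfolding orthonormal_list_def by simp
  have unit: "herm x x = 1" if "x \<bullet> x = 1" for x :: C8
    using that by (simp add: herm_self power2_norm_eq_inner)
  have aa: "herm a a = 1" "herm b b = 1" "herm c c = 1" "herm d d = 1"
    using in4[of 0 0] in4[of 1 1] in4[of 2 2] in4[of 3 3] by (simp_all add: unit)
  have ab: "herm a b = \<i> * of_real p" "herm c d = \<i> * of_real q"
    using in4[of 0 1] in4[of 2 3]
    by (simp_all add: p_def q_def \<omega>_eq_Im_herm complex_eq_iff inner_eq_Re_herm)
  have ba: "herm b a = - (\<i> * of_real p)" "herm d c = - (\<i> * of_real q)"
    using cnj_herm[of a b] cnj_herm[of c d] ab by simp_all
  have hb: "herm b' b' = of_real (1 - p\<^sup>2)" "herm d' d' = of_real (1 - q\<^sup>2)"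
    unfolding b'_def d'_def by (simp_all add: aa ab ba power2_eq_square algebra_simps)
  have n: "(norm (x $ i))\<^sup>2 + (norm (x $ j))\<^sup>2 + (norm (x $ k))\<^sup>2 + (norm (x $ l))\<^sup>2 \<le> t"
    if x: "herm x x = of_real t" for x :: C8 and t
    by (rule sum_norm_4_le[OF x d])
  have nn: "0 \<le> t" if "herm x x = complex_of_real t" for x :: C8 and t
  proof -
    have "t = (norm x)\<^sup>2" using that unfolding herm_self by (simp only: of_real_eq_iff)
    then show ?thesis by simp
  qed
  note pq = nn[OF hb(1)] nn[OF hb(2)]
  have n1: "(norm (x $ i))\<^sup>2 + (norm (x $ j))\<^sup>2 + (norm (x $ k))\<^sup>2 + (norm (x $ l))\<^sup>2 \<le> 1"
    if "herm x x = 1" for x :: C8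
    using n[of x 1] that by simp
  have "(norm ?V)\<^sup>2 \<le> 1 * (1 - p\<^sup>2) * (1 * (1 - q\<^sup>2))"
    unfolding V
    by (rule order_trans[OF vol4_hadamard]) (intro mult_mono n1 n aa hb; insert pq, simp)
  then have "(Re ?V)\<^sup>2 + (Im ?V)\<^sup>2 \<le> (1 - p\<^sup>2) * (1 - q\<^sup>2)" unfolding cmod_power2 by simp
  moreover have "Re ?V = 1 - p * q" using cal by (simp add: p_def q_def)
  moreover have "(1 - p * q)\<^sup>2 = (1 - p\<^sup>2) * (1 - q\<^sup>2) + (p - q)\<^sup>2"
    by (simp add: power2_eq_square algebra_simps)
  ultimately have "(p - q)\<^sup>2 + (Im ?V)\<^sup>2 \<le> 0" by simp
  then show ?thesis by (simp add: sum_power2_le_zero_iff)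
qed

text \<open>Because both volumes are real, the real part of their product is the product of their
  real parts, and \<Phi> factors into the two Cayley values.\<close>

lemma cayley_product_calibrated:
  assumes c1: "cayley1 \<xi>1" and c2: "cayley2 \<xi>2"
  shows "vwedge \<xi>1 4 4 \<xi>2 \<Phi> = 1"
proof -
  have g: "\<xi>1 \<in> Grass X1 (2 * 2)" "\<xi>2 \<in> Grass X2 (2 * 2)" using c1 c2 unfolding cayley_iff by simp_all
  obtain us where us: "length us = 2 * 2" "set us \<subseteq> X1" "orthonormal_list us" "adapted \<omega> us" "\<xi>1 = simple_vector us"
    by (rule Grass_adapted[OF g(1) X1_subspace zero_less_numeral])
  obtain vs where vs: "length vs = 2 * 2" "set vs \<subseteq> X2" "orthonormal_list vs" "adapted \<omega> vs" "\<xi>2 = simple_vector vs"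
    by (rule Grass_adapted[OF g(2) X2_subspace zero_less_numeral])
  have l: "length us = 4" "length vs = 4" using us(1) vs(1) by simp_all
  have v1: "cayley_form1 us = 1" "cayley_form2 vs = 1"
    using c1 c2 us(5) vs(5) simple_vector_apply[OF alt_form_cayley(1) l(1)]
      simple_vector_apply[OF alt_form_cayley(2) l(2)] unfolding cayley_iff by simp_all
  obtain a b c d where u: "us = [a, b, c, d]" by (rule length_4_list[OF l(1)])
  obtain a' b' c' d' where v: "vs = [a', b', c', d']" by (rule length_4_list[OF l(2)])
  let ?W = "[a, b, c, d, a', b', c', d']"
  let ?w = "\<Omega>1 [a, b, c, d]" and ?w' = "\<Omega>2 [a', b', c', d']"
  have X: "a \<in> X1" "b \<in> X1" "c \<in> X1" "d \<in> X1" "a' \<in> X2" "b' \<in> X2" "c' \<in> X2" "d' \<in> X2"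
    using us(2) vs(2) unfolding u v by auto
  have \<xi>: "vwedge \<xi>1 4 4 \<xi>2 = simple_vector ?W"
    using vwedge_simple[of us vs] unfolding l us(5)[symmetric] vs(5)[symmetric] by (simp add: u v)
  have adu: "\<omega> [us ! i, us ! j] = 0" "\<omega> [vs ! i, vs ! j] = 0" if "i < 4" "j < 4" "i div 2 \<noteq> j div 2" for i j
    using us(4) vs(4) that unfolding adapted_def l by blast+
  have z: "\<omega> [x, y] = 0 \<and> \<omega> [y, x] = 0" if "x \<in> X1" "y \<in> X2" for x y
    using kaehler_restrict(3,4) that by blast
  have L: "length ?W = 8" by simp
  have ad: "adapted \<omega> ?W"
    unfolding adapted_def L all_less_8
    using adu[of 0 2] adu[of 0 3] adu[of 1 2] adu[of 1 3] adu[of 2 0] adu[of 3 0] adu[of 2 1] adu[of 3 1]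
    by (simp add: u v z X)
  have cal: "Re ?w + \<omega> [a, b] * \<omega> [c, d] = 1" "Re ?w' + \<omega> [a', b'] * \<omega> [c', d'] = 1"
    using cayley_form_adapted(1)[OF us(4)[unfolded u]] cayley_form_adapted(2)[OF vs(4)[unfolded v]] us(2) vs(2) v1
    unfolding u v by simp_all
  have Im: "Im ?w = 0" "Im ?w' = 0"
    using cayley_volume_real[OF us(3)[unfolded u] us(4)[unfolded u], of 1 2 3 4]
      cayley_volume_real[OF vs(3)[unfolded v] vs(4)[unfolded v], of 5 6 7 8] cal
    unfolding \<Omega>_eq_vol4 by simp_all
  have 12: "\<Omega>12 ?W = ?w * ?w'"
    using \<Omega>12_block[of ?W] X by (simp add: all_less_4)
  have zero: "\<Omega>2 [a, b, c, d] = 0" "\<Omega>1 [a', b', c', d'] = 0" "\<Omega>1 [a, b, a', b'] = 0" "\<Omega>2 [a, b, a', b'] = 0"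
    "\<Omega>1 [a, b, c', d'] = 0" "\<Omega>2 [a, b, c', d'] = 0" "\<Omega>1 [c, d, a', b'] = 0" "\<Omega>2 [c, d, a', b'] = 0"
    "\<Omega>1 [c, d, c', d'] = 0" "\<Omega>2 [c, d, c', d'] = 0"
    using X unfolding \<Omega>_eq_vol4 vol4_eq X1_def X2_def by simp_all
  have "\<Phi> ?W = (Re ?w + \<omega> [a, b] * \<omega> [c, d]) * (Re ?w' + \<omega> [a', b'] * \<omega> [c', d'])"
    unfolding \<Phi>_adapted[OF ad refl] 12 zero by (simp add: Im algebra_simps)
  then show ?thesis unfolding \<xi> cal using simple_vector_apply[OF alt_form_\<Phi>(5) L] by simp
qed

theorem theorem1p5:
  fixes \<xi> :: "C8 multivector"
  assumes "\<xi> \<in> Grass UNIV 8"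
  shows "calibrates \<Phi> \<xi> \<longleftrightarrow>
      special_lagrangian \<xi>
    \<or> complex_plane 4 \<xi>
    \<or> (\<exists>\<xi>1 \<xi>2. cayley1 \<xi>1 \<and> cayley2 \<xi>2 \<and> \<xi> = vwedge \<xi>1 4 4 \<xi>2)
    \<or> (\<exists>e \<theta>1 \<theta>2 \<theta>3 \<theta>4 U1 U2 S.
          normal_form \<xi> e \<theta>1 \<theta>2 \<theta>3 \<theta>4
        \<and> \<theta>1 = \<theta>2 \<and> \<theta>2 = \<theta>3 \<and> \<theta>3 = \<theta>4
        \<and> S \<in> Sp4 \<and> U1 \<in> SU4 \<and> U2 \<in> SU4
        \<and> matrix_of_columns e = block_diag U1 U2 ** S)"
proof -
  obtain e c1 s1 c2 s2 c3 s3 c4 s4 where e: "unitary_basis e"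
    and u: "c1\<^sup>2 + s1\<^sup>2 = 1" "c2\<^sup>2 + s2\<^sup>2 = 1" "c3\<^sup>2 + s3\<^sup>2 = 1" "c4\<^sup>2 + s4\<^sup>2 = 1"
    and nn: "0 \<le> c1" "0 \<le> c2" "0 \<le> c3" "0 \<le> s1" "0 \<le> s2" "0 \<le> s3" "0 \<le> s4"
    and \<xi>: "\<xi> = simple_vector (frame e c1 s1 c2 s2 c3 s3 c4 s4)"
    by (rule frame_exists[OF assms])
  let ?F = "frame e c1 s1 c2 s2 c3 s3 c4 s4"
  have val: "\<xi> \<phi> = \<phi> ?F" if "alt_form (*\<^sub>R) 8 \<phi>" for \<phi>
    unfolding \<xi> by (rule simple_vector_apply[OF that length_frame])
  have cal: "calibrates \<Phi> \<xi> \<longleftrightarrow> \<Phi> ?F = 1"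
    unfolding calibrates_def val[OF alt_form_\<Phi>(5)] ..
  have nf: "normal_form \<xi>' e' \<theta> \<theta> \<theta> \<theta> \<longleftrightarrow> unitary_basis e' \<and> 0 \<le> \<theta> \<and> \<theta> \<le> pi / 2 \<and>
      \<xi>' = simple_vector (frame e' (cos \<theta>) (sin \<theta>) (cos \<theta>) (sin \<theta>) (cos \<theta>) (sin \<theta>) (cos \<theta>) (sin \<theta>))"
    for \<xi>' e' \<theta>
    unfolding normal_form_def frame_def plane_pair_def append.simps using pi_ge_zero by auto
  show ?thesis (is "_ \<longleftrightarrow> ?SL \<or> ?CP \<or> ?Cay \<or> ?Sp")
  proof
    assume "calibrates \<Phi> \<xi>"
    then have \<Phi>: "\<Phi> ?F = 1" unfolding cal .
    from frame_equality_cases[OF e u nn \<Phi>] consider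
        (complex) "s1 = 0 \<and> s2 = 0 \<and> s3 = 0 \<and> s4 = 0"
      | (lagrangian) "c1 = 0" "c2 = 0" "c3 = 0" "c4 = 0"
      | (pairing) "1 \<le> norm (\<Omega>1 [e 1, e 2, e 3, e 4]) + norm (\<Omega>1 [e 5, e 6, e 7, e 8])
          \<or> 1 \<le> norm (\<Omega>1 [e 1, e 2, e 5, e 6]) + norm (\<Omega>1 [e 3, e 4, e 7, e 8])
          \<or> 1 \<le> norm (\<Omega>1 [e 1, e 2, e 7, e 8]) + norm (\<Omega>1 [e 3, e 4, e 5, e 6])"
      | (equal) "c2 = c1" "c3 = c1" "c4 = c1" "s2 = s1" "s3 = s1" "s4 = s1"
          "pair_volumes 1 1 1 1 e \<Omega>1 = 1" "pair_volumes 1 1 1 1 e \<Omega>2 = 1"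
      by argo
    then show "?SL \<or> ?CP \<or> ?Cay \<or> ?Sp"
    proof cases
      case complex
      then have c: "c1 = 1" "c2 = 1" "c3 = 1" using u nn by (simp_all add: power2_eq_1_iff)
      \<comment> \<open>With all sines zero \<Phi> is the product of the cosines, which decides the
        sign of \<open>c4\<close> and with it the complex orientation.\<close>
      then have "c4 = 1" using \<Phi> complex \<Phi>_frame[OF e u] by simp
      then show ?thesis using frame_complex_plane[OF e] complex c unfolding \<xi> by simp
    next
      case lagrangian
      then show ?thesis using frame_special_lagrangian[OF e u lagrangian \<Phi>] unfolding \<xi> by blast
    next
      case pairing
      then show ?thesis using frame_pairing_case[OF e u pairing \<Phi>] unfolding \<xi> by blast
    next
      case equal
      have c1: "- 1 \<le> c1" "c1 \<le> 1" using u(1) nn(1) by (smt (verit) zero_le_power2 power2_le_imp_le power_one)+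
      have "s1 = sqrt (1 - c1\<^sup>2)" using u(1) nn(4) by (metis add_diff_cancel_left' real_sqrt_unique)
      \<comment> \<open>Both \<open>c1\<close> and \<open>s1\<close> are non-negative, so the common
        angle lies in the first quadrant, as the normal form demands.\<close>
      then have \<theta>: "cos (arccos c1) = c1" "sin (arccos c1) = s1" "0 \<le> arccos c1" "arccos c1 \<le> pi / 2"
        using c1 nn(1) arccos_le_pi2 by (simp_all add: sin_arccos arccos_lbound)
      have "normal_form \<xi> e (arccos c1) (arccos c1) (arccos c1) (arccos c1)"
        unfolding nf \<theta>(1,2) using e \<theta>(3,4) \<xi> equal by simp
      then show ?thesis using symplectic_frame[OF e equal(7,8)] by blast
    qed
  next
    assume "?SL \<or> ?CP \<or> ?Cay \<or> ?Sp"
    then show "calibrates \<Phi> \<xi>"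
    proof (elim disjE exE conjE)
      assume ?SL
      then have "Re (\<Omega>12 ?F) = 1"
        unfolding special_lagrangian_def calibrates_def \<Omega>12_def[symmetric] using val[OF alt_form_\<Phi>(1)] by simp
      then have \<delta>: "s1 * s2 * s3 * s4 * Re (\<Omega>12 [e 1, e 2, e 3, e 4, e 5, e 6, e 7, e 8]) = 1"
        unfolding \<Omega>12_frame by simp
      let ?s = "\<bar>s1 * s2 * s3 * s4\<bar>"
      have "\<bar>Re (\<Omega>12 [e 1, e 2, e 3, e 4, e 5, e 6, e 7, e 8])\<bar> \<le> 1"
        using abs_Re_le_cmod[of "\<Omega>12 [e 1, e 2, e 3, e 4, e 5, e 6, e 7, e 8]"] norm_\<Omega>12_unitary[OF e] by simp
      then have "?s * \<bar>Re (\<Omega>12 [e 1, e 2, e 3, e 4, e 5, e 6, e 7, e 8])\<bar> \<le> ?s * 1"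
        by (rule mult_left_mono) simp
      \<comment> \<open>The product of the sines has modulus at least 1, which leaves no room for
        the cosines; every other term of \<Phi> then vanishes.\<close>
      then have "1 \<le> ?s" using arg_cong[OF \<delta>, of abs] by (simp add: abs_mult)
      then have "\<bar>c1 * c2 * c3 * c4\<bar> + ?s = 1"
        using unit_pairs_product(1)[OF u] by linarith
      then have "(s1 = 0 \<and> s2 = 0 \<and> s3 = 0 \<and> s4 = 0) \<or> (c1 = 0 \<and> c2 = 0 \<and> c3 = 0 \<and> c4 = 0)"
        by (rule unit_pairs_product(2)[OF u])
      then have "c1 = 0" "c2 = 0" "c3 = 0" "c4 = 0" using \<delta> by auto
      then show ?thesis unfolding cal using \<Phi>_frame[OF e u] \<delta> by simp
    next
      assume ?CP
      then show ?thesis unfolding calibrates_def by (rule complex_plane_calibrated[OF assms])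
    next
      fix \<xi>1 \<xi>2 assume "cayley1 \<xi>1" "cayley2 \<xi>2" "\<xi> = vwedge \<xi>1 4 4 \<xi>2"
      then show ?thesis unfolding calibrates_def using cayley_product_calibrated by simp
    next
      fix e' \<theta>1 \<theta>2 \<theta>3 \<theta>4 U1 U2 S
      assume n: "normal_form \<xi> e' \<theta>1 \<theta>2 \<theta>3 \<theta>4" and eq: "\<theta>1 = \<theta>2" "\<theta>2 = \<theta>3" "\<theta>3 = \<theta>4"
        and S: "S \<in> Sp4" "U1 \<in> SU4" "U2 \<in> SU4" "matrix_of_columns e' = block_diag U1 U2 ** S"
      let ?c = "cos \<theta>4" and ?s = "sin \<theta>4"
      have e': "unitary_basis e'" and \<xi>': "\<xi> = simple_vector (frame e' ?c ?s ?c ?s ?c ?s ?c ?s)"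
        using n unfolding eq nf by blast+
      have "\<Phi> (frame e' ?c ?s ?c ?s ?c ?s ?c ?s) = 1"
        by (rule equal_angles_calibrated[OF e' _ symplectic_frame_volumes[OF S]]) simp
      then show ?thesis
        unfolding calibrates_def \<xi>' simple_vector_apply[OF alt_form_\<Phi>(5) length_frame] .
    qed
  qed
qed

end
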